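(* Let $(T(t))_{t\ge0}$ be a uniformly bounded $C_0$-semigroup on a Hilbert space $H$ with generator $A$ such that $i\mathbb{R}\subset\varrho(A)$. The following three assertions hold for a fixed $\alpha>0$. (a) For $\gamma\in(0,1/2)$, let $(\mathrm{P}_\gamma)$ denote the condition that $$\lim_{\xi\to0+}\xi^{1-2\gamma}\int_{-\infty}^{\infty}\|R(\xi+i\eta,A)(-A)^{-\alpha\gamma}x\|^2\,d\eta=0\qquad\text{for all }x\in H.$$ Then the following are equivalent: $\|T(t)(-A)^{-\alpha}\|=O(1/t)$ as $t\to\infty$; $(\mathrm{P}_\gamma)$ holds for some $\gamma\in(0,1/2)$; $(\mathrm{P}_\gamma)$ holds for all $\gamma\in(0,1/2)$. (b) If $\|T(t)(-A)^{-\alpha}\|=O(1/t)$ as $t\to\infty$, then $$\lim_{\xi\to0+}\frac{1}{\log(1/\xi)}\int_{-\infty}^{\infty}\|R(\xi+i\eta,A)(-A)^{-\alpha/2}x\|^2\,d\eta=0$$ for all $x\in H$. (c) If $$\lim_{\xi\to0+}\frac{1}{\log(1/\xi)}\int_{-\infty}^{\infty}\|R(\xi+i\eta,A)(-A)^{-\alpha/2}x\|^2\,d\eta=0$$ for all $x\in H$, then $$\|T(t)(-A)^{-\alpha}\|=O\left(\frac{\log t}{t}\right)\qquad (t\to\infty).$$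
   Context: All spaces are complex. $\varrho(A)$ is the resolvent set of $A$, $R(\lambda,A)=(\lambda I-A)^{-1}$ for $\lambda\in\varrho(A)$, and $i\mathbb{R}=\{i\eta:\eta\in\mathbb{R}\}$. A $C_0$-semigroup is uniformly bounded if $\sup_{t\ge0}\|T(t)\|<\infty$. $f(t)=O(g(t))$ as $t\to\infty$ means there are $M>0$ and $t_0$ with $f(t)\le M g(t)$ for all $t\ge t_0$. When $A$ generates a uniformly bounded $C_0$-semigroup and $0\in\varrho(A)$, $-A$ is sectorial and invertible, and the fractional powers $(-A)^{a}$, $a\in\mathbb{R}$, are those of the functional calculus for sectorial operators. In particular, for $a>0$, $(-A)^{-a}$ is the bounded injective operator determined by $(-A)^{-a}=\frac{\sin \pi a}{\pi}\int_0^\infty s^{-a}(sI-A)^{-1}ds$ for $0<a<1$ and $(-A)^{-(k+a)}=((-A)^{-1})^k(-A)^{-a}$ for $k\in\mathbb{N}$, $0\le a<1$ (with $(-A)^0=I$), and $(-A)^{a}$ is its inverse. *)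

theory Defs
  imports "HOL-Analysis.Analysis" "HOL-Library.Landau_Symbols"
begin

text \<open>
  Complex Hilbert spaces, layered over the library's real classes: real scalar multiplication and
  the real inner product are the restriction of \<open>scaleC\<close> and the real part of \<open>cinner\<close>, so that
  the norm is the one induced by \<open>cinner\<close>, which is linear in its first argument.
\<close>

class complex_hilbert_space = real_inner + banach +
  fixes scaleC :: "complex \<Rightarrow> 'a \<Rightarrow> 'a" (infixr \<open>*\<^sub>C\<close> 75)
    and cinner :: "'a \<Rightarrow> 'a \<Rightarrow> complex"
  assumes scaleC_add_right: "c *\<^sub>C (x + y) = c *\<^sub>C x + c *\<^sub>C y"
    and scaleC_add_left: "(c + d) *\<^sub>C x = c *\<^sub>C x + d *\<^sub>C x"
    and scaleC_scaleC: "c *\<^sub>C (d *\<^sub>C x) = (c * d) *\<^sub>C x"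
    and scaleC_of_real: "complex_of_real r *\<^sub>C x = r *\<^sub>R x"
    and cinner_commute: "cinner x y = cnj (cinner y x)"
    and cinner_add_left: "cinner (x + y) z = cinner x z + cinner y z"
    and cinner_scaleC_left: "cinner (c *\<^sub>C x) y = c * cinner x y"
    and Re_cinner: "Re (cinner x y) = x \<bullet> y"

text \<open>
  Bounded operators are elements of \<open>'a \<Rightarrow>\<^sub>L 'a\<close>, whose norm is the operator norm. That type only
  ensures real linearity, hence the explicit complex homogeneity below. Values of \<open>T\<close> at negative
  times are irrelevant.
\<close>

definition C0_semigroup :: "(real \<Rightarrow> 'a::complex_hilbert_space \<Rightarrow>\<^sub>L 'a) \<Rightarrow> bool" where
  "C0_semigroup T \<longleftrightarrow>
     (\<forall>t\<ge>0. \<forall>c x. T t (c *\<^sub>C x) = c *\<^sub>C T t x) \<and>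
     T 0 = id_blinfun \<and>
     (\<forall>s\<ge>0. \<forall>t\<ge>0. T (s + t) = T s o\<^sub>L T t) \<and>
     (\<forall>x. ((\<lambda>t. T t x) \<longlongrightarrow> x) (at_right 0))"

definition uniformly_bounded_semigroup :: "(real \<Rightarrow> 'a::complex_hilbert_space \<Rightarrow>\<^sub>L 'a) \<Rightarrow> bool" where
  "uniformly_bounded_semigroup T \<longleftrightarrow> C0_semigroup T \<and> bdd_above ((\<lambda>t. norm (T t)) ` {0..})"

text \<open>
  An unbounded operator is given by its domain \<open>D\<close> and a total function \<open>A\<close>, of which only the
  values on \<open>D\<close> matter.
\<close>

definition is_generator ::
    "(real \<Rightarrow> 'a::complex_hilbert_space \<Rightarrow>\<^sub>L 'a) \<Rightarrow> 'a set \<Rightarrow> ('a \<Rightarrow> 'a) \<Rightarrow> bool" where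
  "is_generator T D A \<longleftrightarrow>
     D = {x. \<exists>y. ((\<lambda>h. (T h x - x) /\<^sub>R h) \<longlongrightarrow> y) (at_right 0)} \<and>
     (\<forall>x\<in>D. ((\<lambda>h. (T h x - x) /\<^sub>R h) \<longlongrightarrow> A x) (at_right 0))"

definition resolvent_set :: "'a::complex_hilbert_space set \<Rightarrow> ('a \<Rightarrow> 'a) \<Rightarrow> complex set" where
  "resolvent_set D A =
     {z. bij_betw (\<lambda>x. z *\<^sub>C x - A x) D UNIV \<and>
         bounded_linear (inv_into D (\<lambda>x. z *\<^sub>C x - A x))}"

definition resolvent ::
    "'a::complex_hilbert_space set \<Rightarrow> ('a \<Rightarrow> 'a) \<Rightarrow> complex \<Rightarrow> 'a \<Rightarrow>\<^sub>L 'a" where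
  "resolvent D A z = Blinfun (inv_into D (\<lambda>x. z *\<^sub>C x - A x))"

text \<open>
  \<open>inv_frac_power D A a\<close> is $(-A)^{-a}$ for $a \ge 0$. Here $(-A)^{-1}$ is the resolvent at 0, and
  the integral is an absolutely convergent integral in the Banach space \<open>'a \<Rightarrow>\<^sub>L 'a\<close>; it is taken
  in the Henstock-Kurzweil sense because the library's Bochner integral requires a separable space.
\<close>

definition inv_frac_power ::
    "'a::complex_hilbert_space set \<Rightarrow> ('a \<Rightarrow> 'a) \<Rightarrow> real \<Rightarrow> 'a \<Rightarrow>\<^sub>L 'a" where
  "inv_frac_power D A a =
     ((o\<^sub>L) (resolvent D A 0) ^^ nat \<lfloor>a\<rfloor>)
       (if frac a = 0 then id_blinfun
        else (sin (pi * frac a) / pi) *\<^sub>R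
          integral {0<..} (\<lambda>s. s powr (- frac a) *\<^sub>R resolvent D A (complex_of_real s)))"

text \<open>
  For the generator of a uniformly bounded semigroup and \<open>\<xi> > 0\<close> this integral is always finite,
  by Plancherel's theorem, so the convention that non-integrable functions have integral 0 plays
  no role.
\<close>

definition resolvent_sq_integral ::
    "'a::complex_hilbert_space set \<Rightarrow> ('a \<Rightarrow> 'a) \<Rightarrow> real \<Rightarrow> 'a \<Rightarrow> real" where
  "resolvent_sq_integral D A \<xi> y = (LBINT \<eta>. (norm (resolvent D A (Complex \<xi> \<eta>) y))\<^sup>2)"

definition cond_P :: "'a::complex_hilbert_space set \<Rightarrow> ('a \<Rightarrow> 'a) \<Rightarrow> real \<Rightarrow> real \<Rightarrow> bool" where
  "cond_P D A \<alpha> \<gamma> \<longleftrightarrow>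
     (\<forall>x. ((\<lambda>\<xi>. \<xi> powr (1 - 2 * \<gamma>) *
              resolvent_sq_integral D A \<xi> (inv_frac_power D A (\<alpha> * \<gamma>) x)) \<longlongrightarrow> 0) (at_right 0))"

definition cond_log :: "'a::complex_hilbert_space set \<Rightarrow> ('a \<Rightarrow> 'a) \<Rightarrow> real \<Rightarrow> bool" where
  "cond_log D A \<alpha> \<longleftrightarrow>
     (\<forall>x. ((\<lambda>\<xi>. 1 / ln (1 / \<xi>) *
              resolvent_sq_integral D A \<xi> (inv_frac_power D A (\<alpha> / 2) x)) \<longlongrightarrow> 0) (at_right 0))"

end

theory Submission
  imports Defs "HOL-Probability.Probability" "HOL-Real_Asymp.Real_Asymp"
begin

text \<open>
  By Plancherel's theorem the resolvent integral of $y$ at $\xi$ equals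
  $2\pi\int_0^\infty e^{-2\xi t}\|T(t)y\|^2\,dt$, so the conditions are about the growth of this
  Laplace transform as $\xi \to 0$. If $\|T(t)(-A)^{-\alpha}\| = O(1/t)$, the moment inequality gives
  $\|T(t)(-A)^{-\alpha\gamma}\| = O(t^{-\gamma})$, which improves to $o(t^{-\gamma})$ on each vector
  because the domain of $A$ is dense; integrating yields the limits. Conversely
  $t\|T(t)y\|^2 \le K^2 e^2 \int_0^\infty e^{-2s/t}\|T(s)y\|^2\,ds$ turns the limits into pointwise
  bounds for $T(t)(-A)^{-\alpha\gamma}$, which the uniform boundedness principle makes uniform; the
  moment inequality (or squaring, for the exponent $\alpha/2$) then reaches $(-A)^{-\alpha}$.

  The semigroup law of the fractional powers is read off from
  $(e-A)^{-a} = \Gamma(a)^{-1}\int_0^\infty t^{a-1}e^{-et}T(t)\,dt$ in the limit $e \to 0$.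
\<close>

text \<open>No separability is assumed, so operator-valued integrals are gauge integrals, while
  Fubini, the fundamental theorem and Plancherel are applied to real functions such as
  \<open>T t x \<bullet> y\<close>. For a merely bounded semigroup the integral of t^(a-1) T(t) need
  not converge absolutely at infinity; the factor e^(-et) cures this, which is why the shift e > 0
  is there and is removed only at the end. The unbounded A is avoided by working with
  \<open>J\<close>, the inverse of -A, and cancelling \<open>J\<close> by injectivity. The moment
  inequality is proved only for exponents below 1. To reach every \<alpha> > 0 the exponent is first
  divided by a large integer, iterating the inequality for a pair h, 2h, then interpolated and
  multiplied up again. The logarithm appears because at \<gamma> = 1/2 the squared rate 1/t is not
  integrable at infinity: effectively cut off at 1/\<xi>, it contributes log(1/\<xi>).\<close>

section \<open>Integration in Banach spaces and uniform boundedness\<close>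

text \<open>Riemann sums of \<open>f - g\<close> are bounded in norm by those of \<open>h\<close>,
  hence small on fine divisions, so all fine Riemann sums of \<open>f\<close> cluster around the
  integral of \<open>g\<close>: the Cauchy criterion. Domination replaces measurability, so the
  values may lie in a nonseparable space such as the bounded operators.\<close>

lemma integrable_on_interval_approx:
  fixes f :: "'n::euclidean_space \<Rightarrow> 'b::banach"
  assumes "\<And>e. e > 0 \<Longrightarrow> \<exists>g h j. g integrable_on cbox a b \<and> (h has_integral j) (cbox a b) \<and>
             j < e \<and> (\<forall>x\<in>cbox a b. norm (f x - g x) \<le> h x)"
  shows "f integrable_on cbox a b"
  unfolding integrable_Cauchy
proof (intro allI impI)
  fix e :: real assume "e > 0"
  \<comment> \<open>Two errors \<open>e/6\<close> bound the sums of \<open>h\<close>, a third one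
    the sums of \<open>g\<close>: every fine sum of \<open>f\<close> is within \<open>e/2\<close> of
    \<open>i\<close>, and two of them are within \<open>e\<close> of each other.\<close>
  then have e: "e/6 > 0" by auto
  from assms[OF e] obtain g h j where g: "g integrable_on cbox a b" and h: "(h has_integral j) (cbox a b)"
    and j: "j < e/6" and fg: "\<And>x. x \<in> cbox a b \<Longrightarrow> norm (f x - g x) \<le> h x" by blast
  from g obtain i where gi: "(g has_integral i) (cbox a b)" by blast
  obtain d1 where "gauge d1" and d1: "\<And>p. \<lbrakk>p tagged_division_of cbox a b; d1 fine p\<rbrakk> \<Longrightarrow>
      norm ((\<Sum>(x,K)\<in>p. measure lborel K *\<^sub>R h x) - j) < e/6"
    by (rule has_integralD[OF h e]) blast
  obtain d2 where "gauge d2" and d2: "\<And>p. \<lbrakk>p tagged_division_of cbox a b; d2 fine p\<rbrakk> \<Longrightarrow>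
      norm ((\<Sum>(x,K)\<in>p. measure lborel K *\<^sub>R g x) - i) < e/6"
    by (rule has_integralD[OF gi e]) blast
  have main: "norm ((\<Sum>(x,K)\<in>p. measure lborel K *\<^sub>R f x) - i) < e/2"
    if p: "p tagged_division_of cbox a b" and "d1 fine p" "d2 fine p" for p
  proof -
    have "norm ((\<Sum>(x,K)\<in>p. measure lborel K *\<^sub>R f x) - (\<Sum>(x,K)\<in>p. measure lborel K *\<^sub>R g x))
        = norm (\<Sum>(x,K)\<in>p. measure lborel K *\<^sub>R (f x - g x))"
      unfolding sum_subtractf[symmetric] by (simp add: split_def scaleR_diff_right)
    also have "\<dots> \<le> (\<Sum>(x,K)\<in>p. measure lborel K *\<^sub>R h x)"
    proof (rule sum_norm_le, clarsimp)
      fix x K assume "(x,K) \<in> p"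
      then have "x \<in> cbox a b" using p by (meson tag_in_interval)
      then show "measure lborel K * norm (f x - g x) \<le> measure lborel K * h x"
        by (intro mult_left_mono fg) auto
    qed
    also have "\<dots> < e/6 + e/6" using d1[OF p \<open>d1 fine p\<close>] j unfolding real_norm_def by linarith
    finally have "dist (\<Sum>(x,K)\<in>p. measure lborel K *\<^sub>R f x) (\<Sum>(x,K)\<in>p. measure lborel K *\<^sub>R g x) < e/6 + e/6"
      by (simp add: dist_norm)
    moreover have "dist (\<Sum>(x,K)\<in>p. measure lborel K *\<^sub>R g x) i < e/6"
      using d2[OF p \<open>d2 fine p\<close>] by (simp add: dist_norm)
    moreover note dist_triangle[of "\<Sum>(x,K)\<in>p. measure lborel K *\<^sub>R f x" i
        "\<Sum>(x,K)\<in>p. measure lborel K *\<^sub>R g x"]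
    ultimately show ?thesis unfolding dist_norm[symmetric] by linarith
  qed
  show "\<exists>\<gamma>. gauge \<gamma> \<and> (\<forall>p1 p2. p1 tagged_division_of cbox a b \<and> \<gamma> fine p1 \<and>
      p2 tagged_division_of cbox a b \<and> \<gamma> fine p2 \<longrightarrow>
      norm ((\<Sum>(x,K)\<in>p1. measure lborel K *\<^sub>R f x) - (\<Sum>(x,K)\<in>p2. measure lborel K *\<^sub>R f x)) < e)"
    using \<open>gauge d1\<close> \<open>gauge d2\<close>
    by (intro exI[of _ "\<lambda>x. d1 x \<inter> d2 x"])
       (auto simp: fine_Int intro!: gauge_Int norm_triangle_half_l[OF main main])
qed

text \<open>Cauchy criterion at infinity: over nested intervals the integrals of \<open>f\<close>
  differ by an integral over the part between them, which is dominated by the corresponding one for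
  \<open>g\<close>. Local integrability is a separate hypothesis because that is where a singularity
  of \<open>f\<close> has to be treated.\<close>

lemma dominated_integrable_on:
  fixes f :: "real \<Rightarrow> 'b::banach"
  assumes loc: "\<And>a b. (\<lambda>x. if x \<in> S then f x else 0) integrable_on cbox a b"
    and fg: "\<And>x. x \<in> S \<Longrightarrow> norm (f x) \<le> g x" and g: "g integrable_on S"
  shows "f integrable_on S"
  unfolding integrable_alt_subset[of f]
proof (intro conjI allI impI loc)
  fix e :: real assume "e > 0"
  let ?F = "\<lambda>x. if x \<in> S then f x else 0" and ?G = "\<lambda>x. if x \<in> S then g x else 0"
  from g \<open>e > 0\<close> obtain B where "B > 0" and B: "\<And>a b c d. ball 0 B \<subseteq> cbox a b \<Longrightarrow> cbox a b \<subseteq> cbox c d \<Longrightarrow>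
      norm (integral (cbox a b) ?G - integral (cbox c d) ?G) < e"
    unfolding integrable_alt_subset[of g] by meson
  have gl: "?G integrable_on cbox a b" for a b using g by (rule integrable_altD(1))
  show "\<exists>B>0. \<forall>a b c d. ball 0 B \<subseteq> cbox a b \<and> cbox a b \<subseteq> cbox c d \<longrightarrow>
      norm (integral (cbox a b) ?F - integral (cbox c d) ?F) < e"
  proof (intro exI[of _ B] conjI allI impI \<open>B > 0\<close>)
    fix a b c d :: real assume *: "ball 0 B \<subseteq> cbox a b \<and> cbox a b \<subseteq> cbox c d"
    have r: "((\<lambda>x. if x \<in> cbox a b then h x else 0) has_integral integral (cbox a b) h) (cbox c d)"
      if "h integrable_on cbox a b" for h :: "real \<Rightarrow> 'z::banach"
      using * that by (subst has_integral_restrict) (auto simp: integrable_integral)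
    have F: "((\<lambda>x. ?F x - (if x \<in> cbox a b then ?F x else 0)) has_integral
        integral (cbox c d) ?F - integral (cbox a b) ?F) (cbox c d)"
      by (intro has_integral_diff integrable_integral loc r)
    have G: "((\<lambda>x. ?G x - (if x \<in> cbox a b then ?G x else 0)) has_integral
        integral (cbox c d) ?G - integral (cbox a b) ?G) (cbox c d)"
      by (intro has_integral_diff integrable_integral gl r)
    have "norm (integral (cbox c d) ?F - integral (cbox a b) ?F) \<le> integral (cbox c d) ?G - integral (cbox a b) ?G"
      using integral_norm_bound_integral[OF has_integral_integrable[OF F] has_integral_integrable[OF G]]
        fg F G by (auto simp: integral_unique)
    also have "\<dots> < e" using B[of a b c d] * by auto
    finally show "norm (integral (cbox a b) ?F - integral (cbox c d) ?F) < e"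
      by (simp add: norm_minus_commute)
  qed
qed

text \<open>The only local obstacle is the end point 0, where \<open>f\<close> may be unbounded.
  Replacing \<open>f\<close> by 0 below a small \<delta> leaves a function integrable by continuity,
  with an error dominated by \<open>g\<close> near 0, where \<open>g\<close> has small
  integral.\<close>

lemma dominated_integrable_on_halfline:
  fixes f :: "real \<Rightarrow> 'b::banach"
  assumes cont: "continuous_on {0<..} f"
    and fg: "\<And>x. x > 0 \<Longrightarrow> norm (f x) \<le> g x" and g: "g integrable_on {0<..}"
  shows "f integrable_on {0<..}"
proof (rule dominated_integrable_on[where g = g])
  show "norm (f x) \<le> g x" if "x \<in> {0<..}" for x using fg that by auto
  show "g integrable_on {0<..}" by fact
  let ?F = "\<lambda>x. if x \<in> {0<..} then f x else 0" and ?G = "\<lambda>x. if x \<in> {0<..} then g x else 0"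
  have gl: "?G integrable_on cbox a b" for a b using g by (rule integrable_altD(1))
  show "?F integrable_on cbox a b" for a b
  proof (rule integrable_on_interval_approx)
    fix e :: real assume "e > 0"
    have "continuous_on {0..1} (\<lambda>x. integral {0..x} ?G)"
      using gl[of 0 1] by (intro indefinite_integral_continuous_1) simp
    then have "((\<lambda>x. integral {0..x} ?G) \<longlongrightarrow> 0) (at 0 within {0..1})"
      by (force simp: continuous_on)
    then have "eventually (\<lambda>x. integral {0..x} ?G < e) (at_right 0)"
      using \<open>e > 0\<close> by (simp add: at_within_Icc_at_right order_tendstoD)
    then have "eventually (\<lambda>x. x > 0 \<and> integral {0..x} ?G < e) (at_right 0)"
      using eventually_at_right_less by (rule eventually_elim2) auto
    then obtain \<delta> where d: "\<delta> > 0" and de: "integral {0..\<delta>} ?G < e"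
      using eventually_happens' trivial_limit_at_right_real by blast
    have 1: "(\<lambda>x. if x \<in> {\<delta>..b} then f x else 0) integrable_on cbox a b"
    proof -
      have "f integrable_on {\<delta>..b}"
        using d by (intro integrable_continuous_interval continuous_on_subset[OF cont]) auto
      then have "(\<lambda>x. if x \<in> {\<delta>..b} then f x else 0) integrable_on UNIV"
        by (simp only: integrable_restrict_UNIV)
      then show ?thesis by (rule integrable_on_subcbox) auto
    qed
    have "?G integrable_on {0..\<delta>}" using gl[of 0 \<delta>] by simp
    then have "(\<lambda>x. if x \<in> {0..\<delta>} then ?G x else 0) integrable_on UNIV"
      by (simp only: integrable_restrict_UNIV)
    then have 2: "(\<lambda>x. if x \<in> {0..\<delta>} then ?G x else 0) integrable_on cbox a b"
      by (rule integrable_on_subcbox) auto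
    have Gnn: "0 \<le> ?G x" for x using order_trans[OF norm_ge_zero fg, of x] by auto
    have "integral (cbox a b) (\<lambda>x. if x \<in> {0..\<delta>} then ?G x else 0)
        \<le> integral UNIV (\<lambda>x. if x \<in> {0..\<delta>} then ?G x else 0)"
      using Gnn 2 \<open>(\<lambda>x. if x \<in> {0..\<delta>} then ?G x else 0) integrable_on UNIV\<close>
      by (intro integral_subset_le) auto
    also have "\<dots> = integral {0..\<delta>} ?G" by (simp only: integral_restrict_UNIV)
    also have "\<dots> < e" by fact
    finally have 3: "integral (cbox a b) (\<lambda>x. if x \<in> {0..\<delta>} then ?G x else 0) < e" .
    show "\<exists>u h j. u integrable_on cbox a b \<and> (h has_integral j) (cbox a b) \<and>
             j < e \<and> (\<forall>x\<in>cbox a b. norm (?F x - u x) \<le> h x)"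
    proof (intro exI conjI ballI)
      fix x assume "x \<in> cbox a b"
      then show "norm (?F x - (if x \<in> {\<delta>..b} then f x else 0)) \<le> (if x \<in> {0..\<delta>} then ?G x else 0)"
        using d fg[of x] Gnn[of x] by auto
    qed (rule 1, rule integrable_integral[OF 2], rule 3)
  qed
qed


text \<open>The first bound is integrable at 0, the second at infinity. The cut \<tau> between them
  is left free because the moment inequality chooses it depending on the vector.\<close>

lemma integrable_on_halfline_powr_bounds:
  fixes f :: "real \<Rightarrow> 'b::banach"
  assumes cont: "continuous_on {0<..} f" and p: "p > 0" and q: "q > 0"
    and P: "\<And>r. r > 0 \<Longrightarrow> norm (f r) \<le> P * r powr (p - 1)"
    and Q: "\<And>r. r > 0 \<Longrightarrow> norm (f r) \<le> Q * r powr (- q - 1)"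
  shows "f integrable_on {0<..}"
    and "\<tau> > 0 \<Longrightarrow> norm (integral {0<..} f) \<le> P * \<tau> powr p / p + Q * \<tau> powr (- q) / q"
proof -
  define g where "g \<tau> r = (if r \<le> \<tau> then P * r powr (p - 1) else Q * r powr (- q - 1))" for \<tau> r :: real
  have fg: "norm (f r) \<le> g \<tau> r" if "r > 0" for r \<tau> using P[OF that] Q[OF that] by (simp add: g_def)
  have g: "(g \<tau> has_integral P * \<tau> powr p / p + Q * \<tau> powr (- q) / q) {0<..}" if "\<tau> > 0" for \<tau>
  proof -
    have "((\<lambda>r. P * r powr (p - 1)) has_integral P * (\<tau> powr (p - 1 + 1) / (p - 1 + 1))) {0..\<tau>}"
      using that p by (intro has_integral_mult_right has_integral_powr_from_0) auto
    then have 1: "(g \<tau> has_integral P * \<tau> powr p / p) {0..\<tau>}"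
      by (rule has_integral_eq_rhs[OF has_integral_eq, rotated]) (auto simp: g_def)
    have "((\<lambda>r. Q * r powr (- q - 1)) has_integral Q * (- (\<tau> powr (- q - 1 + 1)) / (- q - 1 + 1))) {\<tau>..}"
      using that q by (intro has_integral_mult_right has_integral_powr_to_inf) auto
    then have "((\<lambda>r. Q * r powr (- q - 1)) has_integral Q * \<tau> powr (- q) / q) {\<tau>..}" by simp
    then have 2: "(g \<tau> has_integral Q * \<tau> powr (- q) / q) {\<tau>..}"
      by (rule has_integral_spike[OF negligible_sing[of \<tau>], rotated]) (auto simp: g_def)
    have "{0..\<tau>} \<inter> {\<tau>..} = {\<tau>}" using that by auto
    then have "(g \<tau> has_integral P * \<tau> powr p / p + Q * \<tau> powr (- q) / q) ({0..\<tau>} \<union> {\<tau>..})"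
      by (intro has_integral_Un 1 2) auto
    then show ?thesis
      using that by (subst has_integral_spike_set_eq[of _ "{0..\<tau>} \<union> {\<tau>..}"]) (auto intro: negligible_subset[of "{0}"])
  qed
  show int: "f integrable_on {0<..}"
    using g[of 1] fg by (intro dominated_integrable_on_halfline[OF cont, of "g 1"]) auto
  show "norm (integral {0<..} f) \<le> P * \<tau> powr p / p + Q * \<tau> powr (- q) / q" if "\<tau> > 0"
    using g[OF that] fg integral_norm_bound_integral[OF int, of "g \<tau>"] by (auto simp: has_integral_iff)
qed

text \<open>Baire category: the closed sets \<open>A n\<close> cover the space, so one of them
  contains a ball. Every vector is a multiple of a difference of two points of that ball, which
  costs the factor 2.\<close>

theorem uniform_boundedness:
  fixes F :: "'i \<Rightarrow> 'a::banach \<Rightarrow>\<^sub>L 'b::real_normed_vector"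
  assumes pw: "\<And>x. \<exists>C. \<forall>i\<in>I. norm (F i x) \<le> C"
  shows "\<exists>C. \<forall>i\<in>I. norm (F i) \<le> C"
proof -
  define A where "A n = {x. \<forall>i\<in>I. norm (F i x) \<le> real n}" for n
  have cl: "closed (A n)" for n
  proof -
    have "A n = (\<Inter>i\<in>I. {x. norm (F i x) \<le> real n})" by (auto simp: A_def)
    then show ?thesis by (auto intro!: closed_INT closed_Collect_le continuous_intros)
  qed
  have "\<exists>n. interior (A n) \<noteq> {}"
  proof (rule ccontr)
    assume "\<not> ?thesis"
    then have "Met_TC.mtopology interior_of (\<Union>(range A)) = {}"
      using cl by (intro Met_TC.metric_Baire_category_alt) (auto simp: complete_UNIV)
    moreover have "\<Union>(range A) = UNIV"
    proof -
      have "\<exists>n. x \<in> A n" for x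
        using pw[of x] real_arch_simple by (fastforce simp: A_def intro: order_trans)
      then show ?thesis by auto
    qed
    ultimately show False by simp
  qed
  then obtain n x where "x \<in> interior (A n)" by auto
  then obtain r where r: "r > 0" "cball x r \<subseteq> A n"
    by (meson interior_subset mem_interior_cball)
  have "norm (F i) \<le> 2 * real n / r" if i: "i \<in> I" for i
  proof (rule norm_blinfun_bound)
    fix y
    show "norm (F i y) \<le> 2 * real n / r * norm y"
    proof (cases "y = 0")
      case False
      define w where "w = (r / norm y) *\<^sub>R y"
      have "x + w \<in> cball x r" "x \<in> cball x r" using r False by (auto simp: w_def dist_norm)
      then have "x + w \<in> A n" "x \<in> A n" using r by blast+
      then have "norm (F i (x + w)) \<le> n" "norm (F i x) \<le> n" using i by (auto simp: A_def)
      then have "norm (F i w) \<le> 2 * n"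
        using norm_triangle_ineq4[of "F i (x + w)" "F i x"] by (simp add: blinfun.bilinear_simps)
      moreover have "norm (F i w) = r / norm y * norm (F i y)"
        using r by (simp add: w_def blinfun.bilinear_simps)
      ultimately show ?thesis using r False by (simp add: field_simps)
    qed (simp add: blinfun.bilinear_simps)
  qed (use r in auto)
  then show ?thesis by blast
qed

section \<open>The resolvent of a bounded semigroup\<close>

lemma cinner_scaleC_right: "cinner x (c *\<^sub>C y) = cnj c * cinner x (y::'a::complex_hilbert_space)"
  by (metis cinner_commute cinner_scaleC_left complex_cnj_mult)

lemma inner_scaleC_scaleC:
  "(c *\<^sub>C x) \<bullet> (d *\<^sub>C y) = Re (c * cnj d * cinner x (y::'a::complex_hilbert_space))"
  by (simp add: Re_cinner[symmetric] cinner_scaleC_left cinner_scaleC_right algebra_simps)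

lemma norm_scaleC: "norm (c *\<^sub>C x) = cmod c * norm (x::'a::complex_hilbert_space)"
proof -
  have "norm (c *\<^sub>C x) ^ 2 = Re (c * cnj c * cinner x x)"
    by (simp add: power2_norm_eq_inner inner_scaleC_scaleC)
  also have "\<dots> = (cmod c * norm x) ^ 2"
    unfolding complex_norm_square[symmetric]
    by (simp add: Re_cinner power2_norm_eq_inner[symmetric] power_mult_distrib)
  finally show ?thesis by (simp add: power2_eq_iff_nonneg)
qed

lemma scaleC_scaleR_left: "(r *\<^sub>R c) *\<^sub>C x = r *\<^sub>R (c *\<^sub>C (x::'a::complex_hilbert_space))"
  by (simp add: scaleR_conv_of_real scaleC_scaleC[symmetric] scaleC_of_real)

lemma scaleC_scaleR_right: "c *\<^sub>C (r *\<^sub>R x) = r *\<^sub>R (c *\<^sub>C (x::'a::complex_hilbert_space))"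
  by (simp add: scaleC_of_real[symmetric] scaleC_scaleC mult.commute)

interpretation scaleC: bounded_bilinear "scaleC :: complex \<Rightarrow> 'a::complex_hilbert_space \<Rightarrow> 'a"
  by unfold_locales
    (auto simp: scaleC_add_left scaleC_add_right scaleC_scaleR_left scaleC_scaleR_right norm_scaleC intro!: exI[of _ 1])

lemma scaleC_one [simp]: "1 *\<^sub>C x = (x::'a::complex_hilbert_space)"
  using scaleC_of_real[of 1 x] by simp

lemma has_vector_derivative_quotientI:
  assumes "((\<lambda>h. (f (x + h) - f x) /\<^sub>R h) \<longlongrightarrow> D) (at 0)"
  shows "(f has_vector_derivative D) (at x)"
  unfolding has_vector_derivative_def has_derivative_at
proof
  show "bounded_linear (\<lambda>h. h *\<^sub>R D)" by (rule bounded_linear_scaleR_left)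
  have "((\<lambda>h. norm ((f (x + h) - f x) /\<^sub>R h - D)) \<longlongrightarrow> 0) (at 0)"
    using assms by (simp add: tendsto_norm_zero_iff LIM_zero_iff)
  moreover have "\<forall>\<^sub>F h in at 0. norm ((f (x + h) - f x) /\<^sub>R h - D) = norm (f (x + h) - f x - h *\<^sub>R D) / norm h"
  proof -
    have "norm ((f (x + h) - f x) /\<^sub>R h - D) = norm (f (x + h) - f x - h *\<^sub>R D) / norm h" if "h \<noteq> 0" for h
    proof -
      have "(f (x + h) - f x) /\<^sub>R h - D = (f (x + h) - f x - h *\<^sub>R D) /\<^sub>R h"
        using that by (simp add: scaleR_diff_right)
      then show ?thesis by (simp add: divide_inverse_commute)
    qed
    then show ?thesis by (auto simp: eventually_at intro: exI[of _ 1])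
  qed
  ultimately show "(\<lambda>h. norm (f (x + h) - f x - h *\<^sub>R D) / norm h) \<midarrow>0\<rightarrow> 0"
    using tendsto_cong by fastforce
qed

lemma has_integral_halfline_iff:
  "(f has_integral i) {0<..} \<longleftrightarrow> (f has_integral i) {0::real..}" for f :: "real \<Rightarrow> 'a::banach"
  by (rule has_integral_spike_set_eq) (auto intro: negligible_subset[of "{0}"])

lemma has_integral_exp_halfline:
  "a > 0 \<Longrightarrow> ((\<lambda>t. C * exp (- (a * t))) has_integral C / a) {0<..}" for a C :: real
  using has_integral_mult_right[OF has_integral_exp_minus_to_infinity[of a 0], of C]
  by (simp add: has_integral_halfline_iff)

text \<open>Bridge from gauge integrals to the Lebesgue integral over \<open>lborel\<close>, where
  Fubini is available. Continuity gives Borel measurability, which brings integrability down from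
  the completed measure.\<close>

lemma set_integrable_halfline_dominated:
  fixes f :: "real \<Rightarrow> real"
  assumes "continuous_on {0<..} f" and "\<And>t. t > 0 \<Longrightarrow> \<bar>f t\<bar> \<le> g t" and "g integrable_on {0<..}"
  shows "set_integrable lborel {0<..} f"
proof -
  have "f absolutely_integrable_on {0<..}"
    using dominated_integrable_on_halfline[of f g] assms
    by (intro absolutely_integrable_integrable_bound[where g = g]) auto
  moreover have "set_borel_measurable borel {0<..} f"
    using assms(1) by (intro borel_measurable_continuous_on_indicator[unfolded set_borel_measurable_def[symmetric]]) auto
  ultimately show ?thesis
    unfolding set_integrable_def set_borel_measurable_def
    by (subst (asm) integrable_completion) (auto simp: set_borel_measurable_def)
qed

lemma integral_halfline_FTC:
  fixes F f :: "real \<Rightarrow> real"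
  assumes "\<And>t. t > 0 \<Longrightarrow> (F has_vector_derivative f t) (at t)" and c: "continuous_on {0<..} f"
    and i: "set_integrable lborel {0<..} f"
    and "(F \<longlongrightarrow> A) (at_right 0)" and "(F \<longlongrightarrow> B) at_top"
  shows "integral {0<..} f = B - A"
proof -
  have e: "einterval 0 \<infinity> = {0<..}" by (auto simp: einterval_def zero_ereal_def)
  have "(LBINT x=0..\<infinity>. f x) = B - A"
  proof (rule interval_integral_FTC_integrable[where F = F])
    show "isCont f x" if "0 < ereal x" "ereal x < \<infinity>" for x
      using that c by (intro continuous_on_interior[OF c]) (auto simp: interior_open)
  qed (use assms e in \<open>auto simp: zero_ereal_def ereal_tendsto_simps1\<close>)
  then show ?thesis
    using set_borel_integral_eq_integral[OF i] by (simp add: interval_lebesgue_integral_def e)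
qed

text \<open>
  The operator \<open>J\<close> is $(-A)^{-1}$: its range is the domain of $A$, and \<open>J_deriv\<close> says that
  $A J x = -x$. The bound $K \ge 1$ avoids a separate treatment of the zero space.
\<close>

locale bounded_semigroup =
  fixes T :: "real \<Rightarrow> 'a::complex_hilbert_space \<Rightarrow>\<^sub>L 'a" and J :: "'a \<Rightarrow>\<^sub>L 'a" and K :: real
  assumes T_scaleC: "t \<ge> 0 \<Longrightarrow> T t (c *\<^sub>C x) = c *\<^sub>C T t x"
    and T_zero: "T 0 x = x"
    and T_add: "s \<ge> 0 \<Longrightarrow> t \<ge> 0 \<Longrightarrow> T (s + t) x = T s (T t x)"
    and T_right: "((\<lambda>t. T t x) \<longlongrightarrow> x) (at_right 0)"
    and T_bound: "t \<ge> 0 \<Longrightarrow> norm (T t) \<le> K"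
    and K_ge_1: "K \<ge> 1"
    and J_scaleC: "J (c *\<^sub>C x) = c *\<^sub>C J x"
    and J_T: "t \<ge> 0 \<Longrightarrow> J (T t x) = T t (J x)"
    and J_deriv: "((\<lambda>h. (T h (J x) - J x) /\<^sub>R h) \<longlongrightarrow> - x) (at_right 0)"
begin

section \<open>Orbits of the semigroup\<close>

lemma norm_T: "t \<ge> 0 \<Longrightarrow> norm (T t x) \<le> K * norm x"
  by (meson T_bound mult_right_mono norm_blinfun norm_ge_zero order_trans)

text \<open>For r \<le> s, \<open>T s x - T r x = T r (T (s - r) x - x)\<close>, so the bound
  \<open>K\<close> turns right continuity at 0 into an estimate in \<open>s - r\<close> alone.
  Taking the smaller time outside gives continuity from both sides.\<close>

lemma continuous_on_T: "continuous_on {0..} (\<lambda>t. T t x)"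
  unfolding continuous_on_iff
proof (intro ballI allI impI)
  fix t e :: real assume t: "t \<in> {0..}" and e: "e > 0"
  have "eventually (\<lambda>h. dist (T h x) x < e / K) (at_right 0)"
    using T_right[of x] e K_ge_1 by (intro tendstoD) auto
  then obtain d where d: "d > 0" "\<And>h. 0 < h \<Longrightarrow> h < d \<Longrightarrow> dist (T h x) x < e / K"
    unfolding eventually_at_right_field by auto
  have main: "dist (T r x) (T s x) < e" if rs: "0 \<le> r" "r \<le> s" "s < r + d" for r s
  proof (cases "r = s")
    case False
    have "T s x - T r x = T r (T (s - r) x - x)"
      using T_add[of r "s - r" x] rs by (simp add: blinfun.bilinear_simps)
    then have "dist (T r x) (T s x) \<le> K * dist (T (s - r) x) x"
      using norm_T[OF \<open>0 \<le> r\<close>] by (metis dist_commute dist_norm)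
    also have "\<dots> < K * (e / K)" using d(2)[of "s - r"] rs False K_ge_1 by (intro mult_strict_left_mono) auto
    finally show ?thesis using K_ge_1 by simp
  qed (use e in auto)
  show "\<exists>d>0. \<forall>s\<in>{0..}. dist s t < d \<longrightarrow> dist (T s x) (T t x) < e"
  proof (intro exI[of _ d] conjI ballI impI)
    fix s assume "s \<in> {0..}" "dist s t < d"
    then show "dist (T s x) (T t x) < e"
      using main[of s t] main[of t s] t by (cases "s \<le> t") (auto simp: dist_commute dist_real_def)
  qed (use d in auto)
qed

lemma T_J_has_vector_derivative:
  assumes "t > 0"
  shows "((\<lambda>t. T t (J x)) has_vector_derivative - T t x) (at t)"
proof (rule has_vector_derivative_quotientI)
  define w where "w h = (T h (J x) - J x) /\<^sub>R h" for h
  have w: "(w \<longlongrightarrow> - x) (at_right 0)" unfolding w_def by (rule J_deriv)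
  have "((\<lambda>h. T t (w h)) \<longlongrightarrow> T t (- x)) (at_right 0)"
    by (intro tendsto_intros w)
  then have right: "((\<lambda>h. (T (t + h) (J x) - T t (J x)) /\<^sub>R h) \<longlongrightarrow> - T t x) (at_right 0)"
  proof (rule Lim_transform_eventually[OF tendsto_eq_rhs])
    show "\<forall>\<^sub>F h in at_right 0. T t (w h) = (T (t + h) (J x) - T t (J x)) /\<^sub>R h"
      using eventually_at_right_less[of 0]
      by eventually_elim (use assms in \<open>simp add: T_add w_def blinfun.bilinear_simps\<close>)
  qed (simp add: blinfun.bilinear_simps)
  \<comment> \<open>The left difference quotient is \<open>T (t - h) (w h)\<close>, with a moving
    operator. Splitting \<open>w h = (w h + x) - x\<close> leaves a term tending to 0, controlled by
    the bound \<open>K\<close>, and the orbit of \<open>x\<close>, controlled by continuity.\<close>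
  have "((\<lambda>h. T (t - h) (w h + x)) \<longlongrightarrow> 0) (at_right 0)"
  proof (rule Lim_null_comparison)
    show "\<forall>\<^sub>F h in at_right 0. norm (T (t - h) (w h + x)) \<le> K * norm (w h + x)"
      using assms by (auto simp: eventually_at_right_field intro!: norm_T exI[of _ t])
    show "((\<lambda>h. K * norm (w h + x)) \<longlongrightarrow> 0) (at_right 0)"
      using tendsto_mult_right_zero[OF tendsto_norm_zero, of "\<lambda>h. w h + x"] tendsto_add[OF w tendsto_const[of x]] by simp
  qed
  moreover have "((\<lambda>h. T (t - h) x) \<longlongrightarrow> T t x) (at_right 0)"
  proof -
    have "isCont (\<lambda>s. T s x) t"
      using assms continuous_on_T[of x] by (intro continuous_on_interior[OF continuous_on_T]) (auto simp: interior_Ici[of _ "-1"])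
    moreover have "((\<lambda>h. t - h) \<longlongrightarrow> t) (at_right 0)"
      by (rule tendsto_eq_intros | simp)+
    ultimately show ?thesis by (rule isCont_tendsto_compose)
  qed
  ultimately have "((\<lambda>h. T (t - h) (w h + x) - T (t - h) x) \<longlongrightarrow> 0 - T t x) (at_right 0)"
    by (rule tendsto_diff)
  then have "((\<lambda>h. (T (t + - h) (J x) - T t (J x)) /\<^sub>R (- h)) \<longlongrightarrow> - T t x) (at_right 0)"
  proof (rule Lim_transform_eventually[OF tendsto_eq_rhs])
    have "T (t - h) (w h + x) - T (t - h) x = (T (t + - h) (J x) - T t (J x)) /\<^sub>R (- h)"
      if "0 < h" "h < t" for h
    proof -
      have "T t (J x) = T (t - h) (T h (J x))" using T_add[of "t - h" h "J x"] that by simp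
      then show ?thesis by (simp add: w_def blinfun.bilinear_simps algebra_simps)
    qed
    then show "\<forall>\<^sub>F h in at_right 0. T (t - h) (w h + x) - T (t - h) x = (T (t + - h) (J x) - T t (J x)) /\<^sub>R (- h)"
      using assms by (auto simp: eventually_at_right_field)
  qed simp
  then have left: "((\<lambda>h. (T (t + h) (J x) - T t (J x)) /\<^sub>R h) \<longlongrightarrow> - T t x) (at_left 0)"
    using filterlim_at_left_to_right[of "\<lambda>h. (T (t + h) (J x) - T t (J x)) /\<^sub>R h" _ 0] by simp
  show "((\<lambda>h. (T (t + h) (J x) - T t (J x)) /\<^sub>R h) \<longlongrightarrow> - T t x) (at 0)"
    by (rule filterlim_split_at[OF left right])
qed


section \<open>The Laplace transform of an orbit\<close>

definition orbit :: "complex \<Rightarrow> 'a \<Rightarrow> real \<Rightarrow> 'a" where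
  "orbit z x t = exp (- (z * complex_of_real t)) *\<^sub>C T t x"

lemma norm_orbit: "t \<ge> 0 \<Longrightarrow> norm (orbit z x t) \<le> K * norm x * exp (- (Re z * t))"
  using norm_T[of t x] by (simp add: orbit_def norm_scaleC mult.commute)

lemma continuous_on_orbit: "continuous_on {0..} (orbit z x)"
  unfolding orbit_def
  by (intro scaleC.continuous_on continuous_on_T continuous_intros)

lemma orbit_integrable:
  assumes "Re z > 0"
  shows "orbit z x integrable_on {0<..}"
proof (rule dominated_integrable_on_halfline)
  show "continuous_on {0<..} (orbit z x)" by (rule continuous_on_subset[OF continuous_on_orbit]) auto
  show "norm (orbit z x t) \<le> K * norm x * exp (- (Re z * t))" if "t > 0" for t
    using norm_orbit that by simp
  show "(\<lambda>t. K * norm x * exp (- (Re z * t))) integrable_on {0<..}"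
    using has_integral_exp_halfline[OF assms] by blast
qed

lemma norm_integral_orbit:
  assumes "Re z > 0"
  shows "norm (integral {0<..} (orbit z x)) \<le> K / Re z * norm x"
proof -
  have "norm (integral {0<..} (orbit z x)) \<le> integral {0<..} (\<lambda>t. K * norm x * exp (- (Re z * t)))"
  proof (rule integral_norm_bound_integral[OF orbit_integrable[OF assms]])
    show "(\<lambda>t. K * norm x * exp (- (Re z * t))) integrable_on {0<..}"
      using has_integral_exp_halfline[OF assms] by blast
  qed (simp add: norm_orbit)
  also have "\<dots> = K * norm x / Re z" using has_integral_exp_halfline[OF assms] by (rule integral_unique)
  finally show ?thesis by simp
qed

lemma orbit_add: "orbit z (x + y) t = orbit z x t + orbit z y t"
  by (simp add: orbit_def blinfun.bilinear_simps scaleC_add_right)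

lemma orbit_scaleR: "orbit z (c *\<^sub>R x) t = c *\<^sub>R orbit z x t"
  by (simp add: orbit_def blinfun.bilinear_simps scaleC_scaleR_right)

lemma orbit_scaleC: "t \<ge> 0 \<Longrightarrow> orbit z (c *\<^sub>C x) t = c *\<^sub>C orbit z x t"
  by (simp add: orbit_def T_scaleC scaleC_scaleC mult.commute)

text \<open>The resolvent of the generator on the open right half-plane, together with its value at 0.\<close>

definition R :: "complex \<Rightarrow> 'a \<Rightarrow>\<^sub>L 'a" where
  "R z = (if z = 0 then J else Blinfun (\<lambda>x. integral {0<..} (orbit z x)))"

lemma R_0: "R 0 = J" by (simp add: R_def)

lemma R_apply:
  assumes "Re z > 0"
  shows "R z x = integral {0<..} (orbit z x)"
proof -
  have "bounded_linear (\<lambda>x. integral {0<..} (orbit z x))"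
  proof (rule bounded_linear_intro)
    show "norm (integral {0<..} (orbit z x)) \<le> norm x * (K / Re z)" for x
      using norm_integral_orbit[OF assms, of x] by (simp add: mult.commute)
    show "integral {0<..} (orbit z (x + y)) = integral {0<..} (orbit z x) + integral {0<..} (orbit z y)" for x y
      using integral_add[OF orbit_integrable orbit_integrable, OF assms assms, of x y]
      by (simp add: orbit_add[abs_def])
    show "integral {0<..} (orbit z (r *\<^sub>R x)) = r *\<^sub>R integral {0<..} (orbit z x)" for r x
      using integral_cmul[of "{0<..}" r "orbit z x"] by (simp add: orbit_scaleR[abs_def])
  qed
  then show ?thesis using assms by (auto simp: R_def bounded_linear_Blinfun_apply)
qed

lemma R_has_integral: "Re z > 0 \<Longrightarrow> (orbit z x has_integral R z x) {0<..}"
  by (simp add: R_apply integrable_integral orbit_integrable)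

lemma norm_R: "Re z > 0 \<Longrightarrow> norm (R z) \<le> K / Re z"
  using norm_integral_orbit K_ge_1 by (intro norm_blinfun_bound) (auto simp: R_apply)

lemma inner_R_has_integral: "Re z > 0 \<Longrightarrow> ((\<lambda>t. orbit z x t \<bullet> y) has_integral R z x \<bullet> y) {0<..}"
  using has_integral_linear[OF R_has_integral bounded_linear_inner_left] by (simp add: o_def)

lemma inner_orbit_set_integrable:
  assumes "Re z > 0"
  shows "set_integrable lborel {0<..} (\<lambda>t. orbit z x t \<bullet> y)"
proof (rule set_integrable_halfline_dominated)
  show "continuous_on {0<..} (\<lambda>t. orbit z x t \<bullet> y)"
    by (intro continuous_intros continuous_on_subset[OF continuous_on_orbit]) auto
  show "\<bar>orbit z x t \<bullet> y\<bar> \<le> K * norm x * norm y * exp (- (Re z * t))" if "t > 0" for t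
  proof -
    have "\<bar>orbit z x t \<bullet> y\<bar> \<le> norm (orbit z x t) * norm y" by (rule Cauchy_Schwarz_ineq2)
    also have "\<dots> \<le> K * norm x * exp (- (Re z * t)) * norm y"
      using that by (intro mult_right_mono norm_orbit) auto
    finally show ?thesis by (simp add: mult_ac)
  qed
  show "(\<lambda>t. K * norm x * norm y * exp (- (Re z * t))) integrable_on {0<..}"
    using has_integral_exp_halfline[OF assms] by blast
qed

lemma R_scaleC: "Re z > 0 \<Longrightarrow> R z (c *\<^sub>C x) = c *\<^sub>C R z x"
proof -
  assume z: "Re z > 0"
  have "(orbit z (c *\<^sub>C x) has_integral c *\<^sub>C R z x) {0<..}"
    using has_integral_linear[OF R_has_integral[OF z] scaleC.bounded_linear_right]
    by (rule has_integral_eq[rotated]) (auto simp: orbit_scaleC)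
  then show ?thesis using z by (simp add: R_apply integral_unique)
qed

lemma R_J: "Re z > 0 \<Longrightarrow> J (R z x) = R z (J x)"
proof -
  assume z: "Re z > 0"
  have "(orbit z (J x) has_integral J (R z x)) {0<..}"
    using has_integral_linear[OF R_has_integral[OF z] blinfun.bounded_linear_right]
    by (rule has_integral_eq[rotated]) (auto simp: orbit_def J_T J_scaleC)
  then show ?thesis using z by (simp add: R_apply integral_unique)
qed

lemma R_T: "Re z > 0 \<Longrightarrow> s \<ge> 0 \<Longrightarrow> T s (R z x) = R z (T s x)"
proof -
  assume z: "Re z > 0" and s: "s \<ge> 0"
  have com: "T t (T s x) = T s (T t x)" if "t \<ge> 0" for t
    using T_add[of s t x] T_add[of t s x] s that by (simp add: add.commute)
  have "(orbit z (T s x) has_integral T s (R z x)) {0<..}"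
  proof (rule has_integral_eq[rotated])
    show "(blinfun_apply (T s) \<circ> orbit z x has_integral T s (R z x)) {0<..}"
      by (rule has_integral_linear[OF R_has_integral[OF z] blinfun.bounded_linear_right])
  qed (auto simp: orbit_def T_scaleC s com)
  then show ?thesis using z by (simp add: R_apply integral_unique)
qed

text \<open>This is (z - A) R(z) x = x after applying \<open>J\<close>. It comes from integrating
  the derivative of e^(-zt) T(t) J x over the half-line; the inner product with an arbitrary
  \<open>y\<close> makes that an integral of real functions.\<close>

lemma R_J_identity:
  assumes z: "Re z > 0"
  shows "R z x + z *\<^sub>C J (R z x) = J x"
proof -
  \<comment> \<open>By the product rule the derivative of \<open>orbit z (J x)\<close> is
    \<open>- orbit z v\<close>. Its boundary values are \<open>J x\<close> at 0 and 0 at infinity,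
    whence \<open>R z v = J x\<close>.\<close>
  define v where "v = x + z *\<^sub>C J x"
  have "R z v \<bullet> y = J x \<bullet> y" for y
  proof -
    have der: "((\<lambda>t. orbit z (J x) t \<bullet> y) has_vector_derivative - (orbit z v t \<bullet> y)) (at t)" if t: "t > 0" for t
    proof -
      have "((\<lambda>t. exp (- (z * complex_of_real t))) has_vector_derivative - (z * exp (- (z * complex_of_real t)))) (at t)"
        by (rule has_vector_derivative_real_field derivative_eq_intros refl | simp)+
      from scaleC.has_vector_derivative[OF this T_J_has_vector_derivative[OF t, of x]]
      have "(orbit z (J x) has_vector_derivative - orbit z v t) (at t)"
        using t by (simp add: orbit_def v_def scaleC_add_right scaleC_scaleC T_scaleC blinfun.bilinear_simps
            scaleC.minus_left scaleC.minus_right mult.commute orbit_def[abs_def])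
      from bounded_linear.has_vector_derivative[OF bounded_linear_inner_left this, of y]
      show ?thesis by simp
    qed
    have "integral {0<..} (\<lambda>t. - (orbit z v t \<bullet> y)) = 0 - J x \<bullet> y"
    proof (rule integral_halfline_FTC[OF der])
      show "continuous_on {0<..} (\<lambda>t. - (orbit z v t \<bullet> y))"
        by (intro continuous_intros continuous_on_subset[OF continuous_on_orbit]) auto
      show "set_integrable lborel {0<..} (\<lambda>t. - (orbit z v t \<bullet> y))"
        using inner_orbit_set_integrable[OF z] by (simp add: set_integrable_def)
      have "((\<lambda>t. orbit z (J x) t) \<longlongrightarrow> orbit z (J x) 0) (at_right 0)"
        using continuous_on_orbit[of z "J x"] unfolding continuous_on_def
        by (rule_tac tendsto_within_subset[of _ _ _ "{0..}"]) auto
      then show "((\<lambda>t. orbit z (J x) t \<bullet> y) \<longlongrightarrow> J x \<bullet> y) (at_right 0)"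
        by (intro tendsto_intros) (simp add: orbit_def T_zero)
      have "((\<lambda>t. K * norm (J x) * exp (- (Re z * t))) \<longlongrightarrow> 0) at_top"
        using z by real_asymp
      then have "(orbit z (J x) \<longlongrightarrow> 0) at_top"
        by (rule Lim_null_comparison[rotated]) (auto simp: eventually_at_top_linorder intro!: norm_orbit exI[of _ 0])
      then show "((\<lambda>t. orbit z (J x) t \<bullet> y) \<longlongrightarrow> 0) at_top"
        using tendsto_inner[OF _ tendsto_const, of _ 0 at_top y] by simp
    qed auto
    then show ?thesis using inner_R_has_integral[OF z, of v y] by (simp add: integral_unique)
  qed
  then have "R z v = J x" by (metis vector_eq_rdot)
  then show ?thesis using z by (simp add: v_def blinfun.bilinear_simps R_scaleC R_J)
qed

end

section \<open>Gamma integrals\<close>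

lemma integral_scale_halfline:
  fixes f :: "real \<Rightarrow> real"
  assumes "c > 0"
  shows "(LINT t:{0<..}|lborel. f (c * t)) = (LINT t:{0<..}|lborel. f t) / c"
  using lborel_integral_real_affine[of c "\<lambda>t. indicator {0<..} t *\<^sub>R f t" 0] assms
  by (simp add: set_lebesgue_integral_def indicator_def zero_less_mult_iff cong: if_cong)

lemma set_integrable_scale_halfline:
  fixes f :: "real \<Rightarrow> real"
  assumes "c > 0" "set_integrable lborel {0<..} f"
  shows "set_integrable lborel {0<..} (\<lambda>t. f (c * t))"
  using lborel_integrable_real_affine[of "\<lambda>t. indicator {0<..} t *\<^sub>R f t" c 0] assms
  by (simp add: set_integrable_def indicator_def zero_less_mult_iff cong: if_cong)

lemma Gamma_halfline:
  fixes p c :: real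
  assumes p: "p > 0" and c: "c > 0"
  shows "set_integrable lborel {0<..} (\<lambda>t. t powr (p - 1) * exp (- (c * t)))"
    and "(LINT t:{0<..}|lborel. t powr (p - 1) * exp (- (c * t))) = Gamma p * c powr - p"
proof -
  define f where "f t = t powr (p - 1) * exp (- t)" for t :: real
  have h: "(f has_integral Gamma p) {0<..}"
    using Gamma_integral_real[OF p] by (simp add: has_integral_halfline_iff f_def[abs_def] exp_minus divide_inverse)
  have i: "set_integrable lborel {0<..} f"
    by (rule set_integrable_halfline_dominated[where g = f])
      (use h in \<open>auto simp: f_def intro!: continuous_intros\<close>)
  have I: "(LINT t:{0<..}|lborel. f t) = Gamma p"
    using set_borel_integral_eq_integral(2)[OF i] h by (simp add: integral_unique)
  have eq: "t powr (p - 1) * exp (- (c * t)) = c powr (1 - p) * f (c * t)" if "t > 0" for t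
    using that c by (simp add: f_def powr_mult powr_diff field_simps)
  have "set_integrable lborel {0<..} (\<lambda>t. c powr (1 - p) * f (c * t))"
    by (intro set_integrable_mult_right set_integrable_scale_halfline c i)
  then show "set_integrable lborel {0<..} (\<lambda>t. t powr (p - 1) * exp (- (c * t)))"
    using eq by (subst set_integrable_cong) auto
  have "(LINT t:{0<..}|lborel. t powr (p - 1) * exp (- (c * t))) = (LINT t:{0<..}|lborel. c powr (1 - p) * f (c * t))"
    using eq by (intro set_lebesgue_integral_cong) auto
  also have "\<dots> = c powr (1 - p) * (Gamma p / c)"
    using integral_scale_halfline[OF c, of f] I by simp
  also have "\<dots> = Gamma p * c powr - p"
    using c by (simp add: powr_diff powr_minus field_simps)
  finally show "(LINT t:{0<..}|lborel. t powr (p - 1) * exp (- (c * t))) = Gamma p * c powr - p" .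
qed

lemma Gamma_reflection_real:
  fixes a :: real
  shows "Gamma a * Gamma (1 - a) = pi / sin (pi * a)"
proof -
  have "complex_of_real (Gamma a * Gamma (1 - a)) = complex_of_real (pi / sin (pi * a))"
    using Gamma_reflection_complex[of "complex_of_real a"]
    by (simp add: Gamma_complex_of_real[symmetric] sin_of_real[symmetric] del: sin_of_real)
  then show ?thesis by (simp only: of_real_eq_iff)
qed

lemma measurable_quadrant:
  fixes f :: "real \<Rightarrow> real \<Rightarrow> real"
  assumes "continuous_on ({0<..} \<times> {0<..}) (\<lambda>(t, s). f t s)"
  shows "(\<lambda>(t, s). indicator {0<..} t * (indicator {0<..} s * f t s)) \<in> borel_measurable (lborel \<Otimes>\<^sub>M lborel)"
proof -
  have "(\<lambda>x. indicator ({0<..} \<times> {0<..}) x *\<^sub>R (case x of (t, s) \<Rightarrow> f t s)) \<in> borel_measurable borel"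
    by (intro borel_measurable_continuous_on_indicator assms borel_open open_Times) auto
  then show ?thesis
    by (simp add: lborel_prod split_def measurable_lborel1 indicator_times mult.assoc)
qed

text \<open>The dominating \<open>h\<close> enters through its iterated integrals because in both
  applications the inner integral of \<open>h\<close> is an explicit Gamma integral. Joint
  measurability of the integrand comes from continuity on the open quadrant.\<close>

lemma quadrant_Fubini:
  fixes f h :: "real \<Rightarrow> real \<Rightarrow> real"
  assumes cont: "continuous_on ({0<..} \<times> {0<..}) (\<lambda>(t, s). f t s)"
    and fh: "\<And>t s. t > 0 \<Longrightarrow> s > 0 \<Longrightarrow> \<bar>f t s\<bar> \<le> h t s"
    and hs: "\<And>t. t > 0 \<Longrightarrow> set_integrable lborel {0<..} (h t)"
    and ht: "set_integrable lborel {0<..} (\<lambda>t. LINT s:{0<..}|lborel. h t s)"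
  shows "(LINT t:{0<..}|lborel. LINT s:{0<..}|lborel. f t s) = (LINT s:{0<..}|lborel. LINT t:{0<..}|lborel. f t s)"
proof -
  define F where "F = (\<lambda>(t, s). indicator {0<..} t * (indicator {0<..} s * f t s))"
  have F: "F (t, s) = indicator {0<..} t * (indicator {0<..} s * f t s)" for t s
    by (simp add: F_def)
  have mF [measurable]: "F \<in> borel_measurable (lborel \<Otimes>\<^sub>M lborel)"
    unfolding F_def by (rule measurable_quadrant[OF cont])
  have int_s: "integrable lborel (\<lambda>s. F (t, s))" for t
  proof (cases "t > 0")
    case True
    show ?thesis
    proof (rule Bochner_Integration.integrable_bound)
      show "integrable lborel (\<lambda>s. indicator {0<..} s *\<^sub>R h t s)" using hs[OF True] by (simp add: set_integrable_def)
      show "(\<lambda>s. F (t, s)) \<in> borel_measurable lborel" using mF by measurable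
      show "AE s in lborel. norm (F (t, s)) \<le> norm (indicator {0<..} s *\<^sub>R h t s)"
        using fh[OF True] by (intro AE_I2) (auto simp: F indicator_def intro: order_trans[OF _ abs_ge_self])
    qed
  qed (simp add: F)
  have "integrable (lborel \<Otimes>\<^sub>M lborel) F"
  proof (rule lborel_pair.Fubini_integrable[OF mF])
    show "integrable lborel (\<lambda>t. \<integral>s. norm (F (t, s)) \<partial>lborel)"
    proof (rule Bochner_Integration.integrable_bound[OF ht[unfolded set_integrable_def]])
      show "(\<lambda>t. \<integral>s. norm (F (t, s)) \<partial>lborel) \<in> borel_measurable lborel" using mF by measurable
      have "(\<integral>s. norm (F (t, s)) \<partial>lborel) \<le> \<bar>indicator {0<..} t *\<^sub>R (LINT s:{0<..}|lborel. h t s)\<bar>" for t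
      proof (cases "t > 0")
        case True
        have "(\<integral>s. norm (F (t, s)) \<partial>lborel) \<le> (LINT s:{0<..}|lborel. h t s)"
          unfolding set_lebesgue_integral_def
          using hs[OF True] fh[OF True] int_s
          by (intro integral_mono) (auto simp: F True set_integrable_def indicator_def)
        then show ?thesis using True by simp
      qed (simp add: F)
      then show "AE t in lborel. norm (\<integral>s. norm (F (t, s)) \<partial>lborel)
          \<le> norm (indicator {0<..} t *\<^sub>R (LINT s:{0<..}|lborel. h t s))"
        by (intro AE_I2) simp
    qed
    show "AE t in lborel. integrable lborel (\<lambda>s. F (t, s))" using int_s by simp
  qed
  then have "(\<integral>s. \<integral>t. F (t, s) \<partial>lborel \<partial>lborel) = (\<integral>t. \<integral>s. F (t, s) \<partial>lborel \<partial>lborel)"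
    by (intro lborel_pair.Fubini_integral) (simp add: split_def)
  then show ?thesis
    by (simp add: F set_lebesgue_integral_def mult.left_commute)
qed

text \<open>After exchanging the integrals the inner one, of s^(-a) e^(-st), is Gamma(1-a) t^(a-1).
  This turns the Stieltjes integral of a resolvent into a Gamma integral of the semigroup. The shift
  \<open>e > 0\<close> makes the outer integral converge for a function that is only
  bounded.\<close>

lemma Stieltjes_halfline:
  fixes g :: "real \<Rightarrow> real"
  assumes a: "0 < a" "a < 1" and e: "e > 0"
    and cont: "continuous_on {0<..} g" and bd: "\<And>t. t > 0 \<Longrightarrow> \<bar>g t\<bar> \<le> G"
  shows "(LINT s:{0<..}|lborel. s powr - a * (LINT t:{0<..}|lborel. exp (- ((s + e) * t)) * g t))
       = Gamma (1 - a) * (LINT t:{0<..}|lborel. t powr (a - 1) * (exp (- (e * t)) * g t))"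
proof -
  define f where "f t s = s powr - a * (exp (- ((s + e) * t)) * g t)" for t s
  define h where "h t s = G * exp (- (e * t)) * (s powr (1 - a - 1) * exp (- (t * s)))" for t s
  have G: "G \<ge> 0" using bd[of 1] by auto
  have hint: "set_integrable lborel {0<..} (h t)" if "t > 0" for t
    unfolding h_def using that a by (intro set_integrable_mult_right Gamma_halfline(1)) auto
  have hval: "(LINT s:{0<..}|lborel. h t s) = G * Gamma (1 - a) * (t powr (a - 1) * exp (- (e * t)))" if "t > 0" for t
    unfolding h_def using that a by (simp only: set_integral_mult_right Gamma_halfline(2)) auto
  have fval: "(LINT s:{0<..}|lborel. f t s) = Gamma (1 - a) * (t powr (a - 1) * (exp (- (e * t)) * g t))" if "t > 0" for t
  proof -
    have "f t s = exp (- (e * t)) * g t * (s powr (1 - a - 1) * exp (- (t * s)))" for s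
      by (simp add: f_def algebra_simps exp_diff exp_minus exp_add divide_simps)
    then have "(LINT s:{0<..}|lborel. f t s) = exp (- (e * t)) * g t * (Gamma (1 - a) * t powr - (1 - a))"
      using Gamma_halfline(2)[of "1 - a" t] that a by (simp only: set_integral_mult_right)
    then show ?thesis by simp
  qed
  have "(LINT s:{0<..}|lborel. s powr - a * (LINT t:{0<..}|lborel. exp (- ((s + e) * t)) * g t))
      = (LINT s:{0<..}|lborel. LINT t:{0<..}|lborel. f t s)"
    by (simp add: f_def)
  also have "\<dots> = (LINT t:{0<..}|lborel. LINT s:{0<..}|lborel. f t s)"
  proof (rule quadrant_Fubini[symmetric, of _ h])
    show "continuous_on ({0<..} \<times> {0<..}) (\<lambda>(t, s). f t s)"
      unfolding f_def split_def
      by (intro continuous_intros continuous_on_compose2[OF cont]) auto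
    show "\<bar>f t s\<bar> \<le> h t s" if "t > 0" "s > 0" for t s
    proof -
      have "\<bar>f t s\<bar> = exp (- (e * t)) * (s powr - a * exp (- (t * s))) * \<bar>g t\<bar>"
        by (simp add: f_def abs_mult algebra_simps exp_diff exp_minus exp_add divide_simps)
      also have "\<dots> \<le> exp (- (e * t)) * (s powr - a * exp (- (t * s))) * G"
        using bd that by (intro mult_left_mono) auto
      finally show ?thesis by (simp add: h_def mult_ac)
    qed
    have "set_integrable lborel {0<..} (\<lambda>t. G * Gamma (1 - a) * (t powr (a - 1) * exp (- (e * t))))"
      using a e by (intro set_integrable_mult_right Gamma_halfline) auto
    then show "set_integrable lborel {0<..} (\<lambda>t. LINT s:{0<..}|lborel. h t s)"
      using hval by (subst set_integrable_cong) auto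
  qed (use hint in auto)
  also have "\<dots> = (LINT t:{0<..}|lborel. Gamma (1 - a) * (t powr (a - 1) * (exp (- (e * t)) * g t)))"
    using fval by (intro set_lebesgue_integral_cong) auto
  finally show ?thesis by simp
qed

text \<open>The substitution s = tv turns \<open>g (s + t)\<close> into
  \<open>g (t * (1 + v))\<close>; after exchanging the integrals, rescaling t by 1 + v separates the
  variables. The factor in \<open>v\<close> is a Beta integral, left unevaluated here.\<close>

lemma Gamma_convolution_aux:
  fixes g :: "real \<Rightarrow> real"
  assumes a: "0 < a" and b: "0 < b" and e: "e > 0"
    and cont: "continuous_on {0<..} g" and bd: "\<And>t. t > 0 \<Longrightarrow> \<bar>g t\<bar> \<le> G"
  shows "(LINT t:{0<..}|lborel. t powr (a - 1) * (exp (- (e * t)) *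
           (LINT s:{0<..}|lborel. s powr (b - 1) * (exp (- (e * s)) * g (s + t)))))
       = (LINT v:{0<..}|lborel. v powr (b - 1) * (1 + v) powr - (a + b)) *
         (LINT t:{0<..}|lborel. t powr (a + b - 1) * (exp (- (e * t)) * g t))"
proof -
  define H where "H r = exp (- (e * r)) * g r" for r
  define f where "f t v = t powr (a + b - 1) * v powr (b - 1) * H (t * (1 + v))" for t v
  define h where "h t v = G * t powr (a + b - 1) * exp (- (e * t)) * (v powr (b - 1) * exp (- ((e * t) * v)))" for t v
  have inner: "t powr (a - 1) * (exp (- (e * t)) * (LINT s:{0<..}|lborel. s powr (b - 1) * (exp (- (e * s)) * g (s + t))))
      = (LINT v:{0<..}|lborel. f t v)" if t: "t > 0" for t
  proof -
    have "(LINT s:{0<..}|lborel. s powr (b - 1) * (exp (- (e * s)) * g (s + t)))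
       = t * (LINT v:{0<..}|lborel. (t * v) powr (b - 1) * (exp (- (e * (t * v))) * g (t * v + t)))"
      using integral_scale_halfline[OF t, of "\<lambda>s. s powr (b - 1) * (exp (- (e * s)) * g (s + t))"] t by simp
    then have "t powr (a - 1) * (exp (- (e * t)) * (LINT s:{0<..}|lborel. s powr (b - 1) * (exp (- (e * s)) * g (s + t))))
      = (LINT v:{0<..}|lborel. t powr (a - 1) * exp (- (e * t)) * t *
           ((t * v) powr (b - 1) * (exp (- (e * (t * v))) * g (t * v + t))))"
      by simp
    also have "\<dots> = (LINT v:{0<..}|lborel. f t v)"
    proof (intro set_lebesgue_integral_cong ballI allI impI)
      fix v :: real assume "v \<in> {0<..}"
      have 1: "t powr (a - 1) * t * t powr (b - 1) = t powr (a + b - 1)"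
        using t by (simp add: powr_diff powr_add field_simps)
      have 2: "(t * v) powr (b - 1) = t powr (b - 1) * v powr (b - 1)"
        using t \<open>v \<in> _\<close> by (simp add: powr_mult)
      have 3: "exp (- (e * t)) * exp (- (e * (t * v))) = exp (- (e * (t * (1 + v))))"
        by (simp add: exp_add[symmetric] algebra_simps)
      have 4: "t * v + t = t * (1 + v)" by (simp add: algebra_simps)
      have "t powr (a - 1) * exp (- (e * t)) * t *
           ((t * v) powr (b - 1) * (exp (- (e * (t * v))) * g (t * v + t)))
         = (t powr (a - 1) * t * t powr (b - 1)) * v powr (b - 1) *
           ((exp (- (e * t)) * exp (- (e * (t * v)))) * g (t * (1 + v)))"
        unfolding 2 4 by (simp only: mult_ac)
      also have "\<dots> = f t v" unfolding 1 3 f_def H_def ..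
      finally show "t powr (a - 1) * exp (- (e * t)) * t *
           ((t * v) powr (b - 1) * (exp (- (e * (t * v))) * g (t * v + t))) = f t v" .
    qed auto
    finally show ?thesis .
  qed
  have hint: "set_integrable lborel {0<..} (h t)" if "t > 0" for t
    unfolding h_def using that b e by (intro set_integrable_mult_right Gamma_halfline(1)) auto
  have hval: "(LINT v:{0<..}|lborel. h t v) = G * Gamma b * e powr - b * (t powr (a - 1) * exp (- (e * t)))" if "t > 0" for t
  proof -
    have "(LINT v:{0<..}|lborel. h t v) = G * t powr (a + b - 1) * exp (- (e * t)) * (Gamma b * (e * t) powr - b)"
      unfolding h_def using Gamma_halfline(2)[of b "e * t"] that b e by simp
    also have "\<dots> = G * Gamma b * e powr - b * (t powr (a - 1) * exp (- (e * t)))"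
      using that e by (simp add: powr_mult powr_add powr_diff powr_minus field_simps)
    finally show ?thesis .
  qed
  have "(LINT t:{0<..}|lborel. t powr (a - 1) * (exp (- (e * t)) *
           (LINT s:{0<..}|lborel. s powr (b - 1) * (exp (- (e * s)) * g (s + t)))))
     = (LINT t:{0<..}|lborel. LINT v:{0<..}|lborel. f t v)"
    using inner by (intro set_lebesgue_integral_cong) auto
  also have "\<dots> = (LINT v:{0<..}|lborel. LINT t:{0<..}|lborel. f t v)"
  proof (rule quadrant_Fubini[of _ h])
    show "continuous_on ({0<..} \<times> {0<..}) (\<lambda>(t, s). f t s)"
      unfolding f_def split_def H_def
      by (intro continuous_intros continuous_on_compose2[OF cont]) (auto simp: add_pos_pos)
    show "\<bar>f t v\<bar> \<le> h t v" if "t > 0" "v > 0" for t v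
    proof -
      have "\<bar>f t v\<bar> = t powr (a + b - 1) * exp (- (e * t)) * (v powr (b - 1) * exp (- ((e * t) * v))) * \<bar>g (t * (1 + v))\<bar>"
        by (simp add: f_def H_def abs_mult algebra_simps exp_diff exp_minus exp_add divide_simps)
      also have "\<dots> \<le> t powr (a + b - 1) * exp (- (e * t)) * (v powr (b - 1) * exp (- ((e * t) * v))) * G"
        using bd that by (intro mult_left_mono) auto
      finally show ?thesis by (simp add: h_def mult_ac)
    qed
    have "set_integrable lborel {0<..} (\<lambda>t. G * Gamma b * e powr - b * (t powr (a - 1) * exp (- (e * t))))"
      using a e by (intro set_integrable_mult_right Gamma_halfline) auto
    then show "set_integrable lborel {0<..} (\<lambda>t. LINT v:{0<..}|lborel. h t v)"
      using hval by (subst set_integrable_cong) auto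
  qed (use hint in auto)
  also have "\<dots> = (LINT v:{0<..}|lborel. (v powr (b - 1) * (1 + v) powr - (a + b)) *
      (LINT t:{0<..}|lborel. t powr (a + b - 1) * H t))"
  proof (intro set_lebesgue_integral_cong ballI allI impI)
    fix v :: real assume v: "v \<in> {0<..}"
    have "(LINT t:{0<..}|lborel. f t v)
        = (LINT t:{0<..}|lborel. (v powr (b - 1) * (1 + v) powr (1 - (a + b))) * (((1 + v) * t) powr (a + b - 1) * H ((1 + v) * t)))"
    proof (intro set_lebesgue_integral_cong ballI allI impI)
      fix t :: real assume t: "t \<in> {0<..}"
      have "(1 + v) powr (1 - (a + b)) * ((1 + v) * t) powr (a + b - 1) = t powr (a + b - 1)"
        using v t by (simp add: powr_mult mult.assoc[symmetric] powr_add[symmetric])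
      then show "f t v = (v powr (b - 1) * (1 + v) powr (1 - (a + b))) * (((1 + v) * t) powr (a + b - 1) * H ((1 + v) * t))"
        unfolding f_def by (metis (no_types, lifting) mult.commute mult.left_commute)
    qed auto
    also have "\<dots> = (v powr (b - 1) * (1 + v) powr (1 - (a + b))) * ((LINT t:{0<..}|lborel. t powr (a + b - 1) * H t) / (1 + v))"
      using integral_scale_halfline[of "1 + v" "\<lambda>t. t powr (a + b - 1) * H t"] v by simp
    also have "(1 + v) powr (1 - (a + b)) = (1 + v) powr - (a + b) * (1 + v)"
      using v by (simp add: powr_diff powr_minus powr_add divide_inverse)
    finally show "(LINT t:{0<..}|lborel. f t v) = (v powr (b - 1) * (1 + v) powr - (a + b)) *
      (LINT t:{0<..}|lborel. t powr (a + b - 1) * H t)"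
      using v by simp
  qed auto
  finally show ?thesis by (simp add: H_def)
qed

text \<open>The constant depends neither on \<open>g\<close> nor on \<open>e\<close>, so the case
  \<open>g = 1\<close>, \<open>e = 1\<close>, where the left side is Gamma(a) Gamma(b), evaluates
  the Beta integral.\<close>

lemma Gamma_convolution:
  fixes g :: "real \<Rightarrow> real"
  assumes a: "0 < a" and b: "0 < b" and e: "e > 0"
    and cont: "continuous_on {0<..} g" and bd: "\<And>t. t > 0 \<Longrightarrow> \<bar>g t\<bar> \<le> G"
  shows "(LINT t:{0<..}|lborel. t powr (a - 1) * (exp (- (e * t)) *
           (LINT s:{0<..}|lborel. s powr (b - 1) * (exp (- (e * s)) * g (s + t)))))
       = Gamma a * Gamma b / Gamma (a + b) *
         (LINT t:{0<..}|lborel. t powr (a + b - 1) * (exp (- (e * t)) * g t))"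
proof -
  have "(LINT v:{0<..}|lborel. v powr (b - 1) * (1 + v) powr - (a + b)) = Gamma a * Gamma b / Gamma (a + b)"
  proof -
    have I: "(LINT s:{0<..}|lborel. s powr (p - 1) * exp (- s)) = Gamma p" if "p > 0" for p :: real
      using Gamma_halfline(2)[OF that, of 1] by simp
    have "Gamma a * Gamma b = (LINT v:{0<..}|lborel. v powr (b - 1) * (1 + v) powr - (a + b)) * Gamma (a + b)"
      using Gamma_convolution_aux[OF a b, of 1 "\<lambda>_. 1" 1] a b
      by (simp add: I mult.assoc[symmetric])
    moreover have "Gamma (a + b) \<noteq> 0" using Gamma_real_pos[of "a + b"] a b by linarith
    ultimately show ?thesis by (simp add: field_simps)
  qed
  then show ?thesis using Gamma_convolution_aux[OF a b e cont bd] by simp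
qed

section \<open>Regularised fractional powers\<close>

context bounded_semigroup begin

section \<open>Resolvents at nonnegative real numbers\<close>

definition Rr :: "real \<Rightarrow> 'a \<Rightarrow>\<^sub>L 'a" where "Rr s = R (complex_of_real s)"

lemma Rr_0: "Rr 0 = J" by (simp add: Rr_def R_0)

lemma R_real_identity: "s \<ge> 0 \<Longrightarrow> Rr s x + s *\<^sub>R J (Rr s x) = J x"
  using R_J_identity[of "complex_of_real s" x]
  by (cases "s = 0") (auto simp: Rr_def R_0 scaleC_of_real)

lemma J_Rr: "s \<ge> 0 \<Longrightarrow> J (Rr s x) = Rr s (J x)"
  using R_J[of "complex_of_real s" x] by (cases "s = 0") (auto simp: Rr_def R_0)

lemma T_Rr: "s \<ge> 0 \<Longrightarrow> t \<ge> 0 \<Longrightarrow> T t (Rr s x) = Rr s (T t x)"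
  using R_T[of "complex_of_real s" t x] by (cases "s = 0") (auto simp: Rr_def R_0 J_T)

lemma J_inj: "J x = 0 \<Longrightarrow> x = 0"
proof -
  assume "J x = 0"
  then have "((\<lambda>h. 0) \<longlongrightarrow> - x) (at_right (0::real))" using J_deriv[of x] by (simp add: blinfun.bilinear_simps)
  then show "x = 0" using tendsto_const_iff[of "at_right (0::real)" 0 "- x"] by simp
qed

definition M :: real where "M = norm J * (1 + K)"

text \<open>The bound \<open>K / s\<close> fails near 0. Instead \<open>s *\<^sub>R Rr s\<close> is
  bounded by \<open>K\<close>, and \<open>Rr s x = J (x - s *\<^sub>R Rr s x)\<close> then gives
  \<open>norm J * (1 + K)\<close>.\<close>

lemma norm_Rr_le_M: "s \<ge> 0 \<Longrightarrow> norm (Rr s) \<le> M"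
proof (cases "s = 0")
  case True
  then show ?thesis using K_ge_1 by (simp add: Rr_0 M_def distrib_left)
next
  case False
  assume "s \<ge> 0"
  with False have s: "s > 0" by simp
  show ?thesis
  proof (rule norm_blinfun_bound)
    show "0 \<le> M" using K_ge_1 by (simp add: M_def)
    fix x
    have "norm (Rr s x) \<le> K / s * norm x"
      using norm_R[of "complex_of_real s"] s by (intro order_trans[OF norm_blinfun mult_right_mono]) (auto simp: Rr_def)
    then have "norm (s *\<^sub>R Rr s x) \<le> K * norm x" using s by (simp add: field_simps)
    have "Rr s x = J (x - s *\<^sub>R Rr s x)"
      using R_real_identity[OF \<open>s \<ge> 0\<close>, of x] by (simp add: blinfun.bilinear_simps algebra_simps)
    then have "norm (Rr s x) \<le> norm J * norm (x - s *\<^sub>R Rr s x)" by (metis norm_blinfun)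
    also have "\<dots> \<le> norm J * (norm x + K * norm x)"
      by (rule mult_left_mono) (use norm_triangle_ineq4[of x "s *\<^sub>R Rr s x"] \<open>norm (s *\<^sub>R Rr s x) \<le> K * norm x\<close> in linarith, simp)
    finally show "norm (Rr s x) \<le> M * norm x"
      by (simp add: M_def algebra_simps)
  qed
qed

lemma M_nonneg: "M \<ge> 0" using K_ge_1 by (simp add: M_def)

lemma norm_Rr: "s > 0 \<Longrightarrow> norm (Rr s) \<le> K / s"
  using norm_R[of "complex_of_real s"] by (simp add: Rr_def)

text \<open>Both sides are compared after applying \<open>J\<close>, where
  \<open>R_real_identity\<close> expresses everything through bounded operators; then
  \<open>J\<close> is cancelled by injectivity.\<close>

lemma resolvent_identity:
  assumes "r \<ge> 0" "s \<ge> 0"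
  shows "Rr r x - Rr s x = (s - r) *\<^sub>R Rr r (Rr s x)"
proof -
  have 1: "Rr r (J x) = Rr r (Rr s x) + s *\<^sub>R Rr r (J (Rr s x))"
    using arg_cong[OF R_real_identity[OF \<open>s \<ge> 0\<close>, of x], of "Rr r"] by (simp add: blinfun.bilinear_simps)
  have 2: "J (Rr s x) = Rr r (Rr s x) + r *\<^sub>R Rr r (J (Rr s x))"
    using R_real_identity[OF \<open>r \<ge> 0\<close>, of "Rr s x"] J_Rr[OF \<open>r \<ge> 0\<close>, of "Rr s x"] by simp
  have "J (Rr r x - Rr s x) = Rr r (J x) - J (Rr s x)"
    by (simp add: blinfun.bilinear_simps J_Rr[OF \<open>r \<ge> 0\<close>])
  also have "\<dots> = (s - r) *\<^sub>R Rr r (J (Rr s x))" using 1 2 by (simp add: algebra_simps)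
  also have "\<dots> = J ((s - r) *\<^sub>R Rr r (Rr s x))" by (simp add: blinfun.bilinear_simps J_Rr[OF \<open>r \<ge> 0\<close>])
  finally have "J ((Rr r x - Rr s x) - (s - r) *\<^sub>R Rr r (Rr s x)) = 0" by (simp add: blinfun.bilinear_simps)
  then show ?thesis using J_inj by fastforce
qed

lemma Rr_commute:
  assumes "r \<ge> 0" "s \<ge> 0"
  shows "Rr r (Rr s x) = Rr s (Rr r x)"
proof (cases "r = s")
  case False
  have "(s - r) *\<^sub>R Rr r (Rr s x) = (s - r) *\<^sub>R Rr s (Rr r x)"
    using resolvent_identity[OF assms, of x] resolvent_identity[OF assms(2,1), of x]
    by (smt (verit) minus_diff_eq scaleR_minus_left)
  then show ?thesis using False by simp
qed simp

lemma norm_Rr_diff: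
  assumes "r \<ge> 0" "s \<ge> 0"
  shows "norm (Rr r - Rr s) \<le> \<bar>s - r\<bar> * (norm (Rr r) * norm (Rr s))"
proof (rule norm_blinfun_bound)
  fix x
  have "norm ((Rr r - Rr s) x) = \<bar>s - r\<bar> * norm (Rr r (Rr s x))"
    using resolvent_identity[OF assms, of x] by (simp add: blinfun.bilinear_simps)
  also have "norm (Rr r (Rr s x)) \<le> norm (Rr r) * (norm (Rr s) * norm x)"
    by (meson mult_left_mono norm_blinfun norm_ge_zero order_trans)
  finally show "norm ((Rr r - Rr s) x) \<le> \<bar>s - r\<bar> * (norm (Rr r) * norm (Rr s)) * norm x"
    by (simp add: mult.assoc mult_left_mono)
qed auto

lemma continuous_on_Rr: "continuous_on {0..} Rr"
proof (rule lipschitz_on_continuous_on)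
  show "(M * M)-lipschitz_on {0..} Rr"
  proof (rule lipschitz_onI)
    fix r s :: real assume "r \<in> {0..}" "s \<in> {0..}"
    then have "norm (Rr r - Rr s) \<le> \<bar>s - r\<bar> * (M * M)"
      by (intro order_trans[OF norm_Rr_diff] mult_left_mono mult_mono norm_Rr_le_M M_nonneg) auto
    then show "dist (Rr r) (Rr s) \<le> M * M * dist r s"
      by (simp add: dist_norm dist_real_def abs_minus_commute mult.commute)
  qed (simp add: M_nonneg)
qed

text \<open>The fractional power $(e - A)^{-a}$ for $0 < a \le 1$.\<close>

definition shifted_power :: "real \<Rightarrow> real \<Rightarrow> 'a \<Rightarrow>\<^sub>L 'a" where
  "shifted_power e a = (if a = 1 then Rr e else
     (sin (pi * a) / pi) *\<^sub>R integral {0<..} (\<lambda>s. s powr - a *\<^sub>R Rr (s + e)))"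

text \<open>These are the bounds of \<open>integrable_on_halfline_powr_bounds\<close> with p = 1 - a
  and q = a. Both are uniform in \<open>e\<close>: \<open>M\<close> controls the resolvent near 0,
  and K/(s + e) \<le> K/s controls it at infinity.\<close>

lemma powr_Rr:
  assumes e: "e \<ge> 0" and a: "0 < a" "a < 1"
  shows "continuous_on {0<..} (\<lambda>s. s powr - a *\<^sub>R Rr (s + e))"
    and "\<And>s. s > 0 \<Longrightarrow> norm (s powr - a *\<^sub>R Rr (s + e)) \<le> M * s powr (1 - a - 1)"
    and "\<And>s. s > 0 \<Longrightarrow> norm (s powr - a *\<^sub>R Rr (s + e)) \<le> K * s powr (- a - 1)"
    and "(\<lambda>s. s powr - a *\<^sub>R Rr (s + e)) integrable_on {0<..}"
proof -
  show 1: "continuous_on {0<..} (\<lambda>s. s powr - a *\<^sub>R Rr (s + e))"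
    using e by (intro continuous_intros continuous_on_compose2[OF continuous_on_Rr]) auto
  show 2: "norm (s powr - a *\<^sub>R Rr (s + e)) \<le> M * s powr (1 - a - 1)" if "s > 0" for s
    using norm_Rr_le_M[of "s + e"] that e by (simp add: mult.commute mult_left_mono)
  show 3: "norm (s powr - a *\<^sub>R Rr (s + e)) \<le> K * s powr (- a - 1)" if "s > 0" for s
  proof -
    have "norm (Rr (s + e)) \<le> K / (s + e)" using that e by (intro norm_Rr) auto
    also have "\<dots> \<le> K / s" using that e K_ge_1 by (intro divide_left_mono) auto
    finally show ?thesis using that by (simp add: powr_diff field_simps)
  qed
  show "(\<lambda>s. s powr - a *\<^sub>R Rr (s + e)) integrable_on {0<..}"
    using a by (intro integrable_on_halfline_powr_bounds(1)[OF 1 _ _ 2 3]) auto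
qed

text \<open>With \<open>f\<close> the evaluation at a vector or a matrix coefficient, the
  operator-valued integral is reduced to integrals of vectors or of real numbers.\<close>

lemma shifted_power_has_integral:
  assumes "e \<ge> 0" "0 < a" "a < 1" and f: "bounded_linear f"
  shows "((\<lambda>s. s powr - a *\<^sub>R f (Rr (s + e))) has_integral (pi / sin (pi * a)) *\<^sub>R f (shifted_power e a)) {0<..}"
proof -
  interpret f: bounded_linear f by fact
  have "sin (pi * a) > 0" using assms by (intro sin_gt_zero) auto
  moreover have "((\<lambda>s. f (s powr - a *\<^sub>R Rr (s + e))) has_integral
      f (integral {0<..} (\<lambda>s. s powr - a *\<^sub>R Rr (s + e)))) {0<..}"
    using has_integral_linear[OF integrable_integral[OF powr_Rr(4)] f] assms by (simp add: o_def)
  ultimately show ?thesis using assms by (simp add: shifted_power_def f.scaleR)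
qed

lemma shifted_power_commute:
  assumes e: "e \<ge> 0" and a: "0 < a" "a \<le> 1" and S: "\<And>s x. s \<ge> 0 \<Longrightarrow> blinfun_apply S (Rr s x) = Rr s (S x)"
  shows "blinfun_apply S (shifted_power e a x) = shifted_power e a (S x)"
proof (cases "a = 1")
  case False
  with a have a: "0 < a" "a < 1" by auto
  have "((\<lambda>s. s powr - a *\<^sub>R S (Rr (s + e) x)) has_integral (pi / sin (pi * a)) *\<^sub>R S (shifted_power e a x)) {0<..}"
    by (rule shifted_power_has_integral[OF e a, of "\<lambda>F. S (F x)"])
      (intro bounded_linear_compose[OF blinfun.bounded_linear_right] blinfun.bounded_linear_left)
  moreover have "((\<lambda>s. s powr - a *\<^sub>R Rr (s + e) (S x)) has_integral (pi / sin (pi * a)) *\<^sub>R shifted_power e a (S x)) {0<..}"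
    by (rule shifted_power_has_integral[OF e a, of "\<lambda>F. F (S x)"]) (rule blinfun.bounded_linear_left)
  then have "((\<lambda>s. s powr - a *\<^sub>R S (Rr (s + e) x)) has_integral (pi / sin (pi * a)) *\<^sub>R shifted_power e a (S x)) {0<..}"
    by (rule has_integral_eq[rotated]) (use e in \<open>auto simp: S\<close>)
  ultimately have "(pi / sin (pi * a)) *\<^sub>R S (shifted_power e a x) = (pi / sin (pi * a)) *\<^sub>R shifted_power e a (S x)"
    by (rule has_integral_unique)
  moreover have "sin (pi * a) > 0" using a by (intro sin_gt_zero) auto
  ultimately show ?thesis by simp
qed (use S e in \<open>simp add: shifted_power_def\<close>)

text \<open>By the resolvent identity the integrands at \<open>e\<close> and at 0 differ by at most
  s^(-a) times \<open>e * (M * norm (Rr s))\<close>, and \<open>norm (Rr s)\<close> is bounded by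
  both M and K/s. The difference of the integrals is therefore at most a multiple of
  \<open>e\<close> in operator norm.\<close>

lemma tendsto_shifted_power:
  assumes a: "0 < a" "a \<le> 1"
  shows "((\<lambda>e. shifted_power e a) \<longlongrightarrow> shifted_power 0 a) (at_right 0)"
proof (cases "a = 1")
  case True
  have "(Rr \<longlongrightarrow> Rr 0) (at 0 within {0..})"
    using continuous_on_Rr unfolding continuous_on_def by auto
  then have "(Rr \<longlongrightarrow> Rr 0) (at_right 0)" by (rule tendsto_within_subset) auto
  then show ?thesis using True by (simp add: shifted_power_def)
next
  case False
  with a have a: "0 < a" "a < 1" by auto
  define C where "C = sin (pi * a) / pi * (M * M / (1 - a) + M * K / a)"
  have s: "sin (pi * a) > 0" using a by (intro sin_gt_zero) auto
  have "norm (shifted_power e a - shifted_power 0 a) \<le> C * e" if e: "e > 0" for e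
  proof -
    let ?f = "\<lambda>s. s powr - a *\<^sub>R Rr (s + e) - s powr - a *\<^sub>R Rr (s + 0)"
    have i: "?f integrable_on {0<..}" "integral {0<..} ?f = integral {0<..} (\<lambda>s. s powr - a *\<^sub>R Rr (s + e)) -
        integral {0<..} (\<lambda>s. s powr - a *\<^sub>R Rr (s + 0))"
      using powr_Rr(4)[of e a] powr_Rr(4)[of 0 a] a e by (auto intro!: integral_diff integrable_diff)
    have d: "norm (?f s) \<le> s powr - a * (e * (M * norm (Rr s)))" if "s > 0" for s
    proof -
      have "norm (?f s) = s powr - a * norm (Rr (s + e) - Rr s)"
        by (simp add: scaleR_diff_right[symmetric])
      also have "norm (Rr (s + e) - Rr s) \<le> \<bar>s - (s + e)\<bar> * (norm (Rr (s + e)) * norm (Rr s))"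
        using that e by (intro norm_Rr_diff) auto
      also have "\<dots> \<le> e * (M * norm (Rr s))"
        using that e norm_Rr_le_M[of "s + e"] by (auto intro!: mult_left_mono mult_right_mono)
      finally show ?thesis by (simp add: mult_left_mono)
    qed
    have "norm (integral {0<..} ?f) \<le> e * M * M * 1 powr (1 - a) / (1 - a) + e * M * K * 1 powr - a / a"
    proof (rule integrable_on_halfline_powr_bounds(2))
      show "continuous_on {0<..} ?f" using powr_Rr(1)[of e a] powr_Rr(1)[of 0 a] a e
        by (intro continuous_on_diff) auto
      show "norm (?f s) \<le> e * M * M * s powr (1 - a - 1)" if "s > 0" for s
        using order_trans[OF d[OF that] mult_left_mono[OF mult_left_mono[OF mult_left_mono[OF norm_Rr_le_M[of s] M_nonneg]]]] e that
        by (simp add: mult_ac)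
      show "norm (?f s) \<le> e * M * K * s powr (- a - 1)" if "s > 0" for s
        using order_trans[OF d[OF that] mult_left_mono[OF mult_left_mono[OF mult_left_mono[OF norm_Rr[OF that] M_nonneg]]]] e that
        by (simp add: mult_ac powr_diff divide_inverse)
    qed (use a in auto)
    then have "norm (integral {0<..} ?f) \<le> (M * M / (1 - a) + M * K / a) * e"
      by (simp add: algebra_simps)
    then have "(sin (pi * a) / pi) * norm (integral {0<..} ?f) \<le> C * e"
      unfolding C_def using s by (simp add: mult.assoc mult_left_mono divide_right_mono)
    moreover have "shifted_power e a - shifted_power 0 a = (sin (pi * a) / pi) *\<^sub>R integral {0<..} ?f"
      unfolding i(2) using a by (simp add: shifted_power_def scaleR_diff_right)
    ultimately show ?thesis using s by simp
  qed
  then have "\<forall>\<^sub>F e in at_right 0. norm (shifted_power e a - shifted_power 0 a) \<le> C * e"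
    by (intro eventually_mono[OF eventually_at_right_less])
  moreover have "((\<lambda>e. C * e) \<longlongrightarrow> 0) (at_right 0)"
    by (intro tendsto_mult_right_zero tendsto_ident_at)
  ultimately have "((\<lambda>e. shifted_power e a - shifted_power 0 a) \<longlongrightarrow> 0) (at_right 0)"
    by (rule Lim_null_comparison)
  then show ?thesis by (rule LIM_zero_cancel)
qed

lemma continuous_on_inner_T: "continuous_on {0<..} (\<lambda>t. T t x \<bullet> y)"
  by (intro continuous_intros continuous_on_subset[OF continuous_on_T]) auto

lemma inner_T_bound: "t > 0 \<Longrightarrow> \<bar>T t x \<bullet> y\<bar> \<le> K * norm x * norm y"
  by (rule order_trans[OF Cauchy_Schwarz_ineq2]) (intro mult_right_mono norm_T, auto)

lemma inner_Rr:
  assumes "s > 0"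
  shows "Rr s x \<bullet> y = (LINT t:{0<..}|lborel. exp (- (s * t)) * (T t x \<bullet> y))"
proof -
  have "orbit (complex_of_real s) x t = exp (- (s * t)) *\<^sub>R T t x" for t
    by (simp add: orbit_def scaleC_of_real[symmetric] exp_of_real[symmetric])
  then show ?thesis
    using inner_R_has_integral[of "complex_of_real s" x y]
      set_borel_integral_eq_integral(2)[OF inner_orbit_set_integrable[of "complex_of_real s" x y]] assms
    by (simp add: Rr_def integral_unique)
qed

text \<open>Insert the Laplace integral of the resolvent into the Stieltjes integral and use
  \<open>Stieltjes_halfline\<close>. The prefactor sin(pi a)/pi times Gamma(1-a) is 1/Gamma(a) by
  the reflection formula.\<close>

lemma inner_shifted_power:
  assumes e: "e > 0" and a: "0 < a" "a \<le> 1"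
  shows "shifted_power e a x \<bullet> y =
    (LINT t:{0<..}|lborel. t powr (a - 1) * (exp (- (e * t)) * (T t x \<bullet> y))) / Gamma a"
proof (cases "a = 1")
  case True
  have "(LINT t:{0<..}|lborel. t powr (a - 1) * (exp (- (e * t)) * (T t x \<bullet> y)))
      = (LINT t:{0<..}|lborel. exp (- (e * t)) * (T t x \<bullet> y))"
    using True by (intro set_lebesgue_integral_cong) auto
  then show ?thesis using inner_Rr[OF e] True by (simp add: shifted_power_def)
next
  case False
  with a have a: "0 < a" "a < 1" by auto
  have bl: "bounded_linear (\<lambda>F :: 'a \<Rightarrow>\<^sub>L 'a. F x \<bullet> y)"
    by (rule bounded_linear_compose[OF bounded_linear_inner_left blinfun.bounded_linear_left])
  have h: "((\<lambda>s. s powr - a * (Rr (s + e) x \<bullet> y)) has_integral (pi / sin (pi * a)) * (shifted_power e a x \<bullet> y)) {0<..}"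
    using shifted_power_has_integral[OF _ a bl, of e] e by simp
  have c: "continuous_on {0<..} (\<lambda>s. s powr - a * (Rr (s + e) x \<bullet> y))"
    using bounded_linear.continuous_on[OF bl powr_Rr(1)[of e a]] e a by (simp add: blinfun.bilinear_simps)
  have "set_integrable lborel {0<..} (\<lambda>s. s powr - a * (Rr (s + e) x \<bullet> y))"
  proof -
    have b: "\<bar>s powr - a * (Rr (s + e) x \<bullet> y)\<bar> \<le> norm x * norm y * norm (s powr - a *\<^sub>R Rr (s + e))" for s
    proof -
      have "\<bar>s powr - a * (Rr (s + e) x \<bullet> y)\<bar> = \<bar>(s powr - a *\<^sub>R Rr (s + e)) x \<bullet> y\<bar>"
        by (simp add: blinfun.bilinear_simps)
      also have "\<dots> \<le> norm (s powr - a *\<^sub>R Rr (s + e)) * norm x * norm y"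
        by (intro order_trans[OF Cauchy_Schwarz_ineq2] mult_right_mono norm_blinfun) auto
      finally show ?thesis by (simp add: mult_ac)
    qed
    have "(\<lambda>s. \<bar>s powr - a * (Rr (s + e) x \<bullet> y)\<bar>) integrable_on {0<..}"
    proof (rule integrable_on_halfline_powr_bounds(1))
      show "norm \<bar>s powr - a * (Rr (s + e) x \<bullet> y)\<bar> \<le> norm x * norm y * M * s powr (1 - a - 1)" if "s > 0" for s
        using order_trans[OF b mult_left_mono[OF powr_Rr(2)]] e a that by (simp add: mult.assoc)
      show "norm \<bar>s powr - a * (Rr (s + e) x \<bullet> y)\<bar> \<le> norm x * norm y * K * s powr (- a - 1)" if "s > 0" for s
        using order_trans[OF b mult_left_mono[OF powr_Rr(3)]] e a that by (simp add: mult.assoc)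
    qed (use a c in \<open>auto intro: continuous_on_rabs\<close>)
    then show ?thesis by (rule set_integrable_halfline_dominated[OF c order_refl])
  qed
  then have "(pi / sin (pi * a)) * (shifted_power e a x \<bullet> y)
      = (LINT s:{0<..}|lborel. s powr - a * (Rr (s + e) x \<bullet> y))"
    using h by (simp add: set_borel_integral_eq_integral(2) integral_unique)
  also have "\<dots> = (LINT s:{0<..}|lborel. s powr - a * (LINT t:{0<..}|lborel. exp (- ((s + e) * t)) * (T t x \<bullet> y)))"
    using e by (intro set_lebesgue_integral_cong) (auto simp: inner_Rr)
  also have "\<dots> = Gamma (1 - a) * (LINT t:{0<..}|lborel. t powr (a - 1) * (exp (- (e * t)) * (T t x \<bullet> y)))"
    by (rule Stieltjes_halfline[OF a e continuous_on_inner_T inner_T_bound])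
  finally have "(Gamma a * Gamma (1 - a)) * (shifted_power e a x \<bullet> y)
     = Gamma (1 - a) * (LINT t:{0<..}|lborel. t powr (a - 1) * (exp (- (e * t)) * (T t x \<bullet> y)))"
    by (simp only: Gamma_reflection_real)
  moreover have "Gamma (1 - a) > 0" "Gamma a > 0" using a by (auto intro: Gamma_real_pos)
  ultimately show ?thesis by (simp add: field_simps)
qed

text \<open>Moving \<open>T t\<close> inside the inner power produces \<open>T (s + t)\<close>, so
  \<open>Gamma_convolution\<close> applies to the matrix coefficient of \<open>T\<close>, and the
  Gamma factors cancel. The sum stays at most 1, the range in which \<open>shifted_power\<close> is
  the fractional power.\<close>

lemma shifted_power_mult:
  assumes e: "e > 0" and a: "0 < a" and b: "0 < b" and ab: "a + b \<le> 1"
  shows "shifted_power e a (shifted_power e b x) = shifted_power e (a + b) x"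
proof -
  have G: "Gamma a > 0" "Gamma b > 0" "Gamma (a + b) > 0" using a b by (auto intro: Gamma_real_pos)
  have "shifted_power e a (shifted_power e b x) \<bullet> y = shifted_power e (a + b) x \<bullet> y" for y
  proof -
    have "T t (shifted_power e b x) \<bullet> y =
       (LINT s:{0<..}|lborel. s powr (b - 1) * (exp (- (e * s)) * (T (s + t) x \<bullet> y))) / Gamma b" if "t > 0" for t
    proof -
      have "T t (shifted_power e b x) = shifted_power e b (T t x)"
        using that a b ab e by (intro shifted_power_commute T_Rr) auto
      then have "T t (shifted_power e b x) \<bullet> y =
        (LINT s:{0<..}|lborel. s powr (b - 1) * (exp (- (e * s)) * (T s (T t x) \<bullet> y))) / Gamma b"
        using inner_shifted_power[OF e b, of "T t x" y] a ab by simp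
      also have "(LINT s:{0<..}|lborel. s powr (b - 1) * (exp (- (e * s)) * (T s (T t x) \<bullet> y)))
        = (LINT s:{0<..}|lborel. s powr (b - 1) * (exp (- (e * s)) * (T (s + t) x \<bullet> y)))"
        using that by (intro set_lebesgue_integral_cong) (auto simp: T_add)
      finally show ?thesis .
    qed
    then have "(LINT t:{0<..}|lborel. t powr (a - 1) * (exp (- (e * t)) * (T t (shifted_power e b x) \<bullet> y)))
      = (LINT t:{0<..}|lborel. t powr (a - 1) * (exp (- (e * t)) *
           (LINT s:{0<..}|lborel. s powr (b - 1) * (exp (- (e * s)) * (T (s + t) x \<bullet> y)))) / Gamma b)"
      by (intro set_lebesgue_integral_cong) auto
    also have "\<dots> = (LINT t:{0<..}|lborel. t powr (a - 1) * (exp (- (e * t)) *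
           (LINT s:{0<..}|lborel. s powr (b - 1) * (exp (- (e * s)) * (T (s + t) x \<bullet> y))))) / Gamma b"
      by simp
    also have "\<dots> = Gamma a * Gamma b / Gamma (a + b) *
         (LINT t:{0<..}|lborel. t powr (a + b - 1) * (exp (- (e * t)) * (T t x \<bullet> y))) / Gamma b"
      by (simp only: Gamma_convolution[OF a b e continuous_on_inner_T inner_T_bound])
    finally have "shifted_power e a (shifted_power e b x) \<bullet> y = Gamma a * Gamma b / Gamma (a + b) *
         (LINT t:{0<..}|lborel. t powr (a + b - 1) * (exp (- (e * t)) * (T t x \<bullet> y))) / Gamma b / Gamma a"
      using inner_shifted_power[OF e a, of "shifted_power e b x" y] a b ab by simp
    then show ?thesis
      using inner_shifted_power[OF e _ ab, of x y] a b G by simp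
  qed
  then show ?thesis by (metis vector_eq_rdot)
qed

lemma shifted_power_0_mult:
  assumes a: "0 < a" and b: "0 < b" and ab: "a + b \<le> 1"
  shows "shifted_power 0 a (shifted_power 0 b x) = shifted_power 0 (a + b) x"
proof (rule tendsto_unique)
  have "((\<lambda>e. shifted_power e a (shifted_power e b x)) \<longlongrightarrow> shifted_power 0 a (shifted_power 0 b x)) (at_right 0)"
    using a b ab by (intro tendsto_intros tendsto_shifted_power) auto
  moreover have "\<forall>\<^sub>F e in at_right 0. shifted_power e a (shifted_power e b x) = shifted_power e (a + b) x"
    using eventually_at_right_less by eventually_elim (simp add: shifted_power_mult a b ab)
  ultimately show "((\<lambda>e. shifted_power e (a + b) x) \<longlongrightarrow> shifted_power 0 a (shifted_power 0 b x)) (at_right 0)"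
    by (rule Lim_transform_eventually)
  show "((\<lambda>e. shifted_power e (a + b) x) \<longlongrightarrow> shifted_power 0 (a + b) x) (at_right 0)"
    using a b ab by (intro tendsto_intros tendsto_shifted_power) auto
qed simp

end

section \<open>Fractional powers and the moment inequality\<close>

text \<open>The hypothesis is a logarithmic convexity, up to \<open>C\<close>, of the norms of the
  iterates. In the induction step the inequality already known, taken at \<open>F x\<close>, is
  combined with the power \<open>Suc n\<close> of the hypothesis, and a factor
  \<open>norm (F x) ^ n\<close> is cancelled.\<close>

lemma norm_power_le_norm_iterate:
  fixes F :: "'a::real_normed_vector \<Rightarrow> 'a"
  assumes C: "C \<ge> 0" and F: "\<And>x. norm (F x) ^ 2 \<le> C * norm x * norm (F (F x))"
  shows "\<exists>C'\<ge>0. \<forall>x. norm (F x) ^ Suc n \<le> C' * norm x ^ n * norm ((F ^^ Suc n) x)"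
proof (induction n)
  case 0
  show ?case by (intro exI[of _ 1]) simp
next
  case (Suc n)
  then obtain D where D: "D \<ge> 0" "\<And>x. norm (F x) ^ Suc n \<le> D * norm x ^ n * norm ((F ^^ Suc n) x)" by blast
  have "norm (F x) ^ Suc (Suc n) \<le> C ^ Suc n * D * norm x ^ Suc n * norm ((F ^^ Suc (Suc n)) x)" for x
  proof (cases "F x = 0")
    case False
    have "norm (F x) ^ n * norm (F x) ^ Suc (Suc n) = (norm (F x) ^ 2) ^ Suc n"
    proof -
      have "n + Suc (Suc n) = 2 * Suc n" by simp
      then show ?thesis by (simp only: power_add[symmetric] power_mult[symmetric])
    qed
    also have "\<dots> \<le> (C * norm x * norm (F (F x))) ^ Suc n"
      by (rule power_mono[OF F]) simp
    also have "\<dots> = (C * norm x) ^ Suc n * norm (F (F x)) ^ Suc n" by (rule power_mult_distrib)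
    also have "\<dots> \<le> (C * norm x) ^ Suc n * (D * norm (F x) ^ n * norm ((F ^^ Suc n) (F x)))"
      using C by (intro mult_left_mono D zero_le_power) auto
    also have "\<dots> = norm (F x) ^ n * (C ^ Suc n * D * norm x ^ Suc n * norm ((F ^^ Suc (Suc n)) x))"
      by (simp only: funpow_Suc_right o_apply power_mult_distrib mult_ac)
    finally show ?thesis using False by (subst (asm) mult_le_cancel_left_pos) auto
  qed (use C D in simp)
  then show ?case using C D by (intro exI[of _ "C ^ Suc n * D"]) auto
qed

context bounded_semigroup begin

text \<open>The fractional power $(-A)^{-a}$ for $a \ge 0$.\<close>

definition B :: "real \<Rightarrow> 'a \<Rightarrow>\<^sub>L 'a" where
  "B a = ((o\<^sub>L) J ^^ nat \<lfloor>a\<rfloor>) (if frac a = 0 then id_blinfun else shifted_power 0 (frac a))"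

lemma funpow_J_apply: "(((o\<^sub>L) J ^^ n) F) x = (blinfun_apply J ^^ n) (F x)"
  by (induction n) auto

lemma B_0 [simp]: "B 0 x = x" by (simp add: B_def)

lemma B_add_nat: "c \<ge> 0 \<Longrightarrow> B (c + real k) x = (blinfun_apply J ^^ k) (B c x)"
  by (simp add: B_def funpow_J_apply nat_add_distrib funpow_add add.commute[of _ k] frac_def
       del: of_nat_add)

lemma B_1: "B 1 = J"
  using B_add_nat[of 0 1] by (auto intro: blinfun_eqI)

lemma B_le_1: "0 < a \<Longrightarrow> a \<le> 1 \<Longrightarrow> B a = shifted_power 0 a"
  by (cases "a = 1") (simp add: B_1 shifted_power_def Rr_0, simp add: B_def frac_eq floor_eq_iff)

lemma B_commute:
  assumes S: "\<And>s x. s \<ge> 0 \<Longrightarrow> blinfun_apply S (Rr s x) = Rr s (S x)"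
  shows "S (B a x) = B a (S x)"
proof -
  have SJ: "S ((blinfun_apply J ^^ n) y) = (blinfun_apply J ^^ n) (S y)" for n y
    using S[of 0] by (induction n) (auto simp: Rr_0)
  have "S (shifted_power 0 (frac a) x) = shifted_power 0 (frac a) (S x)" if "frac a \<noteq> 0"
    using that frac_lt_1[of a] frac_ge_0[of a] by (intro shifted_power_commute S) linarith+
  then show ?thesis by (simp add: B_def funpow_J_apply SJ)
qed

lemma T_B: "t \<ge> 0 \<Longrightarrow> T t (B a x) = B a (T t x)"
  by (rule B_commute) (rule T_Rr)

lemma Rr_B: "s \<ge> 0 \<Longrightarrow> Rr s (B a x) = B a (Rr s x)"
  by (rule B_commute) (rule Rr_commute)

lemma J_B: "J (B a x) = B a (J x)"
  using Rr_B[of 0] by (simp add: Rr_0)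

lemma B_B_le_1: "0 < a \<Longrightarrow> 0 < b \<Longrightarrow> a + b \<le> 1 \<Longrightarrow> B a (B b x) = B (a + b) x"
  using shifted_power_0_mult[of a b x] by (simp add: B_le_1)

text \<open>Whole powers of \<open>J\<close> split off by \<open>B_add_nat\<close>, so only the
  fractional parts matter. If two fractional parts a and b add up to more than 1, \<open>B b\<close>
  is split into \<open>B (1 - a)\<close> and \<open>B (a + b - 1)\<close>, and \<open>B a\<close>
  together with \<open>B (1 - a)\<close> produces the carry \<open>J\<close>.\<close>

lemma B_B:
  assumes "a \<ge> 0" "b \<ge> 0"
  shows "B a (B b x) = B (a + b) x"
proof -
  have small: "B a (B b x) = B (a + b) x" if "0 \<le> a" "a < 1" "0 \<le> b" "b < 1" for a b x
  proof (cases "a = 0 \<or> b = 0 \<or> a + b \<le> 1")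
    case True
    then show ?thesis using that B_B_le_1[of a b x] by (cases "a = 0"; cases "b = 0") auto
  next
    case False
    then have "B b x = B (1 - a) (B (a + b - 1) x)"
      using that B_B_le_1[of "1 - a" "a + b - 1" x] by (simp add: algebra_simps)
    then have "B a (B b x) = J (B (a + b - 1) x)"
      using that False B_B_le_1[of a "1 - a" "B (a + b - 1) x"] by (simp add: B_1)
    also have "\<dots> = B (a + b) x" using False B_add_nat[of "a + b - 1" 1 x] by simp
    finally show ?thesis .
  qed
  have dec: "B c y = (blinfun_apply J ^^ nat \<lfloor>c\<rfloor>) (B (frac c) y)" if "c \<ge> 0" for c y
    using B_add_nat[of "frac c" "nat \<lfloor>c\<rfloor>" y] that by (simp add: frac_def)
  have J_iter: "B c ((blinfun_apply J ^^ n) y) = (blinfun_apply J ^^ n) (B c y)" for c n y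
    by (induction n) (simp_all add: J_B[symmetric])
  have "B a (B b x) = (blinfun_apply J ^^ (nat \<lfloor>b\<rfloor> + nat \<lfloor>a\<rfloor>)) (B (frac a) (B (frac b) x))"
    using assms by (simp add: dec[of a] dec[of b x] J_iter funpow_add)
  also have "\<dots> = (blinfun_apply J ^^ (nat \<lfloor>b\<rfloor> + nat \<lfloor>a\<rfloor>)) (B (frac a + frac b) x)"
    by (simp add: small frac_lt_1)
  also have "\<dots> = B (frac a + frac b + real (nat \<lfloor>b\<rfloor> + nat \<lfloor>a\<rfloor>)) x"
    by (rule B_add_nat[symmetric]) simp
  also have "frac a + frac b + real (nat \<lfloor>b\<rfloor> + nat \<lfloor>a\<rfloor>) = a + b"
    using assms by (simp add: frac_def)
  finally show ?thesis .
qed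

lemma B_has_integral:
  assumes "0 < a" "a < 1" and "bounded_linear f"
  shows "((\<lambda>s. s powr - a *\<^sub>R f (Rr s)) has_integral (pi / sin (pi * a)) *\<^sub>R f (B a)) {0<..}"
  using shifted_power_has_integral[of 0 a f] assms by (simp add: B_le_1)

text \<open>\<open>L s\<close> is $-A R(s,A)$, written without $A$.\<close>

definition L :: "real \<Rightarrow> 'a \<Rightarrow>\<^sub>L 'a" where "L s = id_blinfun - s *\<^sub>R Rr s"

lemma L_apply: "L s x = x - s *\<^sub>R Rr s x" by (simp add: L_def blinfun.bilinear_simps)

lemma norm_L: "s > 0 \<Longrightarrow> norm (L s) \<le> 1 + K"
proof -
  assume s: "s > 0"
  have "norm (L s) \<le> norm (id_blinfun :: 'a \<Rightarrow>\<^sub>L 'a) + s * norm (Rr s)"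
    using s norm_triangle_ineq4[of id_blinfun "s *\<^sub>R Rr s"] by (simp add: L_def)
  also have "\<dots> \<le> 1 + s * (K / s)"
    using s by (intro add_mono mult_left_mono norm_Rr norm_blinfun_id_le) auto
  finally show ?thesis using s by simp
qed

lemma Rr_eq_L_J: "s \<ge> 0 \<Longrightarrow> Rr s x = L s (J x)"
  using R_real_identity[of s x] J_Rr[of s x] by (simp add: L_apply algebra_simps)

text \<open>Both sides are -A R(s) R(r) x. The swap trades a bound of order 1/r for one of order
  1/s, which is the better one when r is small.\<close>

lemma L_Rr: "r \<ge> 0 \<Longrightarrow> s \<ge> 0 \<Longrightarrow> L s (Rr r x) = Rr s (L r x)"
  using resolvent_identity[of r s x] Rr_commute[of r s x]
  by (simp add: L_apply blinfun.bilinear_simps algebra_simps)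

text \<open>In the integral for (-A)^(-c), \<open>L_Rr\<close> bounds the integrand by a multiple of
  r^(-c)/s, used for r \<le> s; for r \<ge> s the direct bound of order r^(-c-1) is used. Cutting at
  \<tau> = s makes both parts of order s^(-c).\<close>

lemma norm_L_B:
  assumes c: "0 < c" "c < 1"
  shows "\<exists>C\<ge>0. \<forall>s>0. \<forall>y. norm (L s (B c y)) \<le> C * s powr - c * norm y"
proof (intro exI conjI allI impI)
  have sn: "sin (pi * c) > 0" using c by (intro sin_gt_zero) auto
  let ?C = "sin (pi * c) / pi * (K * (1 + K) * (1 / (1 - c) + 1 / c))"
  show "0 \<le> ?C" using sn c K_ge_1 by simp
  fix s :: real and y assume s: "s > 0"
  have bl: "bounded_linear (\<lambda>F :: 'a \<Rightarrow>\<^sub>L 'a. L s (F y))"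
    by (intro bounded_linear_compose[OF blinfun.bounded_linear_right] blinfun.bounded_linear_left)
  have h: "((\<lambda>r. r powr - c *\<^sub>R L s (Rr r y)) has_integral (pi / sin (pi * c)) *\<^sub>R L s (B c y)) {0<..}"
    by (rule B_has_integral[OF c bl])
  have "norm (integral {0<..} (\<lambda>r. r powr - c *\<^sub>R L s (Rr r y)))
      \<le> (K * (1 + K) * norm y / s) * s powr (1 - c) / (1 - c) + (K * (1 + K) * norm y) * s powr - c / c"
  proof (rule integrable_on_halfline_powr_bounds(2))
    show "continuous_on {0<..} (\<lambda>r. r powr - c *\<^sub>R L s (Rr r y))"
      by (intro continuous_intros continuous_on_subset[OF continuous_on_Rr]) auto
    show "norm (r powr - c *\<^sub>R L s (Rr r y)) \<le> (K * (1 + K) * norm y / s) * r powr (1 - c - 1)" if "r > 0" for r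
    proof -
      have "norm (L s (Rr r y)) = norm (Rr s (L r y))" using L_Rr[of r s y] that s by simp
      also have "\<dots> \<le> norm (Rr s) * (norm (L r) * norm y)"
        by (meson mult_left_mono norm_blinfun norm_ge_zero order_trans)
      also have "\<dots> \<le> K / s * ((1 + K) * norm y)"
        using that s K_ge_1 by (intro mult_mono norm_Rr norm_L) auto
      finally have "r powr - c * norm (L s (Rr r y)) \<le> r powr - c * (K / s * ((1 + K) * norm y))"
        by (rule mult_left_mono) simp
      then show ?thesis by (simp add: mult_ac)
    qed
    show "norm (r powr - c *\<^sub>R L s (Rr r y)) \<le> (K * (1 + K) * norm y) * r powr (- c - 1)" if "r > 0" for r
    proof -
      have "norm (L s (Rr r y)) \<le> norm (L s) * (norm (Rr r) * norm y)"
        by (meson mult_left_mono norm_blinfun norm_ge_zero order_trans)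
      also have "\<dots> \<le> (1 + K) * (K / r * norm y)"
        using that s K_ge_1 by (intro mult_mono norm_Rr norm_L) auto
      finally have "r powr - c * norm (L s (Rr r y)) \<le> r powr - c * ((1 + K) * (K / r * norm y))"
        by (rule mult_left_mono) simp
      then show ?thesis using that by (simp add: mult_ac powr_diff)
    qed
  qed (use c s in auto)
  also have "integral {0<..} (\<lambda>r. r powr - c *\<^sub>R L s (Rr r y)) = (pi / sin (pi * c)) *\<^sub>R L s (B c y)"
    using h by (rule integral_unique)
  also have "K * (1 + K) * norm y / s * s powr (1 - c) / (1 - c) + (K * (1 + K) * norm y) * s powr - c / c
      = K * (1 + K) * (1 / (1 - c) + 1 / c) * s powr - c * norm y"
  proof -
    have "K * (1 + K) * norm y / s * s powr (1 - c) = K * (1 + K) * norm y * s powr - c"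
      using s by (simp add: powr_diff powr_minus divide_inverse)
    then show ?thesis by (simp only:) (simp add: divide_inverse algebra_simps)
  qed
  finally have "pi / sin (pi * c) * norm (L s (B c y)) \<le> K * (1 + K) * (1 / (1 - c) + 1 / c) * s powr - c * norm y"
    using sn by simp
  then have "sin (pi * c) / pi * (pi / sin (pi * c) * norm (L s (B c y)))
      \<le> sin (pi * c) / pi * (K * (1 + K) * (1 / (1 - c) + 1 / c) * s powr - c * norm y)"
    using sn by (intro mult_left_mono) auto
  then show "norm (L s (B c y)) \<le> ?C * s powr - c * norm y"
    using sn by (simp add: mult.assoc)
qed

lemma B_inj: "0 \<le> a \<Longrightarrow> a \<le> 1 \<Longrightarrow> B a x = 0 \<Longrightarrow> x = 0"
  using B_B[of "1 - a" a x] J_inj[of x] by (simp add: B_1 blinfun.bilinear_simps)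

text \<open>Split the integral representing $(-A)^{-a}x$ at
  $\tau = (\|x\| / \|(-A)^{-b}x\|)^{1/b}$.\<close>

lemma moment_inequality:
  assumes ab: "0 < a" "a < b" "b < 1"
  shows "\<exists>C\<ge>0. \<forall>x. norm (B a x) \<le> C * norm x powr (1 - a / b) * norm (B b x) powr (a / b)"
proof -
  obtain C where C: "C \<ge> 0" "\<And>s y. s > 0 \<Longrightarrow> norm (L s (B (1 - b) y)) \<le> C * s powr (b - 1) * norm y"
    using norm_L_B[of "1 - b"] ab by auto
  have sn: "sin (pi * a) > 0" using ab by (intro sin_gt_zero) auto
  let ?C = "sin (pi * a) / pi * (C / (b - a) + K / a)"
  have "norm (B a x) \<le> ?C * norm x powr (1 - a / b) * norm (B b x) powr (a / b)" for x
  proof (cases "x = 0")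
    case False
    define X Y where "X = norm x" and "Y = norm (B b x)"
    have X: "X > 0" and Y: "Y > 0" using False B_inj[of b x] ab by (auto simp: X_def Y_def)
    define \<tau> where "\<tau> = (X / Y) powr (1 / b)"
    have "\<tau> > 0" using X Y by (simp add: \<tau>_def)
    have "norm (integral {0<..} (\<lambda>s. s powr - a *\<^sub>R Rr s x)) \<le> C * Y * \<tau> powr (b - a) / (b - a) + K * X * \<tau> powr - a / a"
    proof (rule integrable_on_halfline_powr_bounds(2))
      show "continuous_on {0<..} (\<lambda>s. s powr - a *\<^sub>R Rr s x)"
        by (intro continuous_intros continuous_on_subset[OF continuous_on_Rr]) auto
      show "norm (s powr - a *\<^sub>R Rr s x) \<le> C * Y * s powr (b - a - 1)" if "s > 0" for s
      proof -
        \<comment> \<open>Factoring \<open>J\<close> as \<open>B (1 - b)\<close> after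
          \<open>B b\<close> brings in the norm of \<open>B b x\<close>, with the rate s^(b-1) of
          \<open>norm_L_B\<close>, so that s^(-a) times it is integrable at 0. This is where both 0
          < b and b < 1 enter.\<close>
        have "Rr s x = L s (B (1 - b) (B b x))"
          using that ab B_B[of "1 - b" b x] by (simp add: Rr_eq_L_J B_1)
        then have "norm (Rr s x) \<le> C * s powr (b - 1) * Y" using C(2)[OF that] by (simp add: Y_def)
        then have "s powr - a * norm (Rr s x) \<le> s powr - a * (C * s powr (b - 1) * Y)"
          by (rule mult_left_mono) simp
        also have "\<dots> = C * Y * (s powr - a * s powr (b - 1))" by simp
        also have "s powr - a * s powr (b - 1) = s powr (b - a - 1)" by (simp add: powr_add[symmetric] algebra_simps)
        finally show ?thesis by simp
      qed
      show "norm (s powr - a *\<^sub>R Rr s x) \<le> K * X * s powr (- a - 1)" if "s > 0" for s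
      proof -
        have "norm (Rr s x) \<le> K / s * X"
          unfolding X_def using that by (intro order_trans[OF norm_blinfun mult_right_mono] norm_Rr) auto
        then have "s powr - a * norm (Rr s x) \<le> s powr - a * (K / s * X)"
          by (rule mult_left_mono) simp
        then show ?thesis using that by (simp add: powr_diff mult_ac)
      qed
    qed (use ab \<open>\<tau> > 0\<close> in auto)
    moreover have "\<tau> powr (b - a) * Y = X powr (1 - a / b) * Y powr (a / b)"
    proof -
      have "\<tau> powr (b - a) = (X / Y) powr (1 - a / b)"
        using ab by (simp add: \<tau>_def powr_powr diff_divide_distrib)
      then show ?thesis using X Y by (simp add: powr_divide powr_diff field_simps)
    qed
    moreover have "\<tau> powr - a * X = X powr (1 - a / b) * Y powr (a / b)"
    proof -
      have "\<tau> powr - a = (X / Y) powr - (a / b)"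
        using ab by (simp add: \<tau>_def powr_powr)
      then show ?thesis using X Y by (simp only:) (simp add: powr_divide powr_diff powr_minus field_simps)
    qed
    ultimately have "norm (integral {0<..} (\<lambda>s. s powr - a *\<^sub>R Rr s x))
        \<le> (C / (b - a) + K / a) * (X powr (1 - a / b) * Y powr (a / b))"
      by (simp add: algebra_simps)
    moreover have "integral {0<..} (\<lambda>s. s powr - a *\<^sub>R Rr s x) = (pi / sin (pi * a)) *\<^sub>R B a x"
      using B_has_integral[of a "\<lambda>F. F x"] ab by (intro integral_unique) (auto intro: blinfun.bounded_linear_left)
    ultimately have "pi / sin (pi * a) * norm (B a x) \<le> (C / (b - a) + K / a) * (X powr (1 - a / b) * Y powr (a / b))"
      using sn by simp
    then have "sin (pi * a) / pi * (pi / sin (pi * a) * norm (B a x))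
        \<le> sin (pi * a) / pi * ((C / (b - a) + K / a) * (X powr (1 - a / b) * Y powr (a / b)))"
      using sn by (intro mult_left_mono) auto
    then show ?thesis using sn by (simp add: mult.assoc X_def Y_def)
  qed (simp add: blinfun.bilinear_simps)
  moreover have "?C \<ge> 0" using sn ab C K_ge_1 by simp
  ultimately show ?thesis by blast
qed

text \<open>Required for every \<open>t > 0\<close> rather than for large \<open>t\<close>, so that
  \<open>decay_add\<close> can use it at \<open>t/2\<close> without a side condition; for \<rho>
  \<ge> 0 boundedness of the semigroup makes this no restriction.\<close>

definition decay :: "real \<Rightarrow> real \<Rightarrow> bool" where
  "decay a \<rho> \<longleftrightarrow> (\<exists>C\<ge>0. \<forall>t>0. \<forall>x. norm (T t (B a x)) \<le> C * t powr - \<rho> * norm x)"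

text \<open>Half of the time is spent on each of the two powers; the factor 2^(\<rho> + \<sigma>)
  comes from evaluating the rates at \<open>t/2\<close>.\<close>

lemma decay_add:
  assumes "decay a \<rho>" "decay b \<sigma>" "a \<ge> 0" "b \<ge> 0"
  shows "decay (a + b) (\<rho> + \<sigma>)"
proof -
  obtain C where C: "C \<ge> 0" "\<And>t x. t > 0 \<Longrightarrow> norm (T t (B a x)) \<le> C * t powr - \<rho> * norm x"
    using assms unfolding decay_def by blast
  obtain D where D: "D \<ge> 0" "\<And>t x. t > 0 \<Longrightarrow> norm (T t (B b x)) \<le> D * t powr - \<sigma> * norm x"
    using assms unfolding decay_def by blast
  have "norm (T t (B (a + b) x)) \<le> C * D * 2 powr (\<rho> + \<sigma>) * t powr - (\<rho> + \<sigma>) * norm x" if t: "t > 0" for t x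
  proof -
    have "T t (B (a + b) x) = T (t/2) (B a (T (t/2) (B b x)))"
      using T_add[of "t/2" "t/2"] t by (simp add: B_B[OF assms(3,4), symmetric] T_B)
    then have "norm (T t (B (a + b) x)) \<le> C * (t/2) powr - \<rho> * norm (T (t/2) (B b x))"
      using C(2)[of "t/2"] t by simp
    also have "\<dots> \<le> C * (t/2) powr - \<rho> * (D * (t/2) powr - \<sigma> * norm x)"
      using C D(2)[of "t/2"] t by (intro mult_left_mono) auto
    also have "\<dots> = C * D * 2 powr (\<rho> + \<sigma>) * t powr - (\<rho> + \<sigma>) * norm x"
    proof -
      have "(t/2) powr - \<rho> * (t/2) powr - \<sigma> = (t/2) powr - (\<rho> + \<sigma>)" by (simp add: powr_add[symmetric])
      also have "\<dots> = 2 powr (\<rho> + \<sigma>) * t powr - (\<rho> + \<sigma>)"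
      proof -
        have "(t/2) powr - p = 2 powr p * t powr - p" for p
          using t by (simp add: powr_divide powr_minus_divide)
        then show ?thesis .
      qed
      finally have "C * D * ((t/2) powr - \<rho> * (t/2) powr - \<sigma>) * norm x
          = C * D * (2 powr (\<rho> + \<sigma>) * t powr - (\<rho> + \<sigma>)) * norm x" by (simp only:)
      then show ?thesis by (simp only: mult_ac)
    qed
    finally show ?thesis .
  qed
  then show ?thesis unfolding decay_def using C D by (intro exI[of _ "C * D * 2 powr (\<rho> + \<sigma>)"]) auto
qed

lemma decay_mult_nat:
  assumes "decay a \<rho>" "a \<ge> 0"
  shows "decay (real (Suc n) * a) (real (Suc n) * \<rho>)"
proof (induction n)
  case (Suc n)
  show ?case using decay_add[OF assms(1) Suc assms(2)] assms by (simp add: algebra_simps)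
qed (use assms in simp)

text \<open>The moment inequality is applied to \<open>T t x\<close>: its first factor is bounded by
  \<open>K * norm x\<close>, its second by the assumed rate.\<close>

lemma decay_interpolate:
  assumes d: "decay a \<rho>" and "0 < \<theta>" "\<theta> < 1" "0 < a" "a < 1"
  shows "decay (\<theta> * a) (\<theta> * \<rho>)"
proof -
  obtain C where C: "C \<ge> 0" "\<And>t x. t > 0 \<Longrightarrow> norm (T t (B a x)) \<le> C * t powr - \<rho> * norm x"
    using assms unfolding decay_def by blast
  obtain D where D: "D \<ge> 0" "\<And>x. norm (B (\<theta> * a) x) \<le> D * norm x powr (1 - \<theta>) * norm (B a x) powr \<theta>"
    using moment_inequality[of "\<theta> * a" a] assms by auto
  have "norm (T t (B (\<theta> * a) x)) \<le> D * K powr (1 - \<theta>) * C powr \<theta> * t powr - (\<theta> * \<rho>) * norm x" if t: "t > 0" for t x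
  proof -
    have "norm (T t (B (\<theta> * a) x)) = norm (B (\<theta> * a) (T t x))" using t by (simp add: T_B)
    also have "\<dots> \<le> D * norm (T t x) powr (1 - \<theta>) * norm (B a (T t x)) powr \<theta>" by (rule D)
    also have "\<dots> \<le> D * (K * norm x) powr (1 - \<theta>) * (C * t powr - \<rho> * norm x) powr \<theta>"
    proof (intro mult_mono powr_mono2)
      show "norm (B a (T t x)) \<le> C * t powr - \<rho> * norm x" using C(2)[OF t, of x] t by (simp add: T_B)
    qed (use t assms D C norm_T K_ge_1 in auto)
    also have "\<dots> = D * K powr (1 - \<theta>) * C powr \<theta> * t powr - (\<theta> * \<rho>) * (norm x powr (1 - \<theta>) * norm x powr \<theta>)"
      using C K_ge_1 by (simp add: powr_mult powr_powr mult_ac)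
    also have "norm x powr (1 - \<theta>) * norm x powr \<theta> = norm x" by (simp add: powr_add[symmetric])
    finally show ?thesis .
  qed
  then show ?thesis unfolding decay_def using D by (intro exI[of _ "D * K powr (1 - \<theta>) * C powr \<theta>"]) auto
qed

lemma B_funpow: "a \<ge> 0 \<Longrightarrow> (blinfun_apply (B a) ^^ n) x = B (real n * a) x"
  by (induction n) (simp_all add: B_B algebra_simps)

text \<open>The exponent \<open>real (Suc n) * h\<close> may exceed 1, out of reach of
  \<open>moment_inequality\<close>. For the pair h, 2h that inequality is the hypothesis of
  \<open>norm_power_le_norm_iterate\<close> for \<open>B h\<close>, whose conclusion at
  \<open>T t x\<close> compares \<open>B h\<close> with \<open>B (real (Suc n) * h)\<close>; the
  rate follows by taking roots.\<close>

lemma decay_divide: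
  assumes d: "decay (real (Suc n) * h) (real (Suc n) * \<rho>)" and h: "0 < h" "2 * h < 1"
  shows "decay h \<rho>"
proof -
  obtain C where C: "C \<ge> 0" "\<And>t x. t > 0 \<Longrightarrow> norm (T t (B (real (Suc n) * h) x)) \<le> C * t powr - (real (Suc n) * \<rho>) * norm x"
    using d unfolding decay_def by blast
  obtain D where D: "D \<ge> 0" "\<And>x. norm (B h x) \<le> D * norm x powr (1/2) * norm (B (2 * h) x) powr (1/2)"
    using moment_inequality[of h "2 * h"] h by auto
  have "norm (B h x) ^ 2 \<le> D ^ 2 * norm x * norm (B h (B h x))" for x
  proof -
    have "norm (B h x) ^ 2 \<le> (D * norm x powr (1/2) * norm (B (2 * h) x) powr (1/2)) ^ 2"
      by (rule power_mono[OF D(2)]) simp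
    also have "\<dots> = D ^ 2 * norm x * norm (B (2 * h) x)"
      by (simp add: power_mult_distrib powr_half_sqrt)
    finally show ?thesis using B_B[of h h x] h by simp
  qed
  from norm_power_le_norm_iterate[OF _ this, of n] obtain E where E: "E \<ge> 0"
    "\<And>x. norm (B h x) ^ Suc n \<le> E * norm x ^ n * norm ((blinfun_apply (B h) ^^ Suc n) x)" by auto
  define c where "c = (E * K ^ n * C) powr (1 / real (Suc n))"
  have "norm (T t (B h x)) \<le> c * t powr - \<rho> * norm x" if t: "t > 0" for t x
  proof (rule power_le_imp_le_base)
    have "norm (T t (B h x)) ^ Suc n = norm (B h (T t x)) ^ Suc n" using t by (simp add: T_B)
    also have "\<dots> \<le> E * norm (T t x) ^ n * norm (B (real (Suc n) * h) (T t x))"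
      using E(2)[of "T t x"] h by (simp only: B_funpow)
    also have "\<dots> \<le> E * (K * norm x) ^ n * (C * t powr - (real (Suc n) * \<rho>) * norm x)"
    proof (intro mult_mono power_mono norm_T)
      show "norm (B (real (Suc n) * h) (T t x)) \<le> C * t powr - (real (Suc n) * \<rho>) * norm x"
        using C(2)[OF t, of x] t by (simp add: T_B)
    qed (use t E K_ge_1 in auto)
    also have "\<dots> = (E * K ^ n * C) * t powr - (real (Suc n) * \<rho>) * norm x ^ Suc n"
      by (simp add: power_mult_distrib)
    also have "E * K ^ n * C = c ^ Suc n"
      using E C K_ge_1 unfolding c_def powr_realpow'[symmetric]
      by (cases "E * K ^ n * C = 0") (auto simp: powr_realpow[symmetric] powr_powr simp del: power_Suc)
    also have "t powr - (real (Suc n) * \<rho>) = (t powr - \<rho>) ^ Suc n"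
      using t by (simp add: powr_realpow[symmetric] powr_powr mult.commute del: power_Suc)
    finally show "norm (T t (B h x)) ^ Suc n \<le> (c * t powr - \<rho> * norm x) ^ Suc n"
      by (simp only: power_mult_distrib)
  qed (simp add: c_def)
  then show ?thesis unfolding decay_def by (intro exI[of _ c]) (auto simp: c_def)
qed

text \<open>Dividing by a large N brings the exponent below 1/2, interpolation scales it by \<theta>
  = l N / m', with m' large enough for \<theta> < 1, and multiplication by m' ends at l a.\<close>

lemma decay_scale:
  assumes d: "decay a \<rho>" and a: "a > 0" and l: "l > 0"
  shows "decay (l * a) (l * \<rho>)"
proof -
  obtain n where n: "real n > 2 * a" using reals_Archimedean2 by blast
  define N where "N = real (Suc n)"
  have N: "N > 0" "2 * a < N" using n by (auto simp: N_def)
  have h: "decay (a / N) (\<rho> / N)"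
  proof (rule decay_divide)
    show "decay (real (Suc n) * (a / N)) (real (Suc n) * (\<rho> / N))" unfolding N_def[symmetric] using d N by simp
  qed (use a N in \<open>auto simp: divide_simps\<close>)
  obtain m where "real m > l * N" using reals_Archimedean2 by blast
  define m' where "m' = real (Suc m)"
  have m': "m' > 0" "l * N < m'" using \<open>real m > l * N\<close> by (auto simp: m'_def)
  define \<theta> where "\<theta> = l * N / m'"
  have th: "0 < \<theta>" "\<theta> < 1" using m' l N by (auto simp: \<theta>_def)
  have "decay (m' * (\<theta> * (a / N))) (m' * (\<theta> * (\<rho> / N)))"
    unfolding m'_def using th a N by (intro decay_mult_nat decay_interpolate h) (auto simp: divide_simps)
  then show ?thesis using m' N by (simp add: \<theta>_def)
qed

end

section \<open>Plancherel's theorem\<close>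

lemma (in pair_sigma_finite) integrable_product_mult:
  fixes f :: "'a \<Rightarrow> real" and g :: "'b \<Rightarrow> real"
  assumes f: "integrable M1 f" and g: "integrable M2 g"
  shows "integrable (M1 \<Otimes>\<^sub>M M2) (\<lambda>x. f (fst x) * g (snd x))"
proof (rule Fubini_integrable)
  have [measurable]: "f \<in> borel_measurable M1" "g \<in> borel_measurable M2" using f g by auto
  show "(\<lambda>x. f (fst x) * g (snd x)) \<in> borel_measurable (M1 \<Otimes>\<^sub>M M2)" by measurable
  show "integrable M1 (\<lambda>x. \<integral>y. norm (f (fst (x, y)) * g (snd (x, y))) \<partial>M2)"
    using f by (simp add: abs_mult)
  show "AE x in M1. integrable M2 (\<lambda>y. f (fst (x, y)) * g (snd (x, y)))"
    using g by simp
qed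

text \<open>The two values are rescaled real and imaginary parts of the characteristic function of
  the standard normal distribution.\<close>

lemma Gaussian_cos_sin:
  fixes e r :: real
  assumes e: "e > 0"
  shows "integrable lborel (\<lambda>\<eta>. exp (- ((e * \<eta>)\<^sup>2 / 2)))"
    and "(\<integral>\<eta>. exp (- ((e * \<eta>)\<^sup>2 / 2)) * cos (\<eta> * r) \<partial>lborel) = sqrt (2 * pi) / e * exp (- ((r / e)\<^sup>2 / 2))"
    and "(\<integral>\<eta>. exp (- ((e * \<eta>)\<^sup>2 / 2)) * sin (\<eta> * r) \<partial>lborel) = 0"
proof -
  have i1: "integrable lborel (\<lambda>v::real. exp (- (v\<^sup>2 / 2)))"
  proof -
    have "integrable lborel (\<lambda>v. sqrt (2 * pi) * (std_normal_density v * v ^ 0))"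
      by (intro integrable_mult_right integrable_std_normal_moment)
    then show ?thesis by (simp add: std_normal_density_def)
  qed
  show "integrable lborel (\<lambda>\<eta>. exp (- ((e * \<eta>)\<^sup>2 / 2)))"
    using lborel_integrable_real_affine[OF i1, of e 0] e by simp
  interpret N: prob_space std_normal_distribution by (rule prob_space_normal_density) simp
  interpret N: real_distribution std_normal_distribution by unfold_locales auto
  have ch: "(CLINT x|std_normal_distribution. iexp (t * x)) = complex_of_real (exp (- (t\<^sup>2) / 2))" for t
    using fun_cong[OF char_std_normal_distribution, of t] by (simp add: char_def)
  have ii: "complex_integrable std_normal_distribution (\<lambda>x. iexp (t * x))" for t
    by (rule N.integrable_iexp) auto
  have dens: "(\<integral>x. h x \<partial>std_normal_distribution) = (\<integral>v. exp (- (v\<^sup>2 / 2)) * h v \<partial>lborel) / sqrt (2 * pi)"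
    if "h \<in> borel_measurable borel" for h :: "real \<Rightarrow> real"
    using that by (subst integral_density) (auto simp: std_normal_density_def normal_density_nonneg)
  have c: "(\<integral>v. exp (- (v\<^sup>2 / 2)) * cos (v * t) \<partial>lborel) = sqrt (2 * pi) * exp (- (t\<^sup>2 / 2))" for t :: real
  proof -
    have "Re (CLINT x|std_normal_distribution. iexp (t * x)) = (\<integral>x. cos (x * t) \<partial>std_normal_distribution)"
      by (subst integral_Re[symmetric, OF ii]) (simp add: Re_exp mult.commute)
    then show ?thesis unfolding ch by (simp add: dens)
  qed
  have s: "(\<integral>v. exp (- (v\<^sup>2 / 2)) * sin (v * t) \<partial>lborel) = 0" for t :: real
  proof -
    have "Im (CLINT x|std_normal_distribution. iexp (t * x)) = (\<integral>x. sin (x * t) \<partial>std_normal_distribution)"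
      by (subst integral_Im[symmetric, OF ii]) (simp add: Im_exp mult.commute)
    then show ?thesis unfolding ch by (simp add: dens)
  qed
  show "(\<integral>\<eta>. exp (- ((e * \<eta>)\<^sup>2 / 2)) * cos (\<eta> * r) \<partial>lborel) = sqrt (2 * pi) / e * exp (- ((r / e)\<^sup>2 / 2))"
    using lborel_integral_real_affine[of e "\<lambda>v. exp (- (v\<^sup>2 / 2)) * cos (v * (r / e))" 0] e c[of "r / e"]
    by (simp add: field_simps)
  show "(\<integral>\<eta>. exp (- ((e * \<eta>)\<^sup>2 / 2)) * sin (\<eta> * r) \<partial>lborel) = 0"
    using lborel_integral_real_affine[of e "\<lambda>v. exp (- (v\<^sup>2 / 2)) * sin (v * (r / e))" 0] e s[of "r / e"]
    by (simp add: mult.commute)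
qed

text \<open>Plancherel's theorem for the Fourier transform of \<open>f\<close> on the half-line, where
  \<open>p t s + \<i> q t s\<close> is the inner product of \<open>f t\<close> and \<open>f s\<close> and \<open>N\<close> is the squared norm of the
  transform. Regularise by a Gaussian in \<open>\<eta>\<close> and let its width tend to infinity.\<close>

lemma Plancherel_halfline:
  fixes p q :: "real \<Rightarrow> real \<Rightarrow> real" and N :: "real \<Rightarrow> real"
  assumes \<xi>: "\<xi> > 0"
    and cp: "continuous_on ({0<..} \<times> {0<..}) (\<lambda>(t, s). p t s)"
    and cq: "continuous_on ({0<..} \<times> {0<..}) (\<lambda>(t, s). q t s)"
    and bp: "\<And>t s. t > 0 \<Longrightarrow> s > 0 \<Longrightarrow> \<bar>p t s\<bar> \<le> C * (exp (- (\<xi> * t)) * exp (- (\<xi> * s)))"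
    and bq: "\<And>t s. t > 0 \<Longrightarrow> s > 0 \<Longrightarrow> \<bar>q t s\<bar> \<le> C * (exp (- (\<xi> * t)) * exp (- (\<xi> * s)))"
    and N: "\<And>\<eta>. N \<eta> = (LINT t:{0<..}|lborel. LINT s:{0<..}|lborel. cos (\<eta> * (t - s)) * p t s + sin (\<eta> * (t - s)) * q t s)"
    and N_nonneg: "\<And>\<eta>. N \<eta> \<ge> 0"
  shows "integrable lborel N" and "integral\<^sup>L lborel N = 2 * pi * (LINT t:{0<..}|lborel. p t t)"
proof -
  have C: "C \<ge> 0"
    using order_trans[OF abs_ge_zero bp[of 1 1]] mult_neg_pos[of C "exp (- (\<xi> * 1)) * exp (- (\<xi> * 1))"]
    by force
  define P where "P = (\<lambda>(t, s). indicator {0<..} t * (indicator {0<..} s * p t s))"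
  define Q where "Q = (\<lambda>(t, s). indicator {0<..} t * (indicator {0<..} s * q t s))"
  have [measurable]: "P \<in> borel_measurable (lborel \<Otimes>\<^sub>M lborel)" "Q \<in> borel_measurable (lborel \<Otimes>\<^sub>M lborel)"
    unfolding P_def Q_def by (intro measurable_quadrant cp cq)+
  define a where "a t = indicator {0<..} t * exp (- (\<xi> * t))" for t :: real
  have a_int: "integrable lborel a"
  proof -
    have "set_integrable lborel {0<..} (\<lambda>t. exp (- (\<xi> * t)))"
      using has_integral_exp_halfline[OF \<xi>, of 1]
      by (intro set_integrable_halfline_dominated[where g = "\<lambda>t. exp (- (\<xi> * t))"]) (auto intro!: continuous_intros)
    then show ?thesis by (simp add: set_integrable_def a_def[abs_def])
  qed
  have a_nonneg: "a t \<ge> 0" for t by (simp add: a_def)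
  have Pb: "\<bar>P x\<bar> \<le> C * (a (fst x) * a (snd x))" and Qb: "\<bar>Q x\<bar> \<le> C * (a (fst x) * a (snd x))" for x
    using bp[of "fst x" "snd x"] bq[of "fst x" "snd x"]
    by (auto simp: P_def Q_def a_def split_def indicator_def)
  have aa_int: "integrable (lborel \<Otimes>\<^sub>M lborel) (\<lambda>x. a (fst x) * a (snd x))"
    by (rule lborel_pair.integrable_product_mult[OF a_int a_int])
  have trig: "\<bar>cos \<theta> * u + sin \<theta> * v\<bar> \<le> 2 * c" if "\<bar>u\<bar> \<le> c" "\<bar>v\<bar> \<le> c" for u v c \<theta> :: real
  proof -
    have "\<bar>cos \<theta> * u\<bar> \<le> 1 * c" "\<bar>sin \<theta> * v\<bar> \<le> 1 * c"
      unfolding abs_mult using that by (intro mult_mono abs_cos_le_one abs_sin_le_one; simp)+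
    then show ?thesis by linarith
  qed
  \<comment> \<open>The integrand of \<open>N \<eta>\<close>, extended by 0 to the whole plane. It
    is dominated by a product that does not depend on \<eta>; the Gaussian weight below makes it
    integrable in \<eta> as well.\<close>
  define \<kappa> where "\<kappa> \<eta> x = cos (\<eta> * (fst x - snd x)) * P x + sin (\<eta> * (fst x - snd x)) * Q x" for \<eta> and x :: "real \<times> real"
  have \<kappa>b: "\<bar>\<kappa> \<eta> x\<bar> \<le> 2 * C * (a (fst x) * a (snd x))" for \<eta> x
    using trig[OF Pb[of x] Qb[of x], of "\<eta> * (fst x - snd x)"] by (simp add: \<kappa>_def mult.assoc)
  have \<kappa>_int: "integrable (lborel \<Otimes>\<^sub>M lborel) (\<kappa> \<eta>)" for \<eta>
  proof (rule Bochner_Integration.integrable_bound)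
    show "integrable (lborel \<Otimes>\<^sub>M lborel) (\<lambda>x. 2 * C * (a (fst x) * a (snd x)))" using aa_int by simp
    show "\<kappa> \<eta> \<in> borel_measurable (lborel \<Otimes>\<^sub>M lborel)" unfolding \<kappa>_def by measurable
    show "AE x in lborel \<Otimes>\<^sub>M lborel. norm (\<kappa> \<eta> x) \<le> norm (2 * C * (a (fst x) * a (snd x)))"
      using \<kappa>b by (intro AE_I2) (auto intro: order_trans[OF _ abs_ge_self])
  qed
  have N_eq: "N \<eta> = integral\<^sup>L (lborel \<Otimes>\<^sub>M lborel) (\<kappa> \<eta>)" for \<eta>
  proof -
    have "\<kappa> \<eta> (t, s) = indicator {0<..} t * (indicator {0<..} s *
        (cos (\<eta> * (t - s)) * p t s + sin (\<eta> * (t - s)) * q t s))" for t s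
      by (simp add: \<kappa>_def P_def Q_def distrib_left mult_ac)
    then have "(\<integral>s. \<kappa> \<eta> (t, s) \<partial>lborel) = indicator {0<..} t *
        (LINT s:{0<..}|lborel. cos (\<eta> * (t - s)) * p t s + sin (\<eta> * (t - s)) * q t s)" for t
      by (simp add: set_lebesgue_integral_def)
    then show ?thesis
      using lborel_pair.integral_fst'[OF \<kappa>_int, of \<eta>] by (simp add: N set_lebesgue_integral_def)
  qed
  \<comment> \<open>With \<epsilon> decreasing to 0, the Gaussian weights \<open>w n\<close>
    increase to 1; any decreasing positive null sequence would do.\<close>
  define \<epsilon> where "\<epsilon> n = inverse (real (Suc n))" for n
  have \<epsilon>: "\<epsilon> n > 0" for n by (simp add: \<epsilon>_def)
  have \<epsilon>_lim: "\<epsilon> \<longlonglongrightarrow> 0" unfolding \<epsilon>_def by (rule LIMSEQ_inverse_real_of_nat)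
  define w where "w n \<eta> = exp (- ((\<epsilon> n * \<eta>)\<^sup>2 / 2))" for n \<eta>
  have w_int: "integrable lborel (w n)" for n
    unfolding w_def by (rule Gaussian_cos_sin(1)[OF \<epsilon>])
  have w_meas [measurable]: "w n \<in> borel_measurable lborel" for n using w_int by auto
  have w_pos: "w n \<eta> > 0" for n \<eta> by (simp add: w_def)
  interpret trip: pair_sigma_finite lborel "lborel \<Otimes>\<^sub>M lborel :: (real \<times> real) measure"
    by unfold_locales
  have \<Psi>_int: "integrable (lborel \<Otimes>\<^sub>M (lborel \<Otimes>\<^sub>M lborel)) (\<lambda>(\<eta>, x). w n \<eta> * \<kappa> \<eta> x)" for n
  proof (rule Bochner_Integration.integrable_bound)
    show "integrable (lborel \<Otimes>\<^sub>M (lborel \<Otimes>\<^sub>M lborel)) (\<lambda>y. w n (fst y) * (2 * C * (a (fst (snd y)) * a (snd (snd y)))))"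
      using aa_int by (intro trip.integrable_product_mult w_int) simp
    show "(\<lambda>(\<eta>, x). w n \<eta> * \<kappa> \<eta> x) \<in> borel_measurable (lborel \<Otimes>\<^sub>M (lborel \<Otimes>\<^sub>M lborel))"
      unfolding \<kappa>_def by measurable
    show "AE y in lborel \<Otimes>\<^sub>M (lborel \<Otimes>\<^sub>M lborel). norm (case y of (\<eta>, x) \<Rightarrow> w n \<eta> * \<kappa> \<eta> x)
        \<le> norm (w n (fst y) * (2 * C * (a (fst (snd y)) * a (snd (snd y)))))"
      using \<kappa>b[unfolded mult.assoc] C a_nonneg w_pos
      by (intro AE_I2) (auto simp: abs_mult less_imp_le intro!: mult_left_mono)
  qed
  have wN_int: "integrable lborel (\<lambda>\<eta>. w n \<eta> * N \<eta>)" for n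
    using trip.integrable_fst'[OF \<Psi>_int[of n]] by (simp add: N_eq)
  \<comment> \<open>The result of integrating \<eta> out: the cosine part gives a Gaussian in t - s
    of width \<epsilon> n, and the sine part vanishes, which is why \<open>q\<close> is absent from
    the final formula.\<close>
  define G where "G n x = sqrt (2 * pi) / \<epsilon> n * exp (- (((fst x - snd x) / \<epsilon> n)\<^sup>2 / 2)) * P x" for n and x :: "real \<times> real"
  have inner_\<eta>: "(\<integral>\<eta>. w n \<eta> * \<kappa> \<eta> x \<partial>lborel) = G n x" for n x
  proof -
    let ?r = "fst x - snd x"
    have bnd: "integrable lborel (\<lambda>\<eta>. w n \<eta> * cos (\<eta> * ?r))" "integrable lborel (\<lambda>\<eta>. w n \<eta> * sin (\<eta> * ?r))"
      by (rule Bochner_Integration.integrable_bound[OF w_int[of n]];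
          force simp: abs_mult mult_left_le)+
    have "(\<integral>\<eta>. w n \<eta> * \<kappa> \<eta> x \<partial>lborel) = (\<integral>\<eta>. (w n \<eta> * cos (\<eta> * ?r)) * P x + (w n \<eta> * sin (\<eta> * ?r)) * Q x \<partial>lborel)"
      by (simp add: \<kappa>_def algebra_simps)
    also have "\<dots> = (\<integral>\<eta>. w n \<eta> * cos (\<eta> * ?r) \<partial>lborel) * P x + (\<integral>\<eta>. w n \<eta> * sin (\<eta> * ?r) \<partial>lborel) * Q x"
      using bnd by simp
    also have "\<dots> = G n x"
      unfolding w_def Gaussian_cos_sin(2,3)[OF \<epsilon>] by (simp add: G_def)
    finally show ?thesis .
  qed
  have wN_val: "(\<integral>\<eta>. w n \<eta> * N \<eta> \<partial>lborel) = (\<integral>t. \<integral>s. G n (t, s) \<partial>lborel \<partial>lborel)" for n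
  proof -
    have "(\<integral>\<eta>. w n \<eta> * N \<eta> \<partial>lborel) = (\<integral>x. (\<integral>\<eta>. w n \<eta> * \<kappa> \<eta> x \<partial>lborel) \<partial>(lborel \<Otimes>\<^sub>M lborel))"
      using trip.Fubini_integral[OF \<Psi>_int[of n]] by (simp add: N_eq)
    also have "\<dots> = (\<integral>x. G n x \<partial>(lborel \<Otimes>\<^sub>M lborel))" by (simp add: inner_\<eta>)
    also have "\<dots> = (\<integral>t. \<integral>s. G n (t, s) \<partial>lborel \<partial>lborel)"
    proof (rule lborel_pair.integral_fst'[symmetric])
      have "integrable (lborel \<Otimes>\<^sub>M lborel) P"
        using \<kappa>_int[of 0] by (simp add: \<kappa>_def[abs_def])
      then have "integrable (lborel \<Otimes>\<^sub>M lborel) (\<lambda>x. sqrt (2 * pi) / \<epsilon> n * P x)" by simp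
      then show "integrable (lborel \<Otimes>\<^sub>M lborel) (G n)"
      proof (rule Bochner_Integration.integrable_bound)
        show "G n \<in> borel_measurable (lborel \<Otimes>\<^sub>M lborel)" unfolding G_def by measurable
        show "AE x in lborel \<Otimes>\<^sub>M lborel. norm (G n x) \<le> norm (sqrt (2 * pi) / \<epsilon> n * P x)"
          using \<epsilon>[of n] by (intro AE_I2) (auto simp: G_def abs_mult mult_left_le intro!: mult_right_mono divide_right_mono)
      qed
    qed
    finally show ?thesis .
  qed
  define I where "I n t = (\<integral>s. G n (t, s) \<partial>lborel)" for n t
  \<comment> \<open>Substituting s = t + \<epsilon> n v fixes the Gaussian and moves the
    concentration on the diagonal into the argument of \<open>P\<close>. The remaining weight has
    total mass 2 pi, the constant of the theorem.\<close>
  have I_eq: "I n t = (\<integral>v. sqrt (2 * pi) * exp (- (v\<^sup>2 / 2)) * P (t, t + \<epsilon> n * v) \<partial>lborel)" for n t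
  proof -
    have pt: "\<epsilon> n * G n (t, t + \<epsilon> n * v) = sqrt (2 * pi) * exp (- (v\<^sup>2 / 2)) * P (t, t + \<epsilon> n * v)" for v
      using \<epsilon>[of n] by (simp add: G_def)
    have "I n t = \<epsilon> n * (\<integral>v. G n (t, t + \<epsilon> n * v) \<partial>lborel)"
      unfolding I_def using lborel_integral_real_affine[of "\<epsilon> n" "\<lambda>s. G n (t, s)" t] \<epsilon>[of n] by simp
    also have "\<dots> = (\<integral>v. \<epsilon> n * G n (t, t + \<epsilon> n * v) \<partial>lborel)" by simp
    finally show ?thesis by (simp only: pt)
  qed
  have gauss: "integrable lborel (\<lambda>v::real. exp (- (v\<^sup>2 / 2)))" "(\<integral>v. exp (- (v\<^sup>2 / 2)) \<partial>lborel) = sqrt (2 * pi)"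
    using Gaussian_cos_sin(1)[of 1] Gaussian_cos_sin(2)[of 1 0] by simp_all
  have Pb1: "\<bar>P (t, s)\<bar> \<le> C * a t" for t s
  proof -
    have "a s \<le> 1" using \<xi> by (auto simp: a_def indicator_def)
    then have "C * (a t * a s) \<le> C * (a t * 1)" using C a_nonneg by (intro mult_left_mono) auto
    then show ?thesis using Pb[of "(t, s)"] by simp
  qed
  have I_bound: "\<bar>I n t\<bar> \<le> 2 * pi * C * a t" for n t
  proof -
    have "norm (I n t) \<le> (\<integral>v. sqrt (2 * pi) * exp (- (v\<^sup>2 / 2)) * (C * a t) \<partial>lborel)"
      unfolding I_eq
    proof (rule order_trans[OF integral_norm_bound integral_mono])
      show "integrable lborel (\<lambda>v. sqrt (2 * pi) * exp (- (v\<^sup>2 / 2)) * (C * a t))" using gauss by simp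
      then show "integrable lborel (\<lambda>v. norm (sqrt (2 * pi) * exp (- (v\<^sup>2 / 2)) * P (t, t + \<epsilon> n * v)))"
      proof (intro integrable_norm, rule Bochner_Integration.integrable_bound)
        show "(\<lambda>v. sqrt (2 * pi) * exp (- (v\<^sup>2 / 2)) * P (t, t + \<epsilon> n * v)) \<in> borel_measurable lborel"
          by measurable
        show "AE v in lborel. norm (sqrt (2 * pi) * exp (- (v\<^sup>2 / 2)) * P (t, t + \<epsilon> n * v))
            \<le> norm (sqrt (2 * pi) * exp (- (v\<^sup>2 / 2)) * (C * a t))"
          using Pb1 C a_nonneg by (intro AE_I2) (auto simp: abs_mult intro!: mult_left_mono)
      qed
      show "norm (sqrt (2 * pi) * exp (- (v\<^sup>2 / 2)) * P (t, t + \<epsilon> n * v)) \<le> sqrt (2 * pi) * exp (- (v\<^sup>2 / 2)) * (C * a t)" for v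
        using Pb1[of t "t + \<epsilon> n * v"] by (auto simp: abs_mult intro!: mult_left_mono)
    qed
    then show ?thesis using gauss by simp
  qed
  have I_lim: "(\<lambda>n. I n t) \<longlonglongrightarrow> 2 * pi * (indicator {0<..} t * p t t)" for t
  proof (cases "t > 0")
    case True
    have "(\<lambda>n. I n t) \<longlonglongrightarrow> (\<integral>v. sqrt (2 * pi) * exp (- (v\<^sup>2 / 2)) * p t t \<partial>lborel)"
      unfolding I_eq
    proof (rule integral_dominated_convergence[where w = "\<lambda>v. sqrt (2 * pi) * exp (- (v\<^sup>2 / 2)) * (C * a t)"])
      show "integrable lborel (\<lambda>v. sqrt (2 * pi) * exp (- (v\<^sup>2 / 2)) * (C * a t))" using gauss by simp
      show "(\<lambda>v. sqrt (2 * pi) * exp (- (v\<^sup>2 / 2)) * P (t, t + \<epsilon> n * v)) \<in> borel_measurable lborel" for n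
        by measurable
      show "AE v in lborel. norm (sqrt (2 * pi) * exp (- (v\<^sup>2 / 2)) * P (t, t + \<epsilon> n * v))
            \<le> sqrt (2 * pi) * exp (- (v\<^sup>2 / 2)) * (C * a t)" for n
        using Pb1 C a_nonneg by (intro AE_I2) (auto simp: abs_mult intro!: mult_left_mono)
      have "(\<lambda>n. P (t, t + \<epsilon> n * v)) \<longlonglongrightarrow> p t t" for v
      proof -
        have l: "(\<lambda>n. t + \<epsilon> n * v) \<longlonglongrightarrow> t"
          using tendsto_add[OF tendsto_const tendsto_mult_left_zero[OF \<epsilon>_lim, of v], of t] by simp
        have "isCont (\<lambda>(t, s). p t s) (t, t)"
          using True by (intro continuous_on_interior[OF cp]) (auto simp: interior_open open_Times)
        then have "(\<lambda>n. (\<lambda>(t, s). p t s) (t, t + \<epsilon> n * v)) \<longlonglongrightarrow> (\<lambda>(t, s). p t s) (t, t)"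
          by (rule isCont_tendsto_compose) (intro tendsto_Pair tendsto_const l)
        \<comment> \<open>\<open>P\<close> is cut off outside the quadrant, which the point t +
          \<epsilon> n v may leave for the first n when v < 0.\<close>
        moreover have "\<forall>\<^sub>F n in sequentially. (\<lambda>(t, s). p t s) (t, t + \<epsilon> n * v) = P (t, t + \<epsilon> n * v)"
          using order_tendstoD(1)[OF l True] by eventually_elim (simp add: P_def True)
        ultimately show ?thesis by (auto intro: Lim_transform_eventually)
      qed
      then show "AE v in lborel. (\<lambda>n. sqrt (2 * pi) * exp (- (v\<^sup>2 / 2)) * P (t, t + \<epsilon> n * v)) \<longlonglongrightarrow> sqrt (2 * pi) * exp (- (v\<^sup>2 / 2)) * p t t"
        by (intro AE_I2 tendsto_mult tendsto_const)
    qed auto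
    then show ?thesis using gauss True by simp
  next
    case False
    then show ?thesis by (simp add: I_eq P_def)
  qed
  have "(\<lambda>n. \<integral>t. I n t \<partial>lborel) \<longlonglongrightarrow> (\<integral>t. 2 * pi * (indicator {0<..} t * p t t) \<partial>lborel)"
  proof (rule integral_dominated_convergence[where w = "\<lambda>t. 2 * pi * C * a t"])
    show "integrable lborel (\<lambda>t. 2 * pi * C * a t)" using a_int by simp
    show "I n \<in> borel_measurable lborel" for n unfolding I_def G_def by measurable
    then show "(\<lambda>t. 2 * pi * (indicator {0<..} t * p t t)) \<in> borel_measurable lborel"
      using I_lim by (rule borel_measurable_LIMSEQ_real[rotated])
  qed (use I_lim I_bound in auto)
  then have lim: "(\<lambda>n. \<integral>\<eta>. w n \<eta> * N \<eta> \<partial>lborel) \<longlonglongrightarrow> 2 * pi * (LINT t:{0<..}|lborel. p t t)"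
    unfolding wN_val I_def[symmetric] by (simp add: set_lebesgue_integral_def)
  have w_lim: "(\<lambda>n. w n \<eta> * N \<eta>) \<longlonglongrightarrow> N \<eta>" for \<eta>
  proof -
    have "(\<lambda>n. w n \<eta> * N \<eta>) \<longlonglongrightarrow> exp (- ((0 * \<eta>)\<^sup>2 / 2)) * N \<eta>"
      unfolding w_def by (intro tendsto_intros \<epsilon>_lim) auto
    then show ?thesis by simp
  qed
  have w_mono: "mono (\<lambda>n. w n \<eta> * N \<eta>)" for \<eta>
  proof (rule monoI)
    fix m n :: nat assume "m \<le> n"
    then have "\<epsilon> n \<le> \<epsilon> m" by (simp add: \<epsilon>_def)
    then have "(\<epsilon> n * \<eta>)\<^sup>2 \<le> (\<epsilon> m * \<eta>)\<^sup>2"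
      using \<epsilon>[of n] by (simp add: power_mult_distrib mult_right_mono power_mono)
    then show "w m \<eta> * N \<eta> \<le> w n \<eta> * N \<eta>"
      using N_nonneg by (intro mult_right_mono) (auto simp: w_def)
  qed
  have N_meas: "N \<in> borel_measurable lborel"
  proof (rule borel_measurable_LIMSEQ_real)
    show "(\<lambda>n. w n \<eta> * N \<eta>) \<longlonglongrightarrow> N \<eta>" for \<eta> by (rule w_lim)
    show "(\<lambda>\<eta>. w n \<eta> * N \<eta>) \<in> borel_measurable lborel" for n using wN_int by auto
  qed
  \<comment> \<open>Monotone convergence, with the limit of the weighted integrals already known,
    yields integrability of \<open>N\<close> as part of its conclusion.\<close>
  note mc = wN_int AE_I2[OF w_mono] AE_I2[OF w_lim] lim N_meas
  show "integrable lborel N" by (rule integrable_monotone_convergence[OF mc])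
  show "integral\<^sup>L lborel N = 2 * pi * (LINT t:{0<..}|lborel. p t t)"
    by (rule integral_monotone_convergence[OF mc])
qed

context bounded_semigroup begin

text \<open>Expand the squared norm by inserting the Laplace integral in both slots of the inner
  product. With g(t) = e^(-\<xi> t) T(t) x, the integrand is the real part of e^(-i \<eta> (t - s))
  times the complex inner product p + iq of g(t) and g(s).\<close>

lemma resolvent_Plancherel:
  assumes \<xi>: "\<xi> > 0"
  shows "integrable lborel (\<lambda>\<eta>. (norm (R (Complex \<xi> \<eta>) x))\<^sup>2)"
    and "(\<integral>\<eta>. (norm (R (Complex \<xi> \<eta>) x))\<^sup>2 \<partial>lborel)
      = 2 * pi * (LINT t:{0<..}|lborel. exp (- (2 * \<xi> * t)) * (norm (T t x))\<^sup>2)"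
proof -
  define g where "g t = exp (- (\<xi> * t)) *\<^sub>R T t x" for t
  have cg: "continuous_on {0<..} g"
    unfolding g_def by (intro continuous_intros continuous_on_subset[OF continuous_on_T]) auto
  have orb: "orbit (Complex \<xi> \<eta>) x t = cis (- (\<eta> * t)) *\<^sub>C g t" for \<eta> t
  proof -
    have "exp (- (Complex \<xi> \<eta> * complex_of_real t)) = cis (- (\<eta> * t)) * complex_of_real (exp (- (\<xi> * t)))"
      by (simp add: complex_eq_iff Re_exp Im_exp)
    then show ?thesis by (simp add: orbit_def g_def scaleC_scaleC[symmetric] scaleC_of_real)
  qed
  have gb: "norm (g t) \<le> K * norm x * exp (- (\<xi> * t))" if "t > 0" for t
    using norm_T[of t x] that by (simp add: g_def mult.commute)
  define p where "p t s = g t \<bullet> g s" for t s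
  \<comment> \<open>The imaginary part of the complex inner product, written as a real inner product
    so that continuity and the Cauchy-Schwarz bound apply to it as to \<open>p\<close>.\<close>
  define q where "q t s = ((- \<i>) *\<^sub>C g t) \<bullet> g s" for t s
  have pq: "(cis \<theta> *\<^sub>C g t) \<bullet> (cis \<phi> *\<^sub>C g s) = cos (\<theta> - \<phi>) * p t s - sin (\<theta> - \<phi>) * q t s" for \<theta> \<phi> t s
  proof -
    have "cis \<theta> * cnj (cis \<phi>) = cis (\<theta> - \<phi>)" by (simp add: cis_cnj cis_mult)
    moreover have "q t s = Im (cinner (g t) (g s))"
      by (simp add: q_def Re_cinner[symmetric] cinner_scaleC_left del: complex_i_mult_minus)
    ultimately show ?thesis by (simp add: inner_scaleC_scaleC p_def Re_cinner)
  qed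
  have k: "orbit (Complex \<xi> \<eta>) x t \<bullet> orbit (Complex \<xi> \<eta>) x s = cos (\<eta> * (t - s)) * p t s + sin (\<eta> * (t - s)) * q t s" for \<eta> t s
  proof -
    have "- (\<eta> * t) - - (\<eta> * s) = - (\<eta> * (t - s))" by (simp add: algebra_simps)
    then show ?thesis unfolding orb pq by (simp only: cos_minus sin_minus)
  qed
  have lap: "R (Complex \<xi> \<eta>) x \<bullet> y = (LINT t:{0<..}|lborel. orbit (Complex \<xi> \<eta>) x t \<bullet> y)" for \<eta> y
    using inner_R_has_integral[of "Complex \<xi> \<eta>" x y]
      set_borel_integral_eq_integral(2)[OF inner_orbit_set_integrable[of "Complex \<xi> \<eta>" x y]] \<xi>
    by (simp add: integral_unique)
  have N: "(norm (R (Complex \<xi> \<eta>) x))\<^sup>2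
      = (LINT t:{0<..}|lborel. LINT s:{0<..}|lborel. cos (\<eta> * (t - s)) * p t s + sin (\<eta> * (t - s)) * q t s)" for \<eta>
  proof -
    have "(norm (R (Complex \<xi> \<eta>) x))\<^sup>2 = (LINT t:{0<..}|lborel. R (Complex \<xi> \<eta>) x \<bullet> orbit (Complex \<xi> \<eta>) x t)"
      unfolding power2_norm_eq_inner lap[of _ "R (Complex \<xi> \<eta>) x"] by (simp add: inner_commute)
    also have "\<dots> = (LINT t:{0<..}|lborel. LINT s:{0<..}|lborel. orbit (Complex \<xi> \<eta>) x t \<bullet> orbit (Complex \<xi> \<eta>) x s)"
      unfolding lap by (simp add: inner_commute)
    finally show ?thesis by (simp only: k)
  qed
  have pb: "\<bar>u t \<bullet> g s\<bar> \<le> (K * norm x)\<^sup>2 * (exp (- (\<xi> * t)) * exp (- (\<xi> * s)))"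
    if "t > 0" "s > 0" "norm (u t) = norm (g t)" for t s u
  proof -
    have "\<bar>u t \<bullet> g s\<bar> \<le> norm (g t) * norm (g s)" using Cauchy_Schwarz_ineq2[of "u t" "g s"] that by simp
    also have "\<dots> \<le> (K * norm x * exp (- (\<xi> * t))) * (K * norm x * exp (- (\<xi> * s)))"
      using that K_ge_1 by (intro mult_mono gb) auto
    finally show ?thesis by (simp add: power2_eq_square mult_ac)
  qed
  have cp: "continuous_on ({0<..} \<times> {0<..}) (\<lambda>(t, s). p t s)"
    unfolding p_def split_def
    by (rule continuous_on_inner; rule continuous_on_compose2[OF cg]; auto intro!: continuous_intros)
  have cq: "continuous_on ({0<..} \<times> {0<..}) (\<lambda>(t, s). q t s)"
    unfolding q_def split_def
    by (rule continuous_on_inner; (rule scaleC.continuous_on)?; (rule continuous_on_compose2[OF cg])?;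
        auto intro!: continuous_intros)
  note P = Plancherel_halfline[OF \<xi> cp cq _ _ N, where C = "(K * norm x)\<^sup>2"]
  have b: "\<bar>p t s\<bar> \<le> (K * norm x)\<^sup>2 * (exp (- (\<xi> * t)) * exp (- (\<xi> * s)))"
    "\<bar>q t s\<bar> \<le> (K * norm x)\<^sup>2 * (exp (- (\<xi> * t)) * exp (- (\<xi> * s)))" if "t > 0" "s > 0" for t s
    using pb[OF that, of g] pb[OF that, of "\<lambda>t. (- \<i>) *\<^sub>C g t"] by (auto simp: p_def q_def norm_scaleC)
  show "integrable lborel (\<lambda>\<eta>. (norm (R (Complex \<xi> \<eta>) x))\<^sup>2)" by (rule P(1)) (auto intro: b)
  have "(\<integral>\<eta>. (norm (R (Complex \<xi> \<eta>) x))\<^sup>2 \<partial>lborel) = 2 * pi * (LINT t:{0<..}|lborel. p t t)"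
    by (rule P(2)) (auto intro: b)
  moreover have "p t t = exp (- (2 * \<xi> * t)) * (norm (T t x))\<^sup>2" for t
    by (simp add: p_def g_def power2_norm_eq_inner[symmetric] exp_double[symmetric] power_mult_distrib power2_eq_square exp_add[symmetric])
  ultimately show "(\<integral>\<eta>. (norm (R (Complex \<xi> \<eta>) x))\<^sup>2 \<partial>lborel)
      = 2 * pi * (LINT t:{0<..}|lborel. exp (- (2 * \<xi> * t)) * (norm (T t x))\<^sup>2)" by simp
qed

end

section \<open>Decay rates and Laplace transforms\<close>

text \<open>The null function \<open>g\<close> may depend on \<open>e\<close>, the constant
  \<open>D\<close> may not, so the upper limit of \<open>f\<close> is at most \<open>e * D\<close>
  for every \<open>e\<close>. The split estimates below arise in this form.\<close>

lemma tendsto_0_of_linear_bounds: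
  fixes f :: "'a \<Rightarrow> real"
  assumes nonneg: "eventually (\<lambda>x. f x \<ge> 0) F"
    and bd: "\<And>e. e > 0 \<Longrightarrow> \<exists>g. (g \<longlongrightarrow> 0) F \<and> eventually (\<lambda>x. f x \<le> e * D + g x) F"
  shows "(f \<longlongrightarrow> 0) F"
proof (rule order_tendstoI)
  show "eventually (\<lambda>x. a < f x) F" if "a < 0" for a
    using nonneg by eventually_elim (use that in auto)
  fix a :: real assume a: "a > 0"
  define e where "e = a / (2 * (\<bar>D\<bar> + 1))"
  have e: "e > 0" using a by (simp add: e_def)
  have "e * D \<le> e * (\<bar>D\<bar> + 1)" using e by (intro mult_left_mono) auto
  also have "\<dots> = a / 2" by (simp add: e_def field_simps)
  finally have eD: "e * D \<le> a / 2" .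
  obtain g where g: "(g \<longlongrightarrow> 0) F" and "eventually (\<lambda>x. f x \<le> e * D + g x) F" using bd[OF e] by blast
  moreover have "eventually (\<lambda>x. g x < a / 2) F" by (rule order_tendstoD(2)[OF g]) (use a in simp)
  ultimately show "eventually (\<lambda>x. f x < a) F"
    using eD by (auto elim: eventually_elim2)
qed

lemma integral_halfline_le:
  fixes f :: "real \<Rightarrow> real"
  assumes "f integrable_on {0<..}" "(g has_integral I) {0<..}" "\<And>t. t > 0 \<Longrightarrow> f t \<le> g t"
  shows "integral {0<..} f \<le> I"
  using integral_le[of f "{0<..}" g] assms by (auto simp: has_integral_iff)

lemma has_integral_indicator_const:
  fixes c t :: real
  assumes "t \<ge> 0"
  shows "((\<lambda>s. if s \<in> {0<..t} then c else 0) has_integral c * t) {0::real<..}"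
proof -
  have "((\<lambda>s. c) has_integral c * t) {0..t}"
    using has_integral_const_real[of c 0 t] assms by (simp add: mult.commute)
  then have "((\<lambda>s. c) has_integral c * t) {0<..t}"
    by (subst has_integral_spike_set_eq[of _ "{0..t}"]) (auto intro: negligible_subset[of "{0}"])
  then show ?thesis by (subst has_integral_restrict) auto
qed

section \<open>Abelian estimates for Laplace transforms\<close>

context
  fixes u :: "real \<Rightarrow> real" and U :: real
  assumes u_nonneg: "\<And>t. t > 0 \<Longrightarrow> u t \<ge> 0" and u_bound: "\<And>t. t > 0 \<Longrightarrow> u t \<le> U"
    and u_cont: "continuous_on {0<..} u"
begin

lemma Laplace_integrable:
  assumes "\<xi> > 0"
  shows "(\<lambda>t. exp (- (2 * \<xi> * t)) * u t) integrable_on {0<..}"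
proof (rule dominated_integrable_on_halfline)
  show "continuous_on {0<..} (\<lambda>t. exp (- (2 * \<xi> * t)) * u t)" by (intro continuous_intros u_cont)
  show "norm (exp (- (2 * \<xi> * t)) * u t) \<le> U * exp (- (2 * \<xi> * t))" if "t > 0" for t
    using u_nonneg[OF that] u_bound[OF that] by simp
  show "(\<lambda>t. U * exp (- (2 * \<xi> * t))) integrable_on {0<..}"
    using has_integral_exp_halfline[of "2 * \<xi>" U] assms by auto
qed

lemma Laplace_nonneg: "\<xi> > 0 \<Longrightarrow> integral {0<..} (\<lambda>t. exp (- (2 * \<xi> * t)) * u t) \<ge> 0"
  by (intro Henstock_Kurzweil_Integration.integral_nonneg Laplace_integrable mult_nonneg_nonneg u_nonneg) auto

text \<open>Split at the time \<open>t1\<close> after which \<open>u t\<close> is below e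
  t^(-\<beta>). The part before \<open>t1\<close> contributes at most \<open>U * t1\<close>, which
  the factor \<xi>^(1-\<beta>) kills; the tail, extended to the whole half-line, gives e
  Gamma(1-\<beta>) (2 \<xi>)^(\<beta>-1), whence \<open>D\<close>.\<close>

lemma Laplace_powr_tendsto_0:
  assumes \<beta>: "0 < \<beta>" "\<beta> < 1" and lim: "((\<lambda>t. t powr \<beta> * u t) \<longlongrightarrow> 0) at_top"
  shows "((\<lambda>\<xi>. \<xi> powr (1 - \<beta>) * integral {0<..} (\<lambda>t. exp (- (2 * \<xi> * t)) * u t)) \<longlongrightarrow> 0) (at_right 0)"
proof (rule tendsto_0_of_linear_bounds[where D = "Gamma (1 - \<beta>) * 2 powr (\<beta> - 1)"])
  show "\<forall>\<^sub>F \<xi> in at_right 0. 0 \<le> \<xi> powr (1 - \<beta>) * integral {0<..} (\<lambda>t. exp (- (2 * \<xi> * t)) * u t)"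
    using eventually_at_right_less by eventually_elim (simp add: Laplace_nonneg)
  fix e :: real assume e: "e > 0"
  have "eventually (\<lambda>t. t powr \<beta> * u t < e) at_top" using order_tendstoD(2)[OF lim e] .
  then obtain t1 where t1: "t1 > 0" "\<And>t. t \<ge> t1 \<Longrightarrow> t powr \<beta> * u t < e"
    unfolding eventually_at_top_linorder by (metis linorder_le_cases max.bounded_iff max.cobounded1 max.strict_coboundedI2 zero_less_one)
  have main: "integral {0<..} (\<lambda>t. exp (- (2 * \<xi> * t)) * u t) \<le> U * t1 + e * (Gamma (1 - \<beta>) * (2 * \<xi>) powr - (1 - \<beta>))"
    if \<xi>: "\<xi> > 0" for \<xi>
  proof (rule integral_halfline_le[OF Laplace_integrable[OF \<xi>]])
    have "((\<lambda>t. t powr (1 - \<beta> - 1) * exp (- (2 * \<xi> * t))) has_integral Gamma (1 - \<beta>) * (2 * \<xi>) powr - (1 - \<beta>)) {0<..}"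
      using set_borel_integral_eq_integral[OF Gamma_halfline(1)[of "1 - \<beta>" "2 * \<xi>"]] Gamma_halfline(2)[of "1 - \<beta>" "2 * \<xi>"] \<beta> \<xi>
      by (simp add: has_integral_iff)
    then show "((\<lambda>t. (if t \<in> {0<..t1} then U else 0) + e * (t powr (1 - \<beta> - 1) * exp (- (2 * \<xi> * t)))) has_integral
        U * t1 + e * (Gamma (1 - \<beta>) * (2 * \<xi>) powr - (1 - \<beta>))) {0<..}"
      using t1 by (intro has_integral_add has_integral_indicator_const has_integral_mult_right) auto
    show "exp (- (2 * \<xi> * t)) * u t \<le> (if t \<in> {0<..t1} then U else 0) + e * (t powr (1 - \<beta> - 1) * exp (- (2 * \<xi> * t)))"
      if t: "t > 0" for t
    proof (cases "t \<le> t1")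
      case True
      have "exp (- (2 * \<xi> * t)) * u t \<le> 1 * U"
        using t \<xi> u_nonneg u_bound by (intro mult_mono) auto
      moreover have "0 \<le> e * (t powr (1 - \<beta> - 1) * exp (- (2 * \<xi> * t)))" using e by simp
      ultimately show ?thesis using True t by simp
    next
      case False
      then have "u t \<le> e * t powr - \<beta>" using t1(2)[of t] t by (simp add: powr_minus field_simps)
      then have "exp (- (2 * \<xi> * t)) * u t \<le> exp (- (2 * \<xi> * t)) * (e * t powr - \<beta>)" by (rule mult_left_mono) simp
      then show ?thesis using False by (simp add: mult_ac)
    qed
  qed
  have *: "\<xi> powr (1 - \<beta>) * integral {0<..} (\<lambda>t. exp (- (2 * \<xi> * t)) * u t)
      \<le> e * (Gamma (1 - \<beta>) * 2 powr (\<beta> - 1)) + U * t1 * \<xi> powr (1 - \<beta>)" if \<xi>: "\<xi> > 0" for \<xi>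
  proof -
    have "\<xi> powr (1 - \<beta>) * integral {0<..} (\<lambda>t. exp (- (2 * \<xi> * t)) * u t)
       \<le> \<xi> powr (1 - \<beta>) * (U * t1 + e * (Gamma (1 - \<beta>) * (2 * \<xi>) powr - (1 - \<beta>)))"
      using that by (intro mult_left_mono main) auto
    also have "\<dots> = U * t1 * \<xi> powr (1 - \<beta>) + e * Gamma (1 - \<beta>) * (\<xi> powr (1 - \<beta>) * (2 * \<xi>) powr - (1 - \<beta>))"
      by (simp add: algebra_simps)
    also have "\<xi> powr (1 - \<beta>) * (2 * \<xi>) powr - (1 - \<beta>) = 2 powr (\<beta> - 1)"
    proof -
      have "(2 * \<xi>) powr - (1 - \<beta>) = 2 powr - (1 - \<beta>) * \<xi> powr - (1 - \<beta>)" using \<xi> by (simp add: powr_mult)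
      then have "\<xi> powr (1 - \<beta>) * (2 * \<xi>) powr - (1 - \<beta>) = 2 powr - (1 - \<beta>) * (\<xi> powr (1 - \<beta>) * \<xi> powr - (1 - \<beta>))"
        by (simp only: mult_ac)
      also have "\<xi> powr (1 - \<beta>) * \<xi> powr - (1 - \<beta>) = 1" using \<xi> by (simp add: powr_add[symmetric])
      finally show ?thesis by simp
    qed
    finally show ?thesis by simp
  qed
  have "((\<lambda>\<xi>. \<xi> powr (1 - \<beta>)) \<longlongrightarrow> 0) (at_right 0)" using \<beta> by real_asymp
  then have "((\<lambda>\<xi>. U * t1 * \<xi> powr (1 - \<beta>)) \<longlongrightarrow> 0) (at_right 0)" by (rule tendsto_mult_right_zero)
  moreover have "\<forall>\<^sub>F \<xi> in at_right 0. \<xi> powr (1 - \<beta>) * integral {0<..} (\<lambda>t. exp (- (2 * \<xi> * t)) * u t)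
      \<le> e * (Gamma (1 - \<beta>) * 2 powr (\<beta> - 1)) + U * t1 * \<xi> powr (1 - \<beta>)"
    using eventually_at_right_less by eventually_elim (rule *)
  ultimately show "\<exists>g. (g \<longlongrightarrow> 0) (at_right 0) \<and> (\<forall>\<^sub>F \<xi> in at_right 0. \<xi> powr (1 - \<beta>) *
      integral {0<..} (\<lambda>t. exp (- (2 * \<xi> * t)) * u t) \<le> e * (Gamma (1 - \<beta>) * 2 powr (\<beta> - 1)) + g \<xi>)"
    by blast
qed

text \<open>The tail bound e/t is not integrable, so it is split once more at 1/\<xi>: below,
  dropping the exponential gives ln(1/\<xi>); above, 1/t \<le> \<xi> and the exponential contribute
  at most 1/2.\<close>

lemma Laplace_log_tendsto_0:
  assumes lim: "((\<lambda>t. t * u t) \<longlongrightarrow> 0) at_top"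
  shows "((\<lambda>\<xi>. 1 / ln (1 / \<xi>) * integral {0<..} (\<lambda>t. exp (- (2 * \<xi> * t)) * u t)) \<longlongrightarrow> 0) (at_right 0)"
proof (rule tendsto_0_of_linear_bounds[where D = 1])
  have small: "eventually (\<lambda>\<xi>::real. 0 < \<xi> \<and> \<xi> < 1) (at_right 0)"
    by (auto simp: eventually_at_right_field intro: exI[of _ 1])
  show "\<forall>\<^sub>F \<xi> in at_right 0. 0 \<le> 1 / ln (1 / \<xi>) * integral {0<..} (\<lambda>t. exp (- (2 * \<xi> * t)) * u t)"
    using small
  proof eventually_elim
    case (elim \<xi>)
    then show ?case using Laplace_nonneg[of \<xi>] by (intro mult_nonneg_nonneg) auto
  qed
  fix e :: real assume e: "e > 0"
  have "eventually (\<lambda>t. t * u t < e) at_top" using order_tendstoD(2)[OF lim e] .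
  \<comment> \<open>With t1 \<ge> 1, the times beyond \<open>t1\<close> and up to 1/\<xi> lie in
    \<open>{1..1 / \<xi>}\<close>.\<close>
  then obtain t1 where t1: "t1 \<ge> 1" "\<And>t. t \<ge> t1 \<Longrightarrow> t * u t < e"
    unfolding eventually_at_top_linorder by (meson linorder_le_cases order_trans)
  have main: "integral {0<..} (\<lambda>t. exp (- (2 * \<xi> * t)) * u t) \<le> U * t1 + e * (ln (1 / \<xi>) + \<xi> / (2 * \<xi>))"
    if \<xi>: "0 < \<xi>" "\<xi> < 1" for \<xi>
  proof (rule integral_halfline_le[OF Laplace_integrable[OF \<xi>(1)]])
    have "((\<lambda>t. 1 / t) has_integral ln (1 / \<xi>) - ln 1) {1..1 / \<xi>}"
      using \<xi> by (intro fundamental_theorem_of_calculus)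
        (auto simp: has_real_derivative_iff_has_vector_derivative[symmetric] intro!: derivative_eq_intros)
    then have "((\<lambda>t. if t \<in> {1..1 / \<xi>} then 1 / t else 0) has_integral ln (1 / \<xi>)) {0<..}"
      by (subst has_integral_restrict) auto
    moreover have "((\<lambda>t. \<xi> * exp (- (2 * \<xi> * t))) has_integral \<xi> / (2 * \<xi>)) {0<..}"
      using \<xi> by (intro has_integral_exp_halfline) auto
    ultimately show "((\<lambda>t. (if t \<in> {0<..t1} then U else 0) +
        e * ((if t \<in> {1..1 / \<xi>} then 1 / t else 0) + \<xi> * exp (- (2 * \<xi> * t)))) has_integral
        U * t1 + e * (ln (1 / \<xi>) + \<xi> / (2 * \<xi>))) {0<..}"
      using t1 by (intro has_integral_add has_integral_indicator_const has_integral_mult_right) auto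
    show "exp (- (2 * \<xi> * t)) * u t \<le> (if t \<in> {0<..t1} then U else 0) +
        e * ((if t \<in> {1..1 / \<xi>} then 1 / t else 0) + \<xi> * exp (- (2 * \<xi> * t)))"
      if t: "t > 0" for t
    proof (cases "t \<le> t1")
      case True
      have "exp (- (2 * \<xi> * t)) * u t \<le> 1 * U"
        using t \<xi> u_nonneg u_bound by (intro mult_mono) auto
      moreover have "0 \<le> e * ((if t \<in> {1..1 / \<xi>} then 1 / t else 0) + \<xi> * exp (- (2 * \<xi> * t)))"
        using e \<xi> by (intro mult_nonneg_nonneg add_nonneg_nonneg) auto
      ultimately show ?thesis using True t by simp
    next
      case False
      then have "u t \<le> e * (1 / t)" using t1(2)[of t] t by (simp add: field_simps)
      then have "exp (- (2 * \<xi> * t)) * u t \<le> exp (- (2 * \<xi> * t)) * (e * (1 / t))" by (rule mult_left_mono) simp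
      also have "\<dots> = e * (exp (- (2 * \<xi> * t)) * (1 / t))" by simp
      also have "\<dots> \<le> e * ((if t \<in> {1..1 / \<xi>} then 1 / t else 0) + \<xi> * exp (- (2 * \<xi> * t)))"
      proof (intro mult_left_mono)
        show "exp (- (2 * \<xi> * t)) * (1 / t) \<le> (if t \<in> {1..1 / \<xi>} then 1 / t else 0) + \<xi> * exp (- (2 * \<xi> * t))"
        proof (cases "t \<le> 1 / \<xi>")
          case True
          have "exp (- (2 * \<xi> * t)) * (1 / t) \<le> 1 * (1 / t)" using \<xi> t by (intro mult_right_mono) auto
          moreover have "0 \<le> \<xi> * exp (- (2 * \<xi> * t))" using \<xi> by simp
          ultimately show ?thesis using True False t1 by simp
        next
          case False
          then have "1 / t \<le> \<xi>" using t \<xi> by (simp add: field_simps)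
          then have "exp (- (2 * \<xi> * t)) * (1 / t) \<le> exp (- (2 * \<xi> * t)) * \<xi>" by (intro mult_left_mono) auto
          then show ?thesis using False by (simp add: mult.commute)
        qed
      qed (use e in simp)
      finally show ?thesis using False by simp
    qed
  qed
  have *: "1 / ln (1 / \<xi>) * integral {0<..} (\<lambda>t. exp (- (2 * \<xi> * t)) * u t)
      \<le> e * 1 + (U * t1 + e / 2) * (1 / ln (1 / \<xi>))" if \<xi>: "0 < \<xi>" "\<xi> < 1" for \<xi>
  proof -
    have l: "ln (1 / \<xi>) > 0" using \<xi> by (simp add: ln_div)
    have "1 / ln (1 / \<xi>) * integral {0<..} (\<lambda>t. exp (- (2 * \<xi> * t)) * u t)
       \<le> 1 / ln (1 / \<xi>) * (U * t1 + e * (ln (1 / \<xi>) + \<xi> / (2 * \<xi>)))"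
      using that l by (intro mult_left_mono main) auto
    also have "\<dots> = e * 1 + (U * t1 + e / 2) * (1 / ln (1 / \<xi>))"
      using l \<xi> by (simp add: field_simps)
    finally show ?thesis .
  qed
  have "((\<lambda>\<xi>::real. 1 / ln (1 / \<xi>)) \<longlongrightarrow> 0) (at_right 0)" by real_asymp
  then have "((\<lambda>\<xi>. (U * t1 + e / 2) * (1 / ln (1 / \<xi>))) \<longlongrightarrow> 0) (at_right 0)" by (rule tendsto_mult_right_zero)
  moreover have "\<forall>\<^sub>F \<xi> in at_right 0. 1 / ln (1 / \<xi>) * integral {0<..} (\<lambda>t. exp (- (2 * \<xi> * t)) * u t)
      \<le> e * 1 + (U * t1 + e / 2) * (1 / ln (1 / \<xi>))"
    using small by eventually_elim (rule *, auto)
  ultimately show "\<exists>g. (g \<longlongrightarrow> 0) (at_right 0) \<and> (\<forall>\<^sub>F \<xi> in at_right 0. 1 / ln (1 / \<xi>) *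
      integral {0<..} (\<lambda>t. exp (- (2 * \<xi> * t)) * u t) \<le> e * 1 + g \<xi>)"
    by blast
qed

end

section \<open>From decay to Laplace transforms and back\<close>

context bounded_semigroup begin

definition lapl :: "real \<Rightarrow> 'a \<Rightarrow> real" where
  "lapl \<xi> y = integral {0<..} (\<lambda>t. exp (- (2 * \<xi> * t)) * (norm (T t y))\<^sup>2)"

lemma norm_T_sq:
  "t > 0 \<Longrightarrow> 0 \<le> (norm (T t y))\<^sup>2" "t > 0 \<Longrightarrow> (norm (T t y))\<^sup>2 \<le> (K * norm y)\<^sup>2"
  "continuous_on {0<..} (\<lambda>t. (norm (T t y))\<^sup>2)"
proof -
  show "(norm (T t y))\<^sup>2 \<le> (K * norm y)\<^sup>2" if "t > 0"
    using that by (intro power_mono norm_T) auto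
  show "continuous_on {0<..} (\<lambda>t. (norm (T t y))\<^sup>2)"
    by (intro continuous_intros continuous_on_subset[OF continuous_on_T]) auto
qed simp

lemma lapl_integrable: "\<xi> > 0 \<Longrightarrow> (\<lambda>t. exp (- (2 * \<xi> * t)) * (norm (T t y))\<^sup>2) integrable_on {0<..}"
  by (rule Laplace_integrable[OF norm_T_sq])

lemma resolvent_sq_eq_lapl:
  assumes "\<xi> > 0"
  shows "(\<integral>\<eta>. (norm (R (Complex \<xi> \<eta>) y))\<^sup>2 \<partial>lborel) = 2 * pi * lapl \<xi> y"
proof -
  have c: "continuous_on {0<..} (\<lambda>t. exp (- (2 * \<xi> * t)) * (norm (T t y))\<^sup>2)"
    by (intro continuous_intros norm_T_sq)
  have "set_integrable lborel {0<..} (\<lambda>t. exp (- (2 * \<xi> * t)) * (norm (T t y))\<^sup>2)"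
    by (rule set_integrable_halfline_dominated[OF c _ lapl_integrable[OF assms, of y]]) simp
  then show ?thesis
    using resolvent_Plancherel(2)[OF assms] by (simp add: set_borel_integral_eq_integral(2) lapl_def)
qed

text \<open>For s \<le> t, \<open>norm (T t y) \<le> K * norm (T s y)\<close> and e^(2 - 2s/t) \<ge>
  1; integrating the squares over s in (0, t] gives the constant. This ties the time t to \<xi> =
  1/t.\<close>

lemma norm_T_le_lapl:
  assumes t: "t > 0"
  shows "t * (norm (T t y))\<^sup>2 \<le> (K * exp 1)\<^sup>2 * lapl (1 / t) y"
proof -
  have "((\<lambda>s. if s \<in> {0<..t} then (norm (T t y))\<^sup>2 else 0) has_integral (norm (T t y))\<^sup>2 * t) {0<..}"
    using t by (intro has_integral_indicator_const) auto
  moreover have "((\<lambda>s. (K * exp 1)\<^sup>2 * (exp (- (2 * (1 / t) * s)) * (norm (T s y))\<^sup>2)) has_integral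
      (K * exp 1)\<^sup>2 * lapl (1 / t) y) {0<..}"
    unfolding lapl_def using t by (intro has_integral_mult_right integrable_integral lapl_integrable) simp
  ultimately have "(norm (T t y))\<^sup>2 * t \<le> (K * exp 1)\<^sup>2 * lapl (1 / t) y"
  proof (rule has_integral_le)
    fix s :: real assume s: "s \<in> {0<..}"
    show "(if s \<in> {0<..t} then (norm (T t y))\<^sup>2 else 0) \<le> (K * exp 1)\<^sup>2 * (exp (- (2 * (1 / t) * s)) * (norm (T s y))\<^sup>2)"
    proof (cases "s \<le> t")
      case True
      have "T t y = T (t - s) (T s y)" using T_add[of "t - s" s y] True s by simp
      then have "norm (T t y) \<le> K * norm (T s y)" using norm_T[of "t - s" "T s y"] True by simp
      then have "(norm (T t y))\<^sup>2 \<le> (K * norm (T s y))\<^sup>2" by (rule power_mono) simp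
      also have "\<dots> \<le> (K * norm (T s y))\<^sup>2 * exp (2 - 2 * (1 / t) * s)"
      proof -
        have "1 \<le> exp (2 - 2 * (1 / t) * s)" using True t by (simp add: field_simps)
        from mult_left_mono[OF this, of "(K * norm (T s y))\<^sup>2"] show ?thesis by simp
      qed
      also have "\<dots> = (K * exp 1)\<^sup>2 * (exp (- (2 * (1 / t) * s)) * (norm (T s y))\<^sup>2)"
        by (simp add: power_mult_distrib exp_double[symmetric] exp_diff exp_minus divide_inverse)
      finally show ?thesis using True s by simp
    qed simp
  qed
  then show ?thesis by (simp add: mult.commute)
qed

text \<open>The difference quotients of \<open>T h (J x)\<close> at 0 tend to \<open>- x\<close>,
  and they lie in the range of \<open>J\<close> because \<open>J\<close> commutes with the
  semigroup.\<close>

lemma range_J_dense: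
  assumes "e > 0"
  shows "\<exists>v. norm (x - J v) < e"
proof -
  have "eventually (\<lambda>h. dist ((T h (J x) - J x) /\<^sub>R h) (- x) < e) (at_right 0)"
    by (rule tendstoD[OF J_deriv assms])
  then have "eventually (\<lambda>h. h > 0 \<and> dist ((T h (J x) - J x) /\<^sub>R h) (- x) < e) (at_right 0)"
    using eventually_at_right_less by (rule eventually_elim2) auto
  then obtain h where h: "h > 0" "dist ((T h (J x) - J x) /\<^sub>R h) (- x) < e"
    using eventually_happens' trivial_limit_at_right_real by blast
  have "J ((x - T h x) /\<^sub>R h) = - ((T h (J x) - J x) /\<^sub>R h)"
    using h(1) J_T[of h x] by (simp add: blinfun.bilinear_simps scaleR_diff_right)
  then have "norm (x - J ((x - T h x) /\<^sub>R h)) = dist ((T h (J x) - J x) /\<^sub>R h) (- x)"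
    by (simp add: dist_norm add.commute)
  then show ?thesis using h by metis
qed

text \<open>Up to an error of norm below e, to which the rate t^(-\<gamma>) applies, x is a vector
  \<open>J v\<close>. On \<open>J v\<close>, which is \<open>B (k * \<alpha>) w\<close>, the rate
  improves to t^(-\<gamma>-k), so multiplying by t^\<gamma> still leaves a null function.\<close>

lemma decay_imp_tendsto:
  assumes d: "decay \<alpha> 1" and \<alpha>: "\<alpha> > 0" and g: "\<gamma> > 0"
  shows "((\<lambda>t. t powr \<gamma> * norm (T t (B (\<alpha> * \<gamma>) x))) \<longlongrightarrow> 0) at_top"
proof -
  \<comment> \<open>Any k > 0 with k \<alpha> \<le> 1 serves: then \<open>J\<close> factors through
    \<open>B (k * \<alpha>)\<close>.\<close>
  define k where "k = min 1 (1 / \<alpha>)"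
  have k: "k > 0" "k * \<alpha> \<le> 1" using \<alpha> by (auto simp: k_def min_def field_simps)
  have "decay (\<alpha> * \<gamma>) \<gamma>" "decay (\<alpha> * \<gamma> + k * \<alpha>) (\<gamma> + k)"
    using decay_scale[OF d \<alpha> g] decay_scale[OF d \<alpha>, of "\<gamma> + k"] k g by (simp_all add: algebra_simps)
  then obtain C1 C2 where C1: "C1 \<ge> 0" "\<And>t x. t > 0 \<Longrightarrow> norm (T t (B (\<alpha> * \<gamma>) x)) \<le> C1 * t powr - \<gamma> * norm x"
    and C2: "\<And>t x. t > 0 \<Longrightarrow> norm (T t (B (\<alpha> * \<gamma> + k * \<alpha>) x)) \<le> C2 * t powr - (\<gamma> + k) * norm x"
    unfolding decay_def by blast
  show ?thesis
  proof (rule tendsto_0_of_linear_bounds[where D = C1])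
    show "\<forall>\<^sub>F t in at_top. 0 \<le> t powr \<gamma> * norm (T t (B (\<alpha> * \<gamma>) x))" by simp
    fix e :: real assume "e > 0"
    then obtain v where v: "norm (x - J v) < e" using range_J_dense by blast
    define w where "w = B (1 - k * \<alpha>) v"
    have w: "J v = B (k * \<alpha>) w" using k \<alpha> B_B[of "k * \<alpha>" "1 - k * \<alpha>" v] by (simp add: w_def B_1)
    show "\<exists>g. (g \<longlongrightarrow> 0) at_top \<and> (\<forall>\<^sub>F t in at_top. t powr \<gamma> * norm (T t (B (\<alpha> * \<gamma>) x)) \<le> e * C1 + g t)"
    proof (intro exI conjI)
      have "((\<lambda>t. t powr - k) \<longlongrightarrow> 0) at_top" using k(1) by real_asymp
      then show "((\<lambda>t. C2 * norm w * t powr - k) \<longlongrightarrow> 0) at_top" by (rule tendsto_mult_right_zero)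
      show "\<forall>\<^sub>F t in at_top. t powr \<gamma> * norm (T t (B (\<alpha> * \<gamma>) x)) \<le> e * C1 + C2 * norm w * t powr - k"
        using eventually_gt_at_top[of 0]
      proof eventually_elim
        case (elim t)
        have "T t (B (\<alpha> * \<gamma>) x) = T t (B (\<alpha> * \<gamma>) (x - J v)) + T t (B (\<alpha> * \<gamma> + k * \<alpha>) w)"
          using B_B[of "\<alpha> * \<gamma>" "k * \<alpha>" w] k \<alpha> g by (simp add: w blinfun.bilinear_simps)
        then have "norm (T t (B (\<alpha> * \<gamma>) x)) \<le> C1 * t powr - \<gamma> * norm (x - J v) + C2 * t powr - (\<gamma> + k) * norm w"
          using norm_triangle_mono[OF C1(2)[OF elim] C2[OF elim]] by simp
        also have "\<dots> \<le> C1 * t powr - \<gamma> * e + C2 * t powr - (\<gamma> + k) * norm w"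
          using v C1(1) by (intro add_right_mono mult_left_mono) auto
        finally have "t powr \<gamma> * norm (T t (B (\<alpha> * \<gamma>) x)) \<le> t powr \<gamma> * (C1 * t powr - \<gamma> * e + C2 * t powr - (\<gamma> + k) * norm w)"
          by (rule mult_left_mono) simp
        also have "\<dots> = (t powr \<gamma> * t powr - \<gamma>) * (e * C1) + C2 * norm w * (t powr \<gamma> * t powr - (\<gamma> + k))"
          by (simp add: algebra_simps)
        also have "\<dots> = e * C1 + C2 * norm w * t powr - k"
          using elim by (simp add: powr_add[symmetric])
        finally show ?case .
      qed
    qed
  qed
qed

lemma decay_imp_lapl_powr:
  assumes "decay \<alpha> 1" "\<alpha> > 0" "0 < \<gamma>" "\<gamma> < 1 / 2"
  shows "((\<lambda>\<xi>. \<xi> powr (1 - 2 * \<gamma>) * lapl \<xi> (B (\<alpha> * \<gamma>) x)) \<longlongrightarrow> 0) (at_right 0)"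
  unfolding lapl_def
proof (rule Laplace_powr_tendsto_0[OF norm_T_sq])
  have "((\<lambda>t. (t powr \<gamma> * norm (T t (B (\<alpha> * \<gamma>) x)))\<^sup>2) \<longlongrightarrow> 0\<^sup>2) at_top"
    using assms by (intro tendsto_power decay_imp_tendsto) auto
  then have "((\<lambda>t. (t powr \<gamma>)\<^sup>2 * (norm (T t (B (\<alpha> * \<gamma>) x)))\<^sup>2) \<longlongrightarrow> 0) at_top"
    by (simp add: power_mult_distrib)
  moreover have "(t powr \<gamma>)\<^sup>2 = t powr (2 * \<gamma>)" for t :: real
    by (simp add: power2_eq_square powr_add[symmetric])
  ultimately show "((\<lambda>t. t powr (2 * \<gamma>) * (norm (T t (B (\<alpha> * \<gamma>) x)))\<^sup>2) \<longlongrightarrow> 0) at_top" by simp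
qed (use assms in auto)

lemma decay_imp_lapl_log:
  assumes "decay \<alpha> 1" "\<alpha> > 0"
  shows "((\<lambda>\<xi>. 1 / ln (1 / \<xi>) * lapl \<xi> (B (\<alpha> / 2) x)) \<longlongrightarrow> 0) (at_right 0)"
  unfolding lapl_def
proof (rule Laplace_log_tendsto_0[OF norm_T_sq])
  have "((\<lambda>t. (t powr (1 / 2) * norm (T t (B (\<alpha> * (1 / 2)) x)))\<^sup>2) \<longlongrightarrow> 0\<^sup>2) at_top"
    using assms by (intro tendsto_power decay_imp_tendsto) auto
  moreover have "\<forall>\<^sub>F t in at_top. (t powr (1 / 2) * norm (T t (B (\<alpha> * (1 / 2)) x)))\<^sup>2 = t * (norm (T t (B (\<alpha> / 2) x)))\<^sup>2"
    using eventually_gt_at_top[of 0] by eventually_elim (simp add: power_mult_distrib powr_half_sqrt)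
  ultimately have "((\<lambda>t. t * (norm (T t (B (\<alpha> / 2) x)))\<^sup>2) \<longlongrightarrow> 0\<^sup>2) at_top"
    by (rule Lim_transform_eventually)
  then show "((\<lambda>t. t * (norm (T t (B (\<alpha> / 2) x)))\<^sup>2) \<longlongrightarrow> 0) at_top" by simp
qed

text \<open>The time from which the bound \<open>c\<close> holds depends on the vector. Before that
  time the weight is bounded by \<open>loc\<close> and the semigroup by \<open>K\<close>, so the
  weighted operators are pointwise bounded from \<open>t1\<close> on and uniform boundedness
  applies.\<close>

lemma pointwise_decay_imp_uniform:
  fixes \<omega> :: "real \<Rightarrow> real" and S :: "'a \<Rightarrow>\<^sub>L 'a"
  assumes t1: "t1 \<ge> 0" and nonneg: "\<And>t. t \<ge> t1 \<Longrightarrow> \<omega> t \<ge> 0"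
    and loc: "\<And>t0. \<exists>W. \<forall>t\<in>{t1..t0}. \<omega> t \<le> W"
    and pw: "\<And>x. eventually (\<lambda>t. \<omega> t * norm (T t (S x)) \<le> c) at_top"
  shows "\<exists>C\<ge>0. \<forall>t\<ge>t1. \<forall>x. \<omega> t * norm (T t (S x)) \<le> C * norm x"
proof -
  have "\<exists>C. \<forall>t\<in>{t1..}. norm (\<omega> t *\<^sub>R (T t o\<^sub>L S)) \<le> C"
  proof (rule uniform_boundedness)
    fix x
    obtain t0 where t0: "\<And>t. t \<ge> t0 \<Longrightarrow> \<omega> t * norm (T t (S x)) \<le> c"
      using pw[of x] unfolding eventually_at_top_linorder by blast
    obtain W where W: "\<forall>t\<in>{t1..t0}. \<omega> t \<le> W" using loc by blast
    show "\<exists>C. \<forall>t\<in>{t1..}. norm ((\<omega> t *\<^sub>R (T t o\<^sub>L S)) x) \<le> C"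
    proof (intro exI ballI)
      fix t assume t: "t \<in> {t1..}"
      have eq: "norm ((\<omega> t *\<^sub>R (T t o\<^sub>L S)) x) = \<omega> t * norm (T t (S x))"
        using nonneg[of t] t by (simp add: blinfun.bilinear_simps)
      show "norm ((\<omega> t *\<^sub>R (T t o\<^sub>L S)) x) \<le> max c (W * (K * norm (S x)))"
      proof (cases "t \<ge> t0")
        case False
        then have "\<omega> t \<le> W" using W t by auto
        then have "\<omega> t * norm (T t (S x)) \<le> W * (K * norm (S x))"
          using norm_T[of t "S x"] t t1 nonneg[of t] by (intro mult_mono) auto
        then show ?thesis unfolding eq by linarith
      next
        case True
        then show ?thesis unfolding eq using t0[of t] by linarith
      qed
    qed
  qed
  then obtain C where C: "\<And>t. t \<ge> t1 \<Longrightarrow> norm (\<omega> t *\<^sub>R (T t o\<^sub>L S)) \<le> C" by auto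
  have "\<omega> t * norm (T t (S x)) \<le> \<bar>C\<bar> * norm x" if "t \<ge> t1" for t x
  proof -
    have "\<omega> t * norm (T t (S x)) = norm ((\<omega> t *\<^sub>R (T t o\<^sub>L S)) x)"
      using nonneg[OF that] by (simp add: blinfun.bilinear_simps)
    also have "\<dots> \<le> \<bar>C\<bar> * norm x"
      using C[OF that] by (intro order_trans[OF norm_blinfun] mult_right_mono) auto
    finally show ?thesis .
  qed
  then show ?thesis by (intro exI[of _ "\<bar>C\<bar>"]) auto
qed

lemma eventually_at_right_0_inverse:
  "eventually P (at_right (0::real)) \<Longrightarrow> eventually (\<lambda>t. P (1 / t)) at_top"
  using filterlim_inverse_at_right_top by (simp add: filterlim_iff divide_inverse)

text \<open>At \<xi> = 1/t the estimate \<open>norm_T_le_lapl\<close>, multiplied by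
  t^(2\<gamma>-1), contains exactly the weighted transform, which is eventually below 1. After
  uniform boundedness the rate \<gamma> for the exponent \<alpha>\<gamma> is scaled by
  1/\<gamma>.\<close>

lemma lapl_powr_imp_decay:
  assumes \<alpha>: "\<alpha> > 0" and \<gamma>: "0 < \<gamma>"
    and lim: "\<And>x. ((\<lambda>\<xi>. \<xi> powr (1 - 2 * \<gamma>) * lapl \<xi> (B (\<alpha> * \<gamma>) x)) \<longlongrightarrow> 0) (at_right 0)"
  shows "decay \<alpha> 1"
proof -
  have pw: "eventually (\<lambda>t. t powr \<gamma> * norm (T t (B (\<alpha> * \<gamma>) x)) \<le> K * exp 1) at_top" for x
    using eventually_at_right_0_inverse[OF order_tendstoD(2)[OF lim zero_less_one, of x]] eventually_gt_at_top[of 0]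
  proof eventually_elim
    case (elim t)
    let ?l = "lapl (1 / t) (B (\<alpha> * \<gamma>) x)"
    have "(t powr \<gamma> * norm (T t (B (\<alpha> * \<gamma>) x)))\<^sup>2 = t powr (2 * \<gamma> - 1) * (t * (norm (T t (B (\<alpha> * \<gamma>) x)))\<^sup>2)"
    proof -
      have "(t powr \<gamma>)\<^sup>2 = t powr (2 * \<gamma> - 1) * t"
        using elim by (simp add: power2_eq_square powr_diff powr_add[symmetric])
      then show ?thesis by (simp add: power_mult_distrib)
    qed
    also have "\<dots> \<le> t powr (2 * \<gamma> - 1) * ((K * exp 1)\<^sup>2 * ?l)"
      using elim by (intro mult_left_mono norm_T_le_lapl) auto
    also have "\<dots> = (K * exp 1)\<^sup>2 * ((1 / t) powr (1 - 2 * \<gamma>) * ?l)"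
    proof -
      have "(1 / t) powr (1 - 2 * \<gamma>) = t powr (2 * \<gamma> - 1)"
        using elim by (simp add: powr_divide powr_minus_divide[symmetric])
      then show ?thesis by simp
    qed
    also have "\<dots> \<le> (K * exp 1)\<^sup>2 * 1" using elim by (intro mult_left_mono) auto
    finally show ?case using K_ge_1 by (simp add: power2_le_iff_abs_le)
  qed
  have "\<exists>C\<ge>0. \<forall>t\<ge>1. \<forall>x. t powr \<gamma> * norm (T t (B (\<alpha> * \<gamma>) x)) \<le> C * norm x"
  proof (rule pointwise_decay_imp_uniform[OF _ _ _ pw])
    show "\<exists>W. \<forall>t\<in>{1..t0}. t powr \<gamma> \<le> W" for t0 :: real
      using \<gamma> by (intro exI[of _ "t0 powr \<gamma>"]) (auto intro!: powr_mono2)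
  qed auto
  then obtain C where C: "C \<ge> 0" "\<And>t x. t \<ge> 1 \<Longrightarrow> t powr \<gamma> * norm (T t (B (\<alpha> * \<gamma>) x)) \<le> C * norm x" by auto
  have "norm (T t (B (\<alpha> * \<gamma>) x)) \<le> (C + K * norm (B (\<alpha> * \<gamma>))) * t powr - \<gamma> * norm x" if t: "t > 0" for t x
  proof (cases "t \<ge> 1")
    case True
    then have "norm (T t (B (\<alpha> * \<gamma>) x)) \<le> C * t powr - \<gamma> * norm x"
      using C(2)[OF True, of x] by (simp add: powr_minus field_simps)
    also have "\<dots> \<le> (C + K * norm (B (\<alpha> * \<gamma>))) * t powr - \<gamma> * norm x"
      using K_ge_1 by (intro mult_right_mono) auto
    finally show ?thesis .
  next
    case False
    \<comment> \<open>For t < 1 boundedness suffices, since t^(-\<gamma>) \<ge> 1.\<close>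
    have "norm (T t (B (\<alpha> * \<gamma>) x)) \<le> K * (norm (B (\<alpha> * \<gamma>)) * norm x)"
      using t K_ge_1 by (intro order_trans[OF norm_T] mult_left_mono norm_blinfun) auto
    also have "\<dots> \<le> t powr - \<gamma> * (K * (norm (B (\<alpha> * \<gamma>)) * norm x))"
    proof -
      have "t powr \<gamma> \<le> 1" using False t \<gamma> by (simp add: powr_le1)
      then have "1 \<le> t powr - \<gamma>" using t by (simp add: powr_minus one_le_inverse_iff)
      from mult_right_mono[OF this, of "K * (norm (B (\<alpha> * \<gamma>)) * norm x)"]
      show ?thesis using K_ge_1 by simp
    qed
    also have "\<dots> \<le> t powr - \<gamma> * ((C + K * norm (B (\<alpha> * \<gamma>))) * norm x)"
      using C by (intro mult_left_mono) (auto simp: algebra_simps)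
    finally show ?thesis by (simp add: mult_ac)
  qed
  then have "decay (\<alpha> * \<gamma>) \<gamma>"
    unfolding decay_def using C K_ge_1 by (intro exI[of _ "C + K * norm (B (\<alpha> * \<gamma>))"]) auto
  then show ?thesis using decay_scale[of "\<alpha> * \<gamma>" \<gamma> "1 / \<gamma>"] \<alpha> \<gamma> by simp
qed

text \<open>The rate sqrt(ln t / t) is not a power of t, so \<open>decay_scale\<close> does not
  apply; instead T(t)(-A)^(-\<alpha>) is the square of T(t/2)(-A)^(-\<alpha>/2). The weight is used
  from t = 2 on, away from the zero of ln, so the final bound starts at 4; the factor 2 comes from
  halving t.\<close>

lemma lapl_log_imp_bound:
  assumes \<alpha>: "\<alpha> > 0"
    and lim: "\<And>x. ((\<lambda>\<xi>. 1 / ln (1 / \<xi>) * lapl \<xi> (B (\<alpha> / 2) x)) \<longlongrightarrow> 0) (at_right 0)"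
  shows "\<exists>C\<ge>0. \<forall>t\<ge>4. \<forall>x. norm (T t (B \<alpha> x)) \<le> C * (ln t / t) * norm x"
proof -
  define \<omega> where "\<omega> t = sqrt (t / ln t)" for t :: real
  have pw: "eventually (\<lambda>t. \<omega> t * norm (T t (B (\<alpha> / 2) x)) \<le> K * exp 1) at_top" for x
    using eventually_at_right_0_inverse[OF order_tendstoD(2)[OF lim zero_less_one, of x]] eventually_gt_at_top[of 1]
  proof eventually_elim
    case (elim t)
    let ?l = "lapl (1 / t) (B (\<alpha> / 2) x)"
    have l: "ln t > 0" using elim by simp
    have "(\<omega> t * norm (T t (B (\<alpha> / 2) x)))\<^sup>2 = 1 / ln t * (t * (norm (T t (B (\<alpha> / 2) x)))\<^sup>2)"
      using elim l by (simp add: power_mult_distrib \<omega>_def)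
    also have "\<dots> \<le> 1 / ln t * ((K * exp 1)\<^sup>2 * ?l)"
      using elim l by (intro mult_left_mono norm_T_le_lapl) auto
    also have "\<dots> = (K * exp 1)\<^sup>2 * (1 / ln (1 / (1 / t)) * ?l)" by simp
    also have "\<dots> \<le> (K * exp 1)\<^sup>2 * 1" using elim by (intro mult_left_mono) auto
    finally show ?case using K_ge_1 by (simp add: power2_le_iff_abs_le)
  qed
  have "\<exists>C\<ge>0. \<forall>t\<ge>2. \<forall>x. \<omega> t * norm (T t (B (\<alpha> / 2) x)) \<le> C * norm x"
  proof (rule pointwise_decay_imp_uniform[OF _ _ _ pw])
    show "\<exists>W. \<forall>t\<in>{2..t0}. \<omega> t \<le> W" for t0 :: real
    proof (intro exI[of _ "sqrt (t0 / ln 2)"] ballI)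
      fix t assume "t \<in> {2..t0}"
      then show "\<omega> t \<le> sqrt (t0 / ln 2)"
        unfolding \<omega>_def by (intro real_sqrt_le_mono frac_le) auto
    qed
  qed (auto simp: \<omega>_def)
  then obtain C where C: "C \<ge> 0" "\<And>t x. t \<ge> 2 \<Longrightarrow> \<omega> t * norm (T t (B (\<alpha> / 2) x)) \<le> C * norm x" by auto
  have "norm (T t (B \<alpha> x)) \<le> 2 * C\<^sup>2 * (ln t / t) * norm x" if t: "t \<ge> 4" for t x
  proof -
    define s where "s = t / 2"
    have s: "s \<ge> 2" using t by (simp add: s_def)
    have l: "ln s > 0" using s by simp
    have w: "\<omega> s > 0" using s l by (simp add: \<omega>_def)
    have "T t (B \<alpha> x) = T s (T s (B (\<alpha> / 2) (B (\<alpha> / 2) x)))"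
      using T_add[of s s "B \<alpha> x"] s \<alpha> B_B[of "\<alpha> / 2" "\<alpha> / 2" x] by (simp add: s_def)
    also have "T s (B (\<alpha> / 2) (B (\<alpha> / 2) x)) = B (\<alpha> / 2) (T s (B (\<alpha> / 2) x))"
      using s by (intro T_B) simp
    finally have "T t (B \<alpha> x) = T s (B (\<alpha> / 2) (T s (B (\<alpha> / 2) x)))" .
    then have "\<omega> s * norm (T t (B \<alpha> x)) \<le> C * norm (T s (B (\<alpha> / 2) x))" using C(2)[OF s] by simp
    then have "\<omega> s * (\<omega> s * norm (T t (B \<alpha> x))) \<le> \<omega> s * (C * norm (T s (B (\<alpha> / 2) x)))"
      using w by (intro mult_left_mono) auto
    also have "\<dots> \<le> C * (C * norm x)"
      using mult_left_mono[OF C(2)[OF s, of x] C(1)] by (simp add: mult_ac)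
    finally have "(s / ln s) * norm (T t (B \<alpha> x)) \<le> C\<^sup>2 * norm x"
      using s l by (simp add: \<omega>_def power2_eq_square mult.assoc[symmetric])
    then have "norm (T t (B \<alpha> x)) \<le> C\<^sup>2 * norm x * (ln s / s)"
      using s l by (simp add: field_simps)
    also have "\<dots> \<le> C\<^sup>2 * norm x * (2 * (ln t / t))"
    proof -
      have "ln s \<le> ln t" using s t by (simp add: s_def)
      then have "ln s / s \<le> 2 * (ln t / t)" using t by (simp add: s_def divide_right_mono)
      then show ?thesis by (intro mult_left_mono) auto
    qed
    finally show ?thesis by (simp add: mult_ac)
  qed
  then show ?thesis by (intro exI[of _ "2 * C\<^sup>2"]) auto
qed

text \<open>For t below the threshold \<open>t0\<close> boundedness of the semigroup gives a
  constant, which t0/t \<ge> 1 turns into a multiple of 1/t.\<close>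

lemma decay_iff_bigo:
  "(\<lambda>t. norm (T t o\<^sub>L B a)) \<in> O[at_top](\<lambda>t. 1 / t) \<longleftrightarrow> decay a 1"
proof
  assume "(\<lambda>t. norm (T t o\<^sub>L B a)) \<in> O[at_top](\<lambda>t. 1 / t)"
  then obtain c where c: "c > 0" "eventually (\<lambda>t. norm (T t o\<^sub>L B a) \<le> c * \<bar>1 / t\<bar>) at_top"
    by (auto elim!: landau_o.bigE)
  then obtain t0 where t0: "t0 > 0" "\<And>t. t \<ge> t0 \<Longrightarrow> norm (T t o\<^sub>L B a) \<le> c * \<bar>1 / t\<bar>"
    unfolding eventually_at_top_linorder by (meson less_le_trans linorder_le_cases zero_less_one)
  have "norm (T t (B a x)) \<le> (c + K * norm (B a) * t0) * t powr - 1 * norm x" if t: "t > 0" for t x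
  proof -
    have "norm (T t o\<^sub>L B a) \<le> (c + K * norm (B a) * t0) / t"
    proof (cases "t \<ge> t0")
      case True
      have "norm (T t o\<^sub>L B a) \<le> c / t" using t0(2)[OF True] t by simp
      also have "\<dots> \<le> (c + K * norm (B a) * t0) / t" using t t0 K_ge_1 by (intro divide_right_mono) auto
      finally show ?thesis .
    next
      case False
      have "norm (T t o\<^sub>L B a) \<le> norm (T t) * norm (B a)" by (rule norm_blinfun_compose)
      also have "\<dots> \<le> K * norm (B a)" using t by (intro mult_right_mono T_bound) auto
      also have "\<dots> \<le> K * norm (B a) * (t0 / t)"
      proof -
        have "1 \<le> t0 / t" using False t by simp
        from mult_left_mono[OF this, of "K * norm (B a)"] show ?thesis using K_ge_1 by simp
      qed
      also have "\<dots> \<le> (c + K * norm (B a) * t0) / t" using c t by (simp add: divide_right_mono)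
      finally show ?thesis .
    qed
    then have "norm ((T t o\<^sub>L B a) x) \<le> (c + K * norm (B a) * t0) / t * norm x"
      by (intro order_trans[OF norm_blinfun mult_right_mono]) auto
    then show ?thesis using t by (simp add: powr_minus_divide)
  qed
  then show "decay a 1" unfolding decay_def using c t0 K_ge_1
    by (intro exI[of _ "c + K * norm (B a) * t0"]) auto
next
  assume "decay a 1"
  then obtain C where C: "C \<ge> 0" "\<And>t x. t > 0 \<Longrightarrow> norm (T t (B a x)) \<le> C * t powr - 1 * norm x"
    unfolding decay_def by blast
  have "norm (T t o\<^sub>L B a) \<le> C * norm (1 / t)" if "t > 0" for t
    using C that by (intro norm_blinfun_bound) (auto simp: powr_minus_divide)
  then show "(\<lambda>t. norm (T t o\<^sub>L B a)) \<in> O[at_top](\<lambda>t. 1 / t)"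
    by (intro bigoI[of _ C] eventually_mono[OF eventually_gt_at_top[of 0]]) simp
qed

end

section \<open>The generator\<close>

context
  fixes T :: "real \<Rightarrow> 'a::complex_hilbert_space \<Rightarrow>\<^sub>L 'a" and D :: "'a set" and A :: "'a \<Rightarrow> 'a"
  assumes ub: "uniformly_bounded_semigroup T" and gen: "is_generator T D A"
    and res0: "0 \<in> resolvent_set D A"
begin

lemma semigroup:
  shows "t \<ge> 0 \<Longrightarrow> T t (c *\<^sub>C x) = c *\<^sub>C T t x"
    and "T 0 x = x"
    and "s \<ge> 0 \<Longrightarrow> t \<ge> 0 \<Longrightarrow> T (s + t) x = T s (T t x)"
    and "((\<lambda>t. T t x) \<longlongrightarrow> x) (at_right 0)"
  using ub unfolding uniformly_bounded_semigroup_def C0_semigroup_def by auto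

lemma generator_D: "x \<in> D \<Longrightarrow> ((\<lambda>h. (T h x - x) /\<^sub>R h) \<longlongrightarrow> A x) (at_right 0)"
  using gen by (simp add: is_generator_def)

lemma generator_I:
  assumes "((\<lambda>h. (T h x - x) /\<^sub>R h) \<longlongrightarrow> y) (at_right 0)"
  shows "x \<in> D" "A x = y"
proof -
  show "x \<in> D" using gen assms unfolding is_generator_def by blast
  show "A x = y" using tendsto_unique[OF _ generator_D[OF \<open>x \<in> D\<close>] assms] by simp
qed

lemma inverse_generator:
  shows "resolvent D A 0 y \<in> D" and "A (resolvent D A 0 y) = - y"
    and "x \<in> D \<Longrightarrow> resolvent D A 0 (- A x) = x"
proof -
  have bij: "bij_betw (\<lambda>x. 0 *\<^sub>C x - A x) D UNIV" and bl: "bounded_linear (inv_into D (\<lambda>x. 0 *\<^sub>C x - A x))"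
    using res0 by (auto simp: resolvent_set_def)
  have ap: "resolvent D A 0 y = inv_into D (\<lambda>x. 0 *\<^sub>C x - A x) y" for y
    unfolding resolvent_def by (simp add: bounded_linear_Blinfun_apply[OF bl])
  show "resolvent D A 0 y \<in> D"
    unfolding ap using bij by (intro inv_into_into) (simp add: bij_betw_def)
  have "0 *\<^sub>C resolvent D A 0 y - A (resolvent D A 0 y) = y"
    unfolding ap using bij_betw_inv_into_right[OF bij, of y] by simp
  then show "A (resolvent D A 0 y) = - y"
    by (simp add: scaleC.zero_left) (metis minus_minus)
  show "resolvent D A 0 (- A x) = x" if "x \<in> D"
    unfolding ap using bij_betw_inv_into_left[OF bij that] by (simp add: scaleC.zero_left)
qed

text \<open>The definition of the resolvent only provides real linearity. That \<open>J\<close> is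
  complex homogeneous and commutes with \<open>T t\<close> is read off from difference quotients:
  their limits determine \<open>A\<close> on complex multiples of \<open>J x\<close> and on
  \<open>T t (J x)\<close>, and applying \<open>J\<close> undoes \<open>A\<close>.\<close>

lemma bounded_semigroup_exists: "\<exists>K. bounded_semigroup T (resolvent D A 0) K"
proof -
  obtain K' where K': "\<And>t. t \<ge> 0 \<Longrightarrow> norm (T t) \<le> K'"
    using ub unfolding uniformly_bounded_semigroup_def bdd_above_def by auto
  have right: "((\<lambda>h. (T h (resolvent D A 0 x) - resolvent D A 0 x) /\<^sub>R h) \<longlongrightarrow> - x) (at_right 0)" for x
    using generator_D[OF inverse_generator(1)[of x]] by (simp add: inverse_generator(2))
  \<comment> \<open>The maximum secures K \<ge> 1 even on the zero space, where the norms
    vanish.\<close>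
  have "bounded_semigroup T (resolvent D A 0) (max 1 K')"
  proof
    fix t c x
    show "norm (T t) \<le> max 1 K'" if "t \<ge> 0" using K'[OF that] by simp
    let ?u = "resolvent D A 0 x"
    have "((\<lambda>h. c *\<^sub>C ((T h ?u - ?u) /\<^sub>R h)) \<longlongrightarrow> c *\<^sub>C (- x)) (at_right 0)"
      by (intro scaleC.tendsto right tendsto_const)
    moreover have "\<forall>\<^sub>F h in at_right 0. c *\<^sub>C ((T h ?u - ?u) /\<^sub>R h) = (T h (c *\<^sub>C ?u) - c *\<^sub>C ?u) /\<^sub>R h"
      using eventually_at_right_less
      by eventually_elim (simp add: semigroup scaleC.diff_right scaleC_scaleR_right)
    ultimately have "((\<lambda>h. (T h (c *\<^sub>C ?u) - c *\<^sub>C ?u) /\<^sub>R h) \<longlongrightarrow> - (c *\<^sub>C x)) (at_right 0)"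
      by (auto intro: Lim_transform_eventually simp: scaleC.minus_right)
    note 1 = generator_I[OF this]
    show "resolvent D A 0 (c *\<^sub>C x) = c *\<^sub>C ?u"
      using inverse_generator(3)[OF 1(1)] by (simp add: 1(2))
    assume t: "t \<ge> 0"
    have "((\<lambda>h. T t ((T h ?u - ?u) /\<^sub>R h)) \<longlongrightarrow> T t (- x)) (at_right 0)"
      by (intro tendsto_intros right)
    moreover have "\<forall>\<^sub>F h in at_right 0. T t ((T h ?u - ?u) /\<^sub>R h) = (T h (T t ?u) - T t ?u) /\<^sub>R h"
      using eventually_at_right_less
    proof eventually_elim
      case (elim h)
      have "T h (T t ?u) = T t (T h ?u)"
        using semigroup(3)[of h t ?u] semigroup(3)[of t h ?u] elim t by (simp add: add.commute)
      then show ?case by (simp add: blinfun.bilinear_simps)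
    qed
    ultimately have "((\<lambda>h. (T h (T t ?u) - T t ?u) /\<^sub>R h) \<longlongrightarrow> - T t x) (at_right 0)"
      by (auto intro: Lim_transform_eventually simp: blinfun.bilinear_simps)
    note 2 = generator_I[OF this]
    show "resolvent D A 0 (T t x) = T t ?u"
      using inverse_generator(3)[OF 2(1)] by (simp add: 2(2))
  qed (use semigroup right in auto)
  then show ?thesis ..
qed

text \<open>\<open>R z\<close> is a two-sided inverse of z - A, in both directions by
  \<open>R_J_identity\<close>: a point x of the domain is \<open>J v\<close> with
  \<open>v = - A x\<close>, and conversely R(z)y = J(y - z R(z)y), so R(z)y lies in the domain and A
  maps it to z R(z)y - y.\<close>

lemma resolvent_eq_R:
  assumes bs: "bounded_semigroup T (resolvent D A 0) K" and z: "Re z > 0"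
  shows "resolvent D A z = bounded_semigroup.R T (resolvent D A 0) z"
proof -
  interpret bounded_semigroup T "resolvent D A 0" K by fact
  let ?J = "resolvent D A 0" and ?f = "\<lambda>x. z *\<^sub>C x - A x"
  have left: "R z (?f x) = x" if "x \<in> D" for x
  proof -
    define v where "v = - A x"
    have x: "?J v = x" using inverse_generator(3)[OF that] by (simp add: v_def)
    have "R z (?f x) = R z (z *\<^sub>C x + v)" by (simp add: v_def)
    also have "\<dots> = R z v + z *\<^sub>C ?J (R z v)"
      using R_J[OF z, of v] by (simp add: blinfun.bilinear_simps R_scaleC z x)
    also have "\<dots> = x" using R_J_identity[OF z, of v] x by simp
    finally show ?thesis .
  qed
  have right: "R z y \<in> D \<and> ?f (R z y) = y" for y
  proof -
    define v where "v = y - z *\<^sub>C R z y"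
    have v: "R z y = ?J v"
      using R_J_identity[OF z, of y] by (simp add: v_def blinfun.bilinear_simps J_scaleC eq_diff_eq)
    have "R z y \<in> D" "A (R z y) = - v" unfolding v by (rule inverse_generator)+
    then have "R z y \<in> D" "A (R z y) = - (y - z *\<^sub>C R z y)" by (simp_all add: v_def)
    then show ?thesis by simp
  qed
  have "inj_on ?f D" by (rule inj_on_inverseI[where g = "R z"]) (rule left)
  then have "inv_into D ?f y = R z y" for y
    using right[of y] by (intro inv_into_f_eq) auto
  then have "inv_into D ?f = blinfun_apply (R z)" by blast
  then show ?thesis by (simp add: resolvent_def blinfun_apply_inverse)
qed

end

theorem proposition3p1:
  fixes T :: "real \<Rightarrow> 'a::complex_hilbert_space \<Rightarrow>\<^sub>L 'a"
    and D :: "'a set" and A :: "'a \<Rightarrow> 'a" and \<alpha> :: real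
  assumes "uniformly_bounded_semigroup T"
    and "is_generator T D A"
    and "range (\<lambda>\<eta>::real. \<i> * complex_of_real \<eta>) \<subseteq> resolvent_set D A"
    and "\<alpha> > 0"
  shows
    "((\<lambda>t. norm (T t o\<^sub>L inv_frac_power D A \<alpha>)) \<in> O[at_top](\<lambda>t. 1 / t)
        \<longleftrightarrow> (\<exists>\<gamma>\<in>{0<..<1/2}. cond_P D A \<alpha> \<gamma>)) \<and>
     ((\<lambda>t. norm (T t o\<^sub>L inv_frac_power D A \<alpha>)) \<in> O[at_top](\<lambda>t. 1 / t)
        \<longleftrightarrow> (\<forall>\<gamma>\<in>{0<..<1/2}. cond_P D A \<alpha> \<gamma>)) \<and>
     ((\<lambda>t. norm (T t o\<^sub>L inv_frac_power D A \<alpha>)) \<in> O[at_top](\<lambda>t. 1 / t)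
        \<longrightarrow> cond_log D A \<alpha>) \<and>
     (cond_log D A \<alpha>
        \<longrightarrow> (\<lambda>t. norm (T t o\<^sub>L inv_frac_power D A \<alpha>)) \<in> O[at_top](\<lambda>t. ln t / t))"
proof -
  have res0: "0 \<in> resolvent_set D A"
    using subsetD[OF assms(3) rangeI, of 0] by simp
  obtain K where bs: "bounded_semigroup T (resolvent D A 0) K"
    using bounded_semigroup_exists[OF assms(1,2) res0] by blast
  interpret bounded_semigroup T "resolvent D A 0" K by fact
  have R: "resolvent D A z = R z" if "Re z > 0" for z
    by (rule resolvent_eq_R[OF assms(1,2) res0 bs that])
  have B: "inv_frac_power D A a = B a" for a
  proof -
    \<comment> \<open>Only s > 0 enters the integral, and there the two resolvents agree.\<close>
    have "integral {0<..} (\<lambda>s. s powr - frac a *\<^sub>R resolvent D A (complex_of_real s))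
        = integral {0<..} (\<lambda>s. s powr - frac a *\<^sub>R Rr (s + 0))"
      by (intro Henstock_Kurzweil_Integration.integral_cong) (simp add: Rr_def R)
    then show ?thesis
      using frac_lt_1[of a] by (simp add: inv_frac_power_def B_def shifted_power_def)
  qed
  have S: "resolvent_sq_integral D A \<xi> y = 2 * pi * lapl \<xi> y" if "\<xi> > 0" for \<xi> y
    using resolvent_sq_eq_lapl[OF that, of y] that by (simp add: resolvent_sq_integral_def R)
  have scale: "((\<lambda>\<xi>. w \<xi> * resolvent_sq_integral D A \<xi> y) \<longlongrightarrow> 0) (at_right 0)
      \<longleftrightarrow> ((\<lambda>\<xi>. w \<xi> * lapl \<xi> y) \<longlongrightarrow> 0) (at_right 0)" for w y
  proof -
    have "((\<lambda>\<xi>. w \<xi> * resolvent_sq_integral D A \<xi> y) \<longlongrightarrow> 0) (at_right 0)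
        \<longleftrightarrow> ((\<lambda>\<xi>. 2 * pi * (w \<xi> * lapl \<xi> y)) \<longlongrightarrow> 2 * pi * 0) (at_right 0)"
      using eventually_at_right_less[of "0::real"]
      by (intro filterlim_cong) (auto elim!: eventually_mono simp: S)
    also have "\<dots> \<longleftrightarrow> ((\<lambda>\<xi>. w \<xi> * lapl \<xi> y) \<longlongrightarrow> 0) (at_right 0)"
      by (rule tendsto_mult_left_iff) simp
    finally show ?thesis .
  qed
  have P: "cond_P D A \<alpha> \<gamma> \<longleftrightarrow> decay \<alpha> 1" if "\<gamma> \<in> {0<..<1/2}" for \<gamma>
    using that assms(4) decay_imp_lapl_powr[of \<alpha> \<gamma>] lapl_powr_imp_decay[of \<alpha> \<gamma>]
    unfolding cond_P_def B scale by auto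
  \<comment> \<open>By \<open>P\<close> each single condition is equivalent to
    \<open>decay \<alpha> 1\<close>. Since the interval of admissible \<gamma> is nonempty, both the
    existential and the universal form are then equivalent to it.\<close>
  have "(1/4 :: real) \<in> {0<..<1/2}" by simp
  then have a: "decay \<alpha> 1 \<longleftrightarrow> (\<exists>\<gamma>\<in>{0<..<1/2}. cond_P D A \<alpha> \<gamma>)"
    "decay \<alpha> 1 \<longleftrightarrow> (\<forall>\<gamma>\<in>{0<..<1/2}. cond_P D A \<alpha> \<gamma>)"
    using P by blast+
  have b: "cond_log D A \<alpha>" if "decay \<alpha> 1"
    using decay_imp_lapl_log[OF that assms(4)] unfolding cond_log_def B scale by blast
  have c: "(\<lambda>t. norm (T t o\<^sub>L B \<alpha>)) \<in> O[at_top](\<lambda>t. ln t / t)" if "cond_log D A \<alpha>"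
  proof -
    from that have "\<exists>C\<ge>0. \<forall>t\<ge>4. \<forall>x. norm (T t (B \<alpha> x)) \<le> C * (ln t / t) * norm x"
      unfolding cond_log_def B scale by (intro lapl_log_imp_bound[OF assms(4)]) (rule spec)
    then obtain C where C: "C \<ge> 0" "\<And>t x. t \<ge> 4 \<Longrightarrow> norm (T t (B \<alpha> x)) \<le> C * (ln t / t) * norm x"
      by blast
    have "norm (T t o\<^sub>L B \<alpha>) \<le> C * norm (ln t / t)" if "t \<ge> 4" for t
      using C that by (intro norm_blinfun_bound) auto
    then show ?thesis
      by (intro bigoI[of _ C] eventually_mono[OF eventually_ge_at_top[of 4]]) simp
  qed
  show ?thesis unfolding B decay_iff_bigo using a b c by blast
qed

end
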